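(* Let $N \geq 2$ be an integer and let $0 < \alpha < 1$. Then there exists a constant $C = C(\alpha, N) > 0$ such that $$\|u\|_{L^{N/(N-\alpha)}(\mathbb{R}^N)} \leq C \,\|D^\alpha u\|_{L^1(\mathbb{R}^N;\mathbb{R}^N)}$$ for all $u \in C_c^\infty(\mathbb{R}^N)$, where $D^\alpha u$ is the Riesz fractional gradient of order $\alpha$ of $u$.
   Context: Functions are real-valued. For an integer $N\ge 2$ and $\beta \in (0,N)$, the Riesz potential of order $\beta$ of a function $u$ is $$I_\beta u(x) := \frac{1}{\gamma(\beta)} \int_{\mathbb{R}^N} \frac{u(y)}{|x-y|^{N-\beta}} \, dy, \qquad \gamma(\beta) = \frac{\pi^{N/2}\, 2^\beta\, \Gamma\left(\frac{\beta}{2}\right)}{\Gamma\left(\frac{N-\beta}{2}\right)},$$ whenever it is well-defined. For $0<\alpha<1$, the Riesz fractional gradient of order $\alpha$ of $u$ is the vector field $D^\alpha u := D I_{1-\alpha} u$, i.e. the (usual) gradient of the Riesz potential of order $1-\alpha$ of $u$. *)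

theory Defs
  imports "HOL-Analysis.Analysis"
begin

definition riesz_const :: "nat \<Rightarrow> real \<Rightarrow> real" where
  "riesz_const N \<beta> =
     pi powr (real N / 2) * 2 powr \<beta> * Gamma (\<beta> / 2) / Gamma ((real N - \<beta>) / 2)"

text \<open>The integrand takes the value 0 at \<open>y = x\<close> (division by zero), which is irrelevant on a
  null set. If the integral does not converge absolutely, the value of the potential is 0.\<close>

definition riesz_potential :: "real \<Rightarrow> (real ^ 'n \<Rightarrow> real) \<Rightarrow> real ^ 'n \<Rightarrow> real" where
  "riesz_potential \<beta> u x =
     1 / riesz_const CARD('n) \<beta> *
       (LINT y|lborel. u y / norm (x - y) powr (real CARD('n) - \<beta>))"

text \<open>Unspecified at points where \<open>f\<close> is not differentiable.\<close>

definition gradient :: "('a::real_inner \<Rightarrow> real) \<Rightarrow> 'a \<Rightarrow> 'a" where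
  "gradient f x = (THE D. GDERIV f x :> D)"

definition riesz_gradient :: "real \<Rightarrow> (real ^ 'n \<Rightarrow> real) \<Rightarrow> real ^ 'n \<Rightarrow> real ^ 'n" where
  "riesz_gradient \<alpha> u = gradient (riesz_potential (1 - \<alpha>) u)"

primrec Ck :: "nat \<Rightarrow> ('a::real_normed_vector \<Rightarrow> real) \<Rightarrow> bool" where
  "Ck 0 f \<longleftrightarrow> continuous_on UNIV f"
| "Ck (Suc k) f \<longleftrightarrow>
     (\<forall>x. f differentiable (at x)) \<and> (\<forall>v. Ck k (\<lambda>x. frechet_derivative f (at x) v))"

definition test_functions :: "('a::real_normed_vector \<Rightarrow> real) set" where
  "test_functions = {u. (\<forall>k. Ck k u) \<and> compact (closure {x. u x \<noteq> 0})}"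

text \<open>The \<open>L\<^sup>p\<close> norm, for finite \<open>p > 0\<close>, with value \<open>\<infinity>\<close> when the
  \<open>p\<close>-th power of the norm is not integrable; there is no real power on \<^typ>\<open>ennreal\<close>.\<close>

definition Lp_norm :: "real \<Rightarrow> ('a::euclidean_space \<Rightarrow> 'b::real_normed_vector) \<Rightarrow> ennreal" where
  "Lp_norm p f =
     (let I = (\<integral>\<^sup>+ x. ennreal (norm (f x) powr p) \<partial>lborel)
      in if I = \<infinity> then \<infinity> else ennreal (enn2real I powr (1 / p)))"

end

theory Submission imports Defs begin

text \<open>
  Let \<open>s = 1 - \<alpha>\<close>, let \<open>v\<close> be the Riesz potential of order \<open>s\<close> of \<open>u\<close>, and \<open>p = N/(N - \<alpha>)\<close>.

  Inversion: \<open>u x\<close> is a constant multiple of the absolutely convergent integral of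
  \<open>(v x - v (x - z)) |z|\<^sup>-\<^sup>N\<^sup>-\<^sup>s\<close> over \<open>z\<close>. Writing the increments of \<open>v\<close> as integrals of its gradient
  and moving the gradient to \<open>u\<close>, the integral becomes the integral over \<open>y\<close> of \<open>\<lambda>(y) y \<bullet> \<nabla>u(x - y)\<close>, where
  \<open>\<lambda>\<close> (below: \<open>inv_weight\<close>) is positive and homogeneous of degree \<open>-N\<close>; integration along rays gives a multiple of \<open>u x\<close>.

  Hence it suffices to bound the integral over \<open>z\<close> of \<open>\<parallel>v - v(\<cdot> - z)\<parallel>\<^sub>p |z|\<^sup>-\<^sup>N\<^sup>-\<^sup>s\<close> by \<open>\<parallel>\<nabla>v\<parallel>\<^sub>1\<close>. The positive and
  negative parts of \<open>v\<close> are cut into layers between consecutive dyadic levels. For the layer between \<open>l\<close>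
  and \<open>2 l\<close>, with \<open>e\<close> the volume of \<open>{v > l}\<close> and \<open>m\<close> the integral of \<open>|\<nabla>v|\<close> over the
  layer, the \<open>L\<^sup>1\<close> norm of the increment by \<open>z\<close> is at most \<open>min (|z| m) (2 l e)\<close> and the increment is bounded by \<open>l\<close>. By
  interpolation the layer contributes at most a multiple of \<open>m\<^sup>s b\<^sup>1\<^sup>-\<^sup>s\<close> with \<open>b = l e powr (1 - 1/N)\<close>.
  A weak Sobolev inequality for each layer bounds the sum of the \<open>b\<close> by the sum of the \<open>m\<close>, which
  is at most \<open>2 \<parallel>\<nabla>v\<parallel>\<^sub>1\<close>.
\<close>

section \<open>Integration on Euclidean space\<close>

text \<open>The potential of order \<open>\<alpha>\<close> maps L1 only into weak L^p, so writing
  \<open>u\<close> as a potential of its fractional gradient is not enough. Truncation makes up for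
  the loss: the gradient of a dyadic layer lives on that layer alone, so weak-type estimates for
  single layers have right-hand sides that add up to a multiple of one L1 norm.

  Minkowski's inequality in L^p is replaced by duality. With \<open>A\<close> the integral of
  \<open>\<bar>u\<bar> powr p\<close>, the inversion formula is paired with
  \<open>\<bar>u\<bar> powr (p - 1)\<close>; Tonelli and Hoelder give
  \<open>A \<le> C * A powr (1 - 1/p) * m\<close>, and the power of \<open>A\<close> can be divided
  out because \<open>A\<close> is finite.

  The sum over the layers is bounded by absorbing half of it into itself, which again needs
  finiteness beforehand. It comes from the decay of \<open>v\<close> like the power
  \<open>-(N - s)\<close> of the norm: since \<open>N - s > N - 1\<close>, the quantity
  \<open>b\<close> stays bounded as the level tends to 0.

  The constant of the inversion formula is never evaluated; it only has to be nonzero, and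
  positivity of \<open>inv_weight\<close> gives that without Fourier transforms.\<close>

lemma nn_integral_lborel_affine:
  fixes f :: "'a::euclidean_space \<Rightarrow> ennreal"
  assumes [measurable]: "f \<in> borel_measurable borel" and c: "c \<noteq> 0"
  shows "(\<integral>\<^sup>+x. f x \<partial>lborel) = ennreal (\<bar>c\<bar> ^ DIM('a)) * (\<integral>\<^sup>+x. f (t + c *\<^sub>R x) \<partial>lborel)"
  by (subst lborel_affine[OF c, of t])
     (simp add: nn_integral_density nn_integral_distr nn_integral_cmult)

lemma nn_integral_lborel_reflect:
  fixes f :: "'a::euclidean_space \<Rightarrow> ennreal"
  assumes "f \<in> borel_measurable borel"
  shows "(\<integral>\<^sup>+x. f (t - x) \<partial>lborel) = (\<integral>\<^sup>+x. f x \<partial>lborel)"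
  using nn_integral_lborel_affine[OF assms, of "-1" t] by simp

lemma nn_integral_lborel_shift:
  fixes f :: "'a::euclidean_space \<Rightarrow> ennreal"
  assumes "f \<in> borel_measurable borel"
  shows "(\<integral>\<^sup>+x. f (x - t) \<partial>lborel) = (\<integral>\<^sup>+x. f x \<partial>lborel)"
  using nn_integral_lborel_affine[OF assms, of 1 "-t"] by simp

lemma integrable_lborel_affine:
  fixes f :: "'a::euclidean_space \<Rightarrow> 'b::{banach, second_countable_topology}"
  assumes f: "integrable lborel f" and c: "c \<noteq> 0"
  shows "integrable lborel (\<lambda>x. f (t + c *\<^sub>R x))"
proof -
  have [measurable]: "f \<in> borel_measurable borel" using f by auto
  have "ennreal (\<bar>c\<bar> ^ DIM('a)) * (\<integral>\<^sup>+x. ennreal (norm (f (t + c *\<^sub>R x))) \<partial>lborel) < \<infinity>"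
    using f nn_integral_lborel_affine[of "\<lambda>x. ennreal (norm (f x))" c t] c
    by (simp add: integrable_iff_bounded)
  then show ?thesis
    using c by (auto simp: integrable_iff_bounded ennreal_mult_less_top)
qed

lemma integrable_lborel_affine_iff:
  fixes f :: "'a::euclidean_space \<Rightarrow> 'b::{banach, second_countable_topology}"
  assumes c: "c \<noteq> 0"
  shows "integrable lborel (\<lambda>x. f (t + c *\<^sub>R x)) \<longleftrightarrow> integrable lborel f"
  using integrable_lborel_affine[of f c t] integrable_lborel_affine[of "\<lambda>x. f (t + c *\<^sub>R x)" "1/c" "-(1/c) *\<^sub>R t"] c
  by (auto simp: algebra_simps)

lemma integral_lborel_affine:
  fixes f :: "'a::euclidean_space \<Rightarrow> 'b::{banach, second_countable_topology}"
  assumes c: "c \<noteq> 0"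
  shows "(\<integral>x. f x \<partial>lborel) = (\<bar>c\<bar> ^ DIM('a)) *\<^sub>R (\<integral>x. f (t + c *\<^sub>R x) \<partial>lborel)"
proof (cases "integrable lborel f")
  case True
  then have [measurable]: "f \<in> borel_measurable borel" by auto
  show ?thesis
    by (subst lborel_affine[OF c, of t])
       (simp add: integral_density integral_distr)
next
  case False
  then show ?thesis using integrable_lborel_affine_iff[OF c, of f t] by (simp add: not_integrable_integral_eq)
qed

lemma integral_lborel_reflect:
  fixes f :: "'a::euclidean_space \<Rightarrow> 'b::{banach, second_countable_topology}"
  shows "(\<integral>x. f (t - x) \<partial>lborel) = (\<integral>x. f x \<partial>lborel)"
  using integral_lborel_affine[of "-1" f t] by simp

lemma integrable_lborel_reflect:
  fixes f :: "'a::euclidean_space \<Rightarrow> 'b::{banach, second_countable_topology}"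
  shows "integrable lborel (\<lambda>x. f (t - x)) \<longleftrightarrow> integrable lborel f"
  using integrable_lborel_affine_iff[of "-1" f t] by simp

text \<open>Uniqueness of Haar measure by a double use of Fubini's theorem; the ball fixes the constant.\<close>
lemma nn_integral_lborel_involution:
  fixes f :: "'a::euclidean_space \<Rightarrow> 'a" and h :: "'a \<Rightarrow> ennreal"
  assumes lin: "linear f" and iso: "\<And>x. norm (f x) = norm x" and inv: "\<And>x. f (f x) = x"
    and [measurable]: "h \<in> borel_measurable borel"
  shows "(\<integral>\<^sup>+x. h (f x) \<partial>lborel) = (\<integral>\<^sup>+x. h x \<partial>lborel)"
proof -
  have [measurable]: "f \<in> borel_measurable borel"
    using lin by (intro borel_measurable_continuous_onI) (simp add: linear_continuous_on linear_conv_bounded_linear)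
  define g :: "'a \<Rightarrow> ennreal" where "g = indicator (ball 0 1)"
  have [measurable]: "g \<in> borel_measurable borel" unfolding g_def by (intro borel_measurable_indicator) simp
  have g_sym: "g (y - f x) = g (f y - x)" for x y
    using iso[of "y - f x"] by (simp add: g_def linear_diff[OF lin] inv indicator_def norm_minus_commute)
  have g_int: "(\<integral>\<^sup>+y. g y \<partial>lborel) = ennreal (unit_ball_vol (real DIM('a)))"
    using emeasure_ball[of 1 "0::'a"] by (simp add: g_def)
  have "(\<integral>\<^sup>+x. h (f x) \<partial>lborel) * (\<integral>\<^sup>+y. g y \<partial>lborel)
      = (\<integral>\<^sup>+y. g y * (\<integral>\<^sup>+x. h (f x) \<partial>lborel) \<partial>lborel)"
    by (simp add: nn_integral_multc mult.commute)
  also have "\<dots> = (\<integral>\<^sup>+y. g y * (\<integral>\<^sup>+x. h (f x + y) \<partial>lborel) \<partial>lborel)"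
  proof (rule nn_integral_cong, rule arg_cong2[where f="(*)"], rule refl)
    fix y :: 'a
    show "(\<integral>\<^sup>+x. h (f x) \<partial>lborel) = (\<integral>\<^sup>+x. h (f x + y) \<partial>lborel)"
      using nn_integral_lborel_affine[of "\<lambda>x. h (f x)" 1 "f y"]
      by (simp add: linear_add[OF lin] inv add.commute)
  qed
  also have "\<dots> = (\<integral>\<^sup>+y. \<integral>\<^sup>+x. g y * h (f x + y) \<partial>lborel \<partial>lborel)"
    by (intro nn_integral_cong) (simp add: nn_integral_cmult)
  also have "\<dots> = (\<integral>\<^sup>+x. \<integral>\<^sup>+y. g y * h (f x + y) \<partial>lborel \<partial>lborel)"
    by (rule lborel_pair.Fubini') simp
  also have "\<dots> = (\<integral>\<^sup>+x. \<integral>\<^sup>+y. g (y - f x) * h y \<partial>lborel \<partial>lborel)"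
  proof (rule nn_integral_cong)
    fix x
    show "(\<integral>\<^sup>+y. g y * h (f x + y) \<partial>lborel) = (\<integral>\<^sup>+y. g (y - f x) * h y \<partial>lborel)"
      using nn_integral_lborel_affine[of "\<lambda>y. g (y - f x) * h y" 1 "f x"] by simp
  qed
  also have "\<dots> = (\<integral>\<^sup>+y. \<integral>\<^sup>+x. g (y - f x) * h y \<partial>lborel \<partial>lborel)"
    by (rule lborel_pair.Fubini') simp
  also have "\<dots> = (\<integral>\<^sup>+y. (\<integral>\<^sup>+x. g x \<partial>lborel) * h y \<partial>lborel)"
    by (intro nn_integral_cong) (simp add: nn_integral_multc g_sym nn_integral_lborel_reflect)
  also have "\<dots> = (\<integral>\<^sup>+x. h x \<partial>lborel) * (\<integral>\<^sup>+y. g y \<partial>lborel)"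
    by (subst nn_integral_cmult) (simp_all add: mult.commute)
  finally show ?thesis
    using unit_ball_vol_pos[of "real DIM('a)"] unfolding g_int
    by (auto simp: mult_right_ennreal_cancel simp del: unit_ball_vol_pos)
qed

lemma integral_lborel_involution:
  fixes f :: "'a::euclidean_space \<Rightarrow> 'a" and h :: "'a \<Rightarrow> 'b::{banach, second_countable_topology}"
  assumes lin: "linear f" and iso: "\<And>x. norm (f x) = norm x" and inv: "\<And>x. f (f x) = x"
    and [measurable]: "h \<in> borel_measurable borel"
  shows "(\<integral>x. h (f x) \<partial>lborel) = (\<integral>x. h x \<partial>lborel)"
proof -
  have [measurable]: "f \<in> borel_measurable borel"
    using lin by (intro borel_measurable_continuous_onI) (simp add: linear_continuous_on linear_conv_bounded_linear)
  have "distr lborel borel f = lborel"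
  proof (rule measure_eqI)
    fix A assume "A \<in> sets (distr lborel borel f)"
    then have [measurable]: "A \<in> sets borel" by simp
    have "emeasure (distr lborel borel f) A = (\<integral>\<^sup>+x. indicator A (f x) \<partial>lborel)"
      by (simp add: nn_integral_distr flip: nn_integral_indicator)
    then show "emeasure (distr lborel borel f) A = emeasure lborel A"
      by (simp add: nn_integral_lborel_involution[OF lin iso inv])
  qed simp
  then show ?thesis
    using integral_distr[of f lborel borel h] by simp
qed

lemma emeasure_lborel_ball:
  fixes a :: "'a::euclidean_space"
  assumes "r \<ge> 0"
  shows "emeasure lborel (ball a r) = ennreal (unit_ball_vol (real DIM('a)) * r ^ DIM('a))"
  using emeasure_ball[OF assms, of a] by simp

section \<open>Integrals of powers, on the line and of the norm\<close>

lemma nn_integral_powr_atLeast: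
  fixes a r :: real assumes "a > 0" "r > 0"
  shows "(\<integral>\<^sup>+t. ennreal (t powr (- a - 1)) * indicator {r..} t \<partial>lborel) = ennreal (r powr (-a) / a)"
proof -
  have "(\<integral>\<^sup>+t. ennreal (t powr (- a - 1)) * indicator {r..} t \<partial>lborel) = 0 - (- (r powr (-a) / a))"
  proof (rule nn_integral_FTC_atLeast)
    fix x assume "r \<le> x"
    then show "((\<lambda>t. - (t powr (-a) / a)) has_real_derivative x powr (- a - 1)) (at x)"
      using assms by (auto intro!: derivative_eq_intros)
  next
    show "((\<lambda>t. - (t powr (-a) / a)) \<longlongrightarrow> 0) at_top"
      using assms tendsto_divide[OF tendsto_neg_powr[of "-a", OF _ filterlim_ident] tendsto_const[of a], THEN tendsto_minus]
      by simp
  qed auto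
  then show ?thesis by simp
qed

lemma nn_integral_powr_greaterThan:
  fixes a r :: real assumes "a > 0" "r > 0"
  shows "(\<integral>\<^sup>+t. ennreal (t powr (- a - 1)) * indicator {r<..} t \<partial>lborel) = ennreal (r powr (-a) / a)"
proof -
  have "AE t in lborel. t \<noteq> r" by (rule AE_lborel_singleton)
  then have "(\<integral>\<^sup>+t. ennreal (t powr (- a - 1)) * indicator {r<..} t \<partial>lborel)
     = (\<integral>\<^sup>+t. ennreal (t powr (- a - 1)) * indicator {r..} t \<partial>lborel)"
    by (intro nn_integral_cong_AE) (auto split: split_indicator)
  then show ?thesis using nn_integral_powr_atLeast[OF assms] by simp
qed

lemma nn_integral_powr_from_0:
  fixes a c :: real assumes "a > -1" "c \<ge> 0"
  shows "(\<integral>\<^sup>+t. ennreal (t powr a) * indicator {0..c} t \<partial>lborel) = ennreal (c powr (a+1) / (a+1))"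
  using nn_integral_has_integral_lebesgue[OF _ has_integral_powr_from_0[OF assms]]
  by (simp add: ennreal_indicator[symmetric] ennreal_mult'[symmetric] mult.commute indicator_def if_distrib cong: if_cong)

text \<open>Layer cake: \<open>norm z powr (-a)\<close> is \<open>a\<close> times the integral of \<open>t powr (-a-1)\<close> over \<open>t > norm z\<close>.\<close>
lemma nn_integral_powr_inside:
  fixes a R :: real
  assumes "0 < a" "a < DIM('a::euclidean_space)" "0 < R"
  shows "(\<integral>\<^sup>+z. ennreal (norm (z::'a) powr (-a)) * indicator (ball 0 R) z \<partial>lborel) < \<infinity>"
proof -
  let ?d = "DIM('a)" and ?w = "unit_ball_vol (real DIM('a))"
  have "(\<integral>\<^sup>+z. ennreal (norm (z::'a) powr (-a)) * indicator (ball 0 R) z \<partial>lborel)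
     = (\<integral>\<^sup>+z. \<integral>\<^sup>+t. ennreal a * (ennreal (t powr (- a - 1)) * indicator {norm (z::'a)<..} t * indicator (ball 0 R) z) \<partial>lborel \<partial>lborel)"
  proof (rule nn_integral_cong_AE, use AE_lborel_singleton[of "0::'a"] in eventually_elim)
    case (elim z)
    then show "ennreal (norm z powr (-a)) * indicator (ball 0 R) z
       = (\<integral>\<^sup>+t. ennreal a * (ennreal (t powr (- a - 1)) * indicator {norm z<..} t * indicator (ball 0 R) z) \<partial>lborel)"
      using assms by (simp add: nn_integral_cmult nn_integral_multc nn_integral_powr_greaterThan)
         (simp add: mult.assoc[symmetric] ennreal_mult[symmetric])
  qed
  also have "\<dots> = (\<integral>\<^sup>+t. \<integral>\<^sup>+z. ennreal a * (ennreal (t powr (- a - 1)) * indicator {norm (z::'a)<..} t * indicator (ball 0 R) z) \<partial>lborel \<partial>lborel)"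
    by (rule lborel_pair.Fubini') (simp add: indicator_def split_beta')
  also have "\<dots> \<le> (\<integral>\<^sup>+t. ennreal (a * ?w) * (ennreal (t powr (- a - 1 + ?d)) * indicator {0..R} t)
       + ennreal (a * ?w * R ^ ?d) * (ennreal (t powr (- a - 1)) * indicator {R..} t) \<partial>lborel)"
  proof (rule nn_integral_mono)
    fix t :: real
    show "(\<integral>\<^sup>+z. ennreal a * (ennreal (t powr (- a - 1)) * indicator {norm (z::'a)<..} t * indicator (ball 0 R) z) \<partial>lborel)
       \<le> ennreal (a * ?w) * (ennreal (t powr (- a - 1 + ?d)) * indicator {0..R} t)
       + ennreal (a * ?w * R ^ ?d) * (ennreal (t powr (- a - 1)) * indicator {R..} t)" (is "?L \<le> _")
    proof (cases "t \<le> 0")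
      case True
      then have "\<not> norm z < t" for z :: 'a using norm_ge_zero[of z] by linarith
      then show ?thesis by simp
    next
      case False
      have "?L = (\<integral>\<^sup>+z. ennreal (a * t powr (- a - 1)) * indicator (ball (0::'a) (min t R)) z \<partial>lborel)"
        using assms by (intro nn_integral_cong) (auto simp: ennreal_mult split: split_indicator)
      also have "\<dots> = ennreal (a * t powr (- a - 1)) * ennreal (?w * min t R ^ ?d)"
        using False assms by (simp add: nn_integral_cmult_indicator emeasure_lborel_ball)
      also have "\<dots> = ennreal (a * ?w * (t powr (- a - 1) * min t R ^ ?d))"
        using assms False by (simp add: ennreal_mult[symmetric] mult_ac)
      also have "\<dots> \<le> ennreal (a * ?w) * (ennreal (t powr (- a - 1 + ?d)) * indicator {0..R} t)
       + ennreal (a * ?w * R ^ ?d) * (ennreal (t powr (- a - 1)) * indicator {R..} t)"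
      proof (cases "t \<le> R")
        case True
        then show ?thesis using False assms
          by (auto simp: ennreal_mult[symmetric] powr_add powr_realpow ennreal_plus[symmetric] simp del: ennreal_plus split: split_indicator)
      next
        case f2: False
        then show ?thesis using False assms
          by (auto simp: ennreal_mult[symmetric] mult_ac split: split_indicator)
      qed
      finally show ?thesis .
    qed
  qed
  also have "\<dots> = ennreal (a * ?w) * ennreal (R powr (- a - 1 + ?d + 1) / (- a - 1 + ?d + 1))
       + ennreal (a * ?w * R ^ ?d) * ennreal (R powr (-a) / a)"
    using assms by (simp add: nn_integral_add nn_integral_cmult nn_integral_powr_atLeast nn_integral_powr_from_0)
  also have "\<dots> < \<infinity>" by (simp add: ennreal_mult[symmetric] ennreal_mult_less_top)
  finally show ?thesis .
qed

text \<open>Layer cake again. Below \<open>t = R\<close> the region between the two radii is empty,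
  and above it the volume is at most that of the ball of radius \<open>t\<close>, which leaves
  \<open>t powr (- (b - d) - 1)\<close>, integrable at infinity because \<open>b\<close> exceeds the
  dimension \<open>d\<close>.\<close>

lemma nn_integral_powr_outside:
  fixes b R :: real
  assumes "b > DIM('a::euclidean_space)" "0 < R"
  shows "(\<integral>\<^sup>+z. ennreal (norm (z::'a) powr (-b)) * indicator (- ball 0 R) z \<partial>lborel) < \<infinity>"
proof -
  let ?d = "DIM('a)" and ?w = "unit_ball_vol (real DIM('a))"
  have b: "b > 0" using assms by (meson less_trans of_nat_0_less_iff DIM_positive)
  have "(\<integral>\<^sup>+z. ennreal (norm (z::'a) powr (-b)) * indicator (- ball 0 R) z \<partial>lborel)
     = (\<integral>\<^sup>+z. \<integral>\<^sup>+t. ennreal b * (ennreal (t powr (- b - 1)) * indicator {norm (z::'a)<..} t * indicator (- ball 0 R) z) \<partial>lborel \<partial>lborel)"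
  proof (rule nn_integral_cong_AE, use AE_lborel_singleton[of "0::'a"] in eventually_elim)
    case (elim z)
    then show "ennreal (norm z powr (-b)) * indicator (- ball 0 R) z
       = (\<integral>\<^sup>+t. ennreal b * (ennreal (t powr (- b - 1)) * indicator {norm z<..} t * indicator (- ball 0 R) z) \<partial>lborel)"
      using b by (simp add: nn_integral_cmult nn_integral_multc nn_integral_powr_greaterThan)
         (simp add: mult.assoc[symmetric] ennreal_mult[symmetric])
  qed
  also have "\<dots> = (\<integral>\<^sup>+t. \<integral>\<^sup>+z. ennreal b * (ennreal (t powr (- b - 1)) * indicator {norm (z::'a)<..} t * indicator (- ball 0 R) z) \<partial>lborel \<partial>lborel)"
    by (rule lborel_pair.Fubini') (simp add: indicator_def split_beta')
  also have "\<dots> \<le> (\<integral>\<^sup>+t. ennreal (b * ?w) * (ennreal (t powr (- (b - ?d) - 1)) * indicator {R..} t) \<partial>lborel)"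
  proof (rule nn_integral_mono)
    fix t :: real
    show "(\<integral>\<^sup>+z. ennreal b * (ennreal (t powr (- b - 1)) * indicator {norm (z::'a)<..} t * indicator (- ball 0 R) z) \<partial>lborel)
       \<le> ennreal (b * ?w) * (ennreal (t powr (- (b - ?d) - 1)) * indicator {R..} t)" (is "?L \<le> _")
    proof (cases "t \<le> R")
      case True
      then have "\<not> (norm z < t \<and> z \<in> - ball 0 R)" for z :: 'a by auto
      then have "?L = (\<integral>\<^sup>+(z::'a). 0 \<partial>lborel)"
        by (intro nn_integral_cong) (auto split: split_indicator)
      then show ?thesis by simp
    next
      case False
      have "?L \<le> (\<integral>\<^sup>+z. ennreal (b * t powr (- b - 1)) * indicator (ball (0::'a) t) z \<partial>lborel)"
        using b by (intro nn_integral_mono) (auto simp: ennreal_mult split: split_indicator)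
      also have "\<dots> = ennreal (b * t powr (- b - 1)) * ennreal (?w * t ^ ?d)"
        using False assms by (simp add: nn_integral_cmult_indicator emeasure_lborel_ball)
      also have "\<dots> = ennreal (b * ?w * (t powr (- (b - ?d) - 1)))"
      proof -
        have "t powr (- b - 1) * t ^ ?d = t powr (- (b - ?d) - 1)"
          using False assms by (subst powr_realpow[symmetric]) (simp_all add: powr_add[symmetric] algebra_simps)
        then show ?thesis using b False assms by (simp add: ennreal_mult[symmetric] mult_ac)
      qed
      also have "\<dots> \<le> ennreal (b * ?w) * (ennreal (t powr (- (b - ?d) - 1)) * indicator {R..} t)"
        using False b by (auto simp: ennreal_mult[symmetric] split: split_indicator)
      finally show ?thesis .
    qed
  qed
  also have "\<dots> = ennreal (b * ?w) * ennreal (R powr (- (b - ?d)) / (b - ?d))"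
    using assms by (subst nn_integral_cmult) (simp_all add: nn_integral_powr_atLeast del: minus_diff_eq)
  also have "\<dots> < \<infinity>" by (simp add: ennreal_mult[symmetric] ennreal_mult_less_top)
  finally show ?thesis .
qed

section \<open>Dyadic layers and increments\<close>

text \<open>Take for \<open>t1\<close> the first time at which \<open>w\<close> equals
  \<open>\<beta>\<close>, and for \<open>t0\<close> the last time before \<open>t1\<close> at which
  it equals \<open>\<alpha>\<close>. Leaving the band in between would, by the intermediate value
  theorem, produce an earlier \<open>t1\<close> or a later \<open>t0\<close>.\<close>

lemma continuous_crossing:
  fixes w :: "real \<Rightarrow> real"
  assumes cont: "continuous_on {0..1} w" and "\<alpha> < \<beta>" "w 0 \<le> \<alpha>" "\<beta> \<le> w 1"
  obtains t0 t1 where "0 \<le> t0" "t0 \<le> t1" "t1 \<le> 1" "w t0 = \<alpha>" "w t1 = \<beta>"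
    "\<And>t. t0 \<le> t \<Longrightarrow> t \<le> t1 \<Longrightarrow> \<alpha> \<le> w t \<and> w t \<le> \<beta>"
proof -
  define S where "S = {t\<in>{0..1}. w t = \<beta>}"
  have "compact S" unfolding S_def
    using continuous_closed_preimage_constant[OF cont, of \<beta>] 
    by (auto simp: compact_eq_bounded_closed intro: bounded_subset[OF bounded_closed_interval[of 0 1]])
  moreover have "S \<noteq> {}"
    using IVT'[of w 0 \<beta> 1] assms by (auto simp: S_def)
  ultimately obtain t1 where t1: "t1 \<in> S" "\<And>t. t \<in> S \<Longrightarrow> t1 \<le> t"
    by (meson compact_attains_inf)
  have c1: "continuous_on {0..t1} w" using t1(1) by (intro continuous_on_subset[OF cont]) (auto simp: S_def)
  define R where "R = {t\<in>{0..t1}. w t = \<alpha>}"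
  have "compact R" unfolding R_def
    using continuous_closed_preimage_constant[OF c1, of \<alpha>] 
    by (auto simp: compact_eq_bounded_closed intro: bounded_subset[OF bounded_closed_interval[of 0 t1]])
  moreover have "R \<noteq> {}"
    using IVT'[of w 0 \<alpha> t1] assms t1 c1 by (auto simp: R_def S_def)
  ultimately obtain t0 where t0: "t0 \<in> R" "\<And>t. t \<in> R \<Longrightarrow> t \<le> t0"
    by (meson compact_attains_sup)
  show thesis
  proof (rule that[of t0 t1])
    fix t assume t: "t0 \<le> t" "t \<le> t1"
    have "w t \<le> \<beta>"
    proof (rule ccontr)
      assume "\<not> w t \<le> \<beta>"
      then obtain t' where "0 \<le> t'" "t' \<le> t" "w t' = \<beta>"
        using IVT'[of w 0 \<beta> t] assms t t0 t1 continuous_on_subset[OF cont, of "{0..t}"] by (auto simp: R_def S_def)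
      moreover then have "t1 \<le> t'" using t1 t by (auto simp: S_def)
      ultimately show False using t \<open>\<not> w t \<le> \<beta>\<close> by (auto dest: order_antisym)
    qed
    moreover have "\<alpha> \<le> w t"
    proof (rule ccontr)
      assume "\<not> \<alpha> \<le> w t"
      then obtain t' where "t \<le> t'" "t' \<le> t1" "w t' = \<alpha>"
        using IVT'[of w t \<alpha> t1] assms t t0 t1 continuous_on_subset[OF cont, of "{t..t1}"] by (auto simp: R_def S_def)
      moreover then have "t' \<le> t0" using t0 t by (auto simp: R_def)
      ultimately show False using t \<open>\<not> \<alpha> \<le> w t\<close> by (auto dest: order_antisym)
    qed
    ultimately show "\<alpha> \<le> w t \<and> w t \<le> \<beta>" by simp
  qed (use t0 t1 in \<open>auto simp: R_def S_def\<close>)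
qed

section \<open>Increments of truncated functions\<close>

definition trunc :: "real \<Rightarrow> real \<Rightarrow> real \<Rightarrow> real" where
  "trunc a b r = max a (min b r)"

lemma borel_measurable_trunc [measurable (raw)]:
  "f \<in> borel_measurable M \<Longrightarrow> (\<lambda>x. trunc a b (f x)) \<in> borel_measurable M"
  unfolding trunc_def by (intro borel_measurable_max borel_measurable_min measurable_const) simp_all

text \<open>This replaces the chain rule for the truncation, which is not differentiable at the two
  levels. The increment of the truncation equals the increment of \<open>w\<close> itself over a
  subinterval on which \<open>w\<close> stays in the band, and there the fundamental theorem of
  calculus applies to \<open>w\<close>.\<close>

lemma trunc_increment_le_aux:
  fixes w w' :: "real \<Rightarrow> real"
  assumes deriv: "\<And>t. 0 \<le> t \<Longrightarrow> t \<le> 1 \<Longrightarrow> (w has_real_derivative w' t) (at t)"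
    and cont: "\<And>t. 0 \<le> t \<Longrightarrow> t \<le> 1 \<Longrightarrow> isCont w' t"
    and "a \<le> b" "trunc a b (w 0) < trunc a b (w 1)"
  shows "ennreal (trunc a b (w 1) - trunc a b (w 0))
     \<le> (\<integral>\<^sup>+t. ennreal (\<bar>w' t\<bar> * indicator {a..b} (w t)) * indicator {0..1} t \<partial>lborel)"
proof -
  let ?\<alpha> = "trunc a b (w 0)" and ?\<beta> = "trunc a b (w 1)"
  \<comment> \<open>A strict increase forces \<open>w 0 < b\<close> and \<open>a < w 1\<close>, so
    clamping can only raise the initial value and only lower the final one.\<close>
  have ab: "a \<le> ?\<alpha>" "?\<beta> \<le> b" "w 0 \<le> ?\<alpha>" "?\<beta> \<le> w 1"
    using assms(3,4) by (auto simp: trunc_def max_def min_def split: if_splits)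
  have "continuous_on {0..1} w"
    by (intro continuous_at_imp_continuous_on ballI DERIV_isCont[OF deriv]) auto
  from continuous_crossing[OF this assms(4) ab(3,4)] obtain t0 t1 where t:
    "0 \<le> t0" "t0 \<le> t1" "t1 \<le> 1" "w t0 = ?\<alpha>" "w t1 = ?\<beta>"
    "\<And>t. t0 \<le> t \<Longrightarrow> t \<le> t1 \<Longrightarrow> ?\<alpha> \<le> w t \<and> w t \<le> ?\<beta>" by blast
  have "has_bochner_integral lborel (\<lambda>t. w' t * indicator {t0..t1} t) (w t1 - w t0)"
    using t by (intro has_bochner_integral_FTC_Icc_real deriv cont) auto
  then have i: "integrable lborel (\<lambda>t. w' t * indicator {t0..t1} t)"
    "(\<integral>t. w' t * indicator {t0..t1} t \<partial>lborel) = ?\<beta> - ?\<alpha>"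
    using t by (auto simp: has_bochner_integral_iff)
  have "ennreal (?\<beta> - ?\<alpha>) = ennreal (norm (\<integral>t. w' t * indicator {t0..t1} t \<partial>lborel))"
    using i assms(4) by simp
  also have "\<dots> \<le> (\<integral>\<^sup>+t. ennreal (norm (w' t * indicator {t0..t1} t)) \<partial>lborel)"
    by (rule integral_norm_bound_ennreal[OF i(1)])
  also have "\<dots> \<le> (\<integral>\<^sup>+t. ennreal (\<bar>w' t\<bar> * indicator {a..b} (w t)) * indicator {0..1} t \<partial>lborel)"
  proof (rule nn_integral_mono)
    fix t
    show "ennreal (norm (w' t * indicator {t0..t1} t)) \<le> ennreal (\<bar>w' t\<bar> * indicator {a..b} (w t)) * indicator {0..1} t"
      using t(1-3) t(6)[of t] ab by (auto split: split_indicator)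
  qed
  finally show ?thesis .
qed

lemma trunc_increment_le:
  fixes w w' :: "real \<Rightarrow> real"
  assumes deriv: "\<And>t. 0 \<le> t \<Longrightarrow> t \<le> 1 \<Longrightarrow> (w has_real_derivative w' t) (at t)"
    and cont: "\<And>t. 0 \<le> t \<Longrightarrow> t \<le> 1 \<Longrightarrow> isCont w' t"
    and "a \<le> b"
  shows "ennreal \<bar>trunc a b (w 1) - trunc a b (w 0)\<bar>
     \<le> (\<integral>\<^sup>+t. ennreal (\<bar>w' t\<bar> * indicator {a..b} (w t)) * indicator {0..1} t \<partial>lborel)"
proof -
  consider "trunc a b (w 0) < trunc a b (w 1)" | "trunc a b (w 0) = trunc a b (w 1)" | "trunc a b (w 1) < trunc a b (w 0)"
    by linarith
  then show ?thesis
  proof cases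
    case 1
    then show ?thesis using trunc_increment_le_aux[OF assms 1] by simp
  next
    case 3
    \<comment> \<open>Negation exchanges the two levels, so a decreasing truncation of
      \<open>w\<close> is an increasing truncation of \<open>- w\<close> between \<open>-b\<close>
      and \<open>-a\<close>.\<close>
    have c: "trunc (-b) (-a) (- r) = - trunc a b r" for r
      using assms(3) by (auto simp: trunc_def max_def min_def)
    have "ennreal (trunc (-b) (-a) (- w 1) - trunc (-b) (-a) (- w 0))
     \<le> (\<integral>\<^sup>+t. ennreal (\<bar>- w' t\<bar> * indicator {-b..-a} (- w t)) * indicator {0..1} t \<partial>lborel)"
      by (rule trunc_increment_le_aux[where w="\<lambda>t. - w t" and w'="\<lambda>t. - w' t"])
         (use assms 3 c in \<open>auto intro!: derivative_intros\<close>)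
    moreover have "indicator {-b..-a} (- w t) = (indicator {a..b} (w t) :: real)" for t
      by (auto split: split_indicator)
    ultimately show ?thesis using 3 unfolding c by simp
  qed simp
qed

text \<open>The gradient is integrated over the segment from \<open>x - z\<close> to
  \<open>x\<close>. After exchanging the integrals, every point of the segment contributes the same
  amount by translation invariance, and the restriction to the band survives.\<close>

lemma trunc_translation_L1:
  fixes f :: "'a::euclidean_space \<Rightarrow> real" and Df :: "'a \<Rightarrow> 'a"
  assumes deriv: "\<And>x. (f has_derivative (\<lambda>h. Df x \<bullet> h)) (at x)"
    and cont: "continuous_on UNIV Df" and "a \<le> b"
  shows "(\<integral>\<^sup>+x. ennreal \<bar>trunc a b (f x) - trunc a b (f (x - z))\<bar> \<partial>lborel)
     \<le> ennreal (norm z) * (\<integral>\<^sup>+x. ennreal (norm (Df x) * indicator {a..b} (f x)) \<partial>lborel)"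
proof -
  have fc: "continuous_on UNIV f" using deriv by (meson continuous_at_imp_continuous_on has_derivative_continuous)
  have [measurable]: "f \<in> borel_measurable borel" "Df \<in> borel_measurable borel"
    using fc cont by (auto intro: borel_measurable_continuous_onI)
  define G where "G = (\<lambda>x. ennreal (norm (Df x) * indicator {a..b} (f x)))"
  have G[measurable]: "G \<in> borel_measurable borel" unfolding G_def by measurable
  have "ennreal \<bar>trunc a b (f x) - trunc a b (f (x - z))\<bar>
     \<le> (\<integral>\<^sup>+t. ennreal (norm z) * G (x + (t - 1) *\<^sub>R z) * indicator {0..1} t \<partial>lborel)" for x
  proof -
    let ?w = "\<lambda>t. f (x + (t - 1) *\<^sub>R z)" and ?w' = "\<lambda>t. Df (x + (t - 1) *\<^sub>R z) \<bullet> z"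
    have "ennreal \<bar>trunc a b (?w 1) - trunc a b (?w 0)\<bar>
     \<le> (\<integral>\<^sup>+t. ennreal (\<bar>?w' t\<bar> * indicator {a..b} (?w t)) * indicator {0..1} t \<partial>lborel)"
    proof (rule trunc_increment_le)
      fix t :: real
      have "(?w has_derivative (\<lambda>h. Df (x + (t - 1) *\<^sub>R z) \<bullet> (h *\<^sub>R z))) (at t)"
        by (rule has_derivative_compose[OF _ deriv]) (auto intro!: derivative_eq_intros)
      then show "(?w has_real_derivative ?w' t) (at t)"
        by (simp add: has_field_derivative_def mult_commute_abs)
      have "continuous_on UNIV ?w'"
        by (intro continuous_intros continuous_on_compose2[OF cont]) auto
      then show "isCont ?w' t" by (simp add: continuous_on_eq_continuous_at)
    qed fact
    also have "\<dots> \<le> (\<integral>\<^sup>+t. ennreal (norm z) * G (x + (t - 1) *\<^sub>R z) * indicator {0..1} t \<partial>lborel)"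
      using Cauchy_Schwarz_ineq2[of "Df _" z]
      by (intro nn_integral_mono) (auto simp: G_def ennreal_mult[symmetric] mult.commute split: split_indicator)
    finally show ?thesis by simp
  qed
  then have "(\<integral>\<^sup>+x. ennreal \<bar>trunc a b (f x) - trunc a b (f (x - z))\<bar> \<partial>lborel)
    \<le> (\<integral>\<^sup>+x. \<integral>\<^sup>+t. ennreal (norm z) * G (x + (t - 1) *\<^sub>R z) * indicator {0..1} t \<partial>lborel \<partial>lborel)"
    by (intro nn_integral_mono)
  also have "\<dots> = (\<integral>\<^sup>+t. \<integral>\<^sup>+x. ennreal (norm z) * G (x + (t - 1) *\<^sub>R z) * indicator {0..1} t \<partial>lborel \<partial>lborel)"
    by (rule lborel_pair.Fubini') simp
  also have "\<dots> = (\<integral>\<^sup>+t. ennreal (norm z) * (\<integral>\<^sup>+x. G x \<partial>lborel) * indicator {0..1::real} t \<partial>lborel)"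
  proof (rule nn_integral_cong)
    fix t :: real
    have "(\<integral>\<^sup>+x. G (x + (t - 1) *\<^sub>R z) \<partial>lborel) = (\<integral>\<^sup>+x. G x \<partial>lborel)"
      using nn_integral_lborel_shift[OF G, of "- ((t - 1) *\<^sub>R z)"] by simp
    then show "(\<integral>\<^sup>+x. ennreal (norm z) * G (x + (t - 1) *\<^sub>R z) * indicator {0..1} t \<partial>lborel)
      = ennreal (norm z) * (\<integral>\<^sup>+x. G x \<partial>lborel) * indicator {0..1} t"
      by (simp add: nn_integral_cmult nn_integral_multc)
  qed
  also have "\<dots> = ennreal (norm z) * (\<integral>\<^sup>+x. G x \<partial>lborel)"
    by (simp add: nn_integral_cmult)
  finally show ?thesis by (simp add: G_def)
qed

lemma trunc_L1_le:
  fixes f :: "'a::euclidean_space \<Rightarrow> real"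
  assumes [measurable]: "f \<in> borel_measurable borel" and "a \<le> b"
  shows "(\<integral>\<^sup>+x. ennreal (trunc a b (f x) - a) \<partial>lborel) \<le> ennreal (b - a) * emeasure lborel {x. a < f x}"
proof -
  have "(\<integral>\<^sup>+x. ennreal (trunc a b (f x) - a) \<partial>lborel) \<le> (\<integral>\<^sup>+x. ennreal (b - a) * indicator {x. a < f x} x \<partial>lborel)"
    using assms(2) by (intro nn_integral_mono) (auto simp: trunc_def split: split_indicator)
  then show ?thesis by (simp add: nn_integral_cmult)
qed

text \<open>By comparison with averages over balls whose volume is twice that of the superlevel set.\<close>
lemma layer_weak_sobolev:
  fixes f :: "'a::euclidean_space \<Rightarrow> real" and Df :: "'a \<Rightarrow> 'a"
  assumes deriv: "\<And>x. (f has_derivative (\<lambda>h. Df x \<bullet> h)) (at x)"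
    and cont: "continuous_on UNIV Df" and ab: "a \<le> b"
    and e: "emeasure lborel {x. a < f x} = ennreal e" "e > 0"
  shows "ennreal (b - a) * emeasure lborel {x. b \<le> f x}
    \<le> ennreal (2 * (2 * e / unit_ball_vol DIM('a)) powr (1 / DIM('a)))
        * (\<integral>\<^sup>+x. ennreal (norm (Df x) * indicator {a..b} (f x)) \<partial>lborel)"
proof -
  let ?\<omega> = "unit_ball_vol (real DIM('a))"
  define r where "r = (2 * e / ?\<omega>) powr (1 / DIM('a))"
  define m where "m = (\<integral>\<^sup>+x. ennreal (norm (Df x) * indicator {a..b} (f x)) \<partial>lborel)"
  have w0: "0 < ?\<omega>" by (rule unit_ball_vol_pos) simp
  then have q: "0 < 2 * e / ?\<omega>" using e by (intro divide_pos_pos) auto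
  then have r: "r > 0" unfolding r_def powr_gt_zero by (rule less_imp_neq[symmetric])
  then have "r ^ DIM('a) = 2 * e / ?\<omega>"
    using q e by (simp only: powr_realpow[symmetric] r_def powr_powr) simp
  then have "?\<omega> * r ^ DIM('a) = 2 * e" using w0 by (metis nonzero_mult_div_cancel_left times_divide_eq_right less_irrefl)
  then have vol: "emeasure lborel (ball (0::'a) r) = ennreal (2 * e)"
    using r by (simp add: emeasure_lborel_ball)
  have fc: "continuous_on UNIV f" using deriv by (meson continuous_at_imp_continuous_on has_derivative_continuous)
  have [measurable]: "f \<in> borel_measurable borel" "Df \<in> borel_measurable borel"
    using fc cont by (auto intro: borel_measurable_continuous_onI)
  define F where "F = (\<lambda>x z. ennreal \<bar>trunc a b (f x) - trunc a b (f (x - z))\<bar> * indicator (ball 0 r) z)"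
  have [measurable]: "(\<lambda>x. indicator (ball (0::'a) r) x :: ennreal) \<in> borel_measurable borel"
    by (intro borel_measurable_indicator) simp
  have Fm: "(\<lambda>(z, x). F x z) \<in> borel_measurable (lborel \<Otimes>\<^sub>M lborel)"
    unfolding F_def split_beta' by measurable
  have [measurable]: "(\<lambda>z. F x z) \<in> borel_measurable lborel" for x
    unfolding F_def by measurable
  \<comment> \<open>Over the ball of volume \<open>2 * e\<close> the constant \<open>b - a\<close>
    has integral \<open>2 * e * (b - a)\<close>, whereas the truncation exceeds \<open>a\<close>
    only on a set of volume \<open>e\<close>. So from a point with \<open>b \<le> f x\<close> the
    increments account for at least half of that integral.\<close>
  have low: "ennreal ((b - a) * e) \<le> (\<integral>\<^sup>+z. F x z \<partial>lborel)" if x: "b \<le> f x" for x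
  proof -
    have "ennreal (b - a) * ennreal (2 * e) = (\<integral>\<^sup>+z. ennreal (b - a) * indicator (ball (0::'a) r) z \<partial>lborel)"
      by (simp add: nn_integral_cmult vol)
    also have "\<dots> \<le> (\<integral>\<^sup>+z. F x z + ennreal (trunc a b (f (x - z)) - a) \<partial>lborel)"
      using x ab by (intro nn_integral_mono)
        (auto simp: F_def trunc_def ennreal_plus[symmetric] simp del: ennreal_plus split: split_indicator)
    also have "\<dots> = (\<integral>\<^sup>+z. F x z \<partial>lborel) + (\<integral>\<^sup>+z. ennreal (trunc a b (f (x - z)) - a) \<partial>lborel)"
      by (rule nn_integral_add) auto
    also have "(\<integral>\<^sup>+z. ennreal (trunc a b (f (x - z)) - a) \<partial>lborel) = (\<integral>\<^sup>+z. ennreal (trunc a b (f z) - a) \<partial>lborel)"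
      by (subst nn_integral_lborel_reflect) auto
    also have "\<dots> \<le> ennreal (b - a) * ennreal e"
      using trunc_L1_le[of f a b] ab e by simp
    finally have *: "ennreal (b - a) * ennreal (2 * e) \<le> (\<integral>\<^sup>+z. F x z \<partial>lborel) + ennreal (b - a) * ennreal e"
      by (simp add: add_left_mono)
    show ?thesis
    proof (cases "(\<integral>\<^sup>+z. F x z \<partial>lborel)")
      case (real q)
      then show ?thesis using * ab e
        by (simp add: ennreal_mult[symmetric] ennreal_plus[symmetric] mult.commute del: ennreal_plus)
    qed simp
  qed
  have "ennreal ((b - a) * e) * emeasure lborel {x. b \<le> f x}
      = (\<integral>\<^sup>+x. ennreal ((b - a) * e) * indicator {x. b \<le> f x} x \<partial>lborel)"
    by (simp add: nn_integral_cmult)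
  also have "\<dots> \<le> (\<integral>\<^sup>+x. \<integral>\<^sup>+z. F x z \<partial>lborel \<partial>lborel)"
    using low by (intro nn_integral_mono) (auto split: split_indicator)
  also have "\<dots> = (\<integral>\<^sup>+z. \<integral>\<^sup>+x. F x z \<partial>lborel \<partial>lborel)"
    by (rule lborel_pair.Fubini'[OF Fm])
  also have "\<dots> \<le> (\<integral>\<^sup>+z. ennreal r * m * indicator (ball (0::'a) r) z \<partial>lborel)"
  proof (rule nn_integral_mono)
    fix z :: 'a
    have "(\<integral>\<^sup>+x. F x z \<partial>lborel) = (\<integral>\<^sup>+x. ennreal \<bar>trunc a b (f x) - trunc a b (f (x - z))\<bar> \<partial>lborel) * indicator (ball 0 r) z"
      unfolding F_def by (rule nn_integral_multc) measurable
    also have "\<dots> \<le> (ennreal (norm z) * m) * indicator (ball 0 r) z"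
      using trunc_translation_L1[OF deriv cont ab, of z] unfolding m_def by (intro mult_right_mono) auto
    also have "\<dots> \<le> ennreal r * m * indicator (ball 0 r) z"
      by (auto intro!: mult_right_mono ennreal_leI split: split_indicator)
    finally show "(\<integral>\<^sup>+x. F x z \<partial>lborel) \<le> ennreal r * m * indicator (ball 0 r) z" .
  qed
  also have "\<dots> = ennreal r * m * ennreal (2 * e)"
    by (simp add: nn_integral_cmult vol)
  finally have "ennreal e * (ennreal (b - a) * emeasure lborel {x. b \<le> f x}) \<le> ennreal e * (ennreal (2 * r) * m)"
    using ab e r by (simp add: ennreal_mult ac_simps)
  then show ?thesis
    unfolding m_def[symmetric] r_def[symmetric] using e by (simp add: ennreal_mult_le_mult_iff)
qed

text \<open>Young's inequality, integrated. The powers are arranged for duality, with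
  \<open>g powr (p - 1)\<close> in the conjugate space. As the normalisation divides by
  \<open>A\<close> and \<open>B\<close>, the case \<open>B = 0\<close> is treated apart: there
  \<open>h\<close> vanishes almost everywhere.\<close>

lemma Holder_nn:
  fixes g h :: "'a \<Rightarrow> real"
  assumes p: "p > 1" and [measurable]: "g \<in> borel_measurable M" "h \<in> borel_measurable M"
    and nn: "\<And>x. 0 \<le> g x" "\<And>x. 0 \<le> h x"
    and A: "(\<integral>\<^sup>+x. ennreal (g x powr p) \<partial>M) \<le> ennreal A" "A > 0"
    and B: "(\<integral>\<^sup>+x. ennreal (h x powr p) \<partial>M) \<le> ennreal B" "B \<ge> 0"
  shows "(\<integral>\<^sup>+x. ennreal (g x powr (p - 1) * h x) \<partial>M) \<le> ennreal (A powr (1 - 1/p) * B powr (1 / p))"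
proof (cases "B = 0")
  case True
  then have "AE x in M. ennreal (h x powr p) = 0"
    using B by (subst nn_integral_0_iff_AE[symmetric]) (auto simp: le_zero_eq)
  then have "AE x in M. ennreal (g x powr (p - 1) * h x) = 0"
    by eventually_elim (use nn p in \<open>auto simp: ennreal_eq_0_iff\<close>)
  then have "(\<integral>\<^sup>+x. ennreal (g x powr (p - 1) * h x) \<partial>M) = 0"
    by (subst nn_integral_0_iff_AE) auto
  then show ?thesis by simp
next
  case False
  then have B0: "B > 0" using B by simp
  let ?K = "A powr (1 - 1/p) * B powr (1 / p)"
  have pw: "g x powr (p - 1) * h x \<le> ?K * ((1 - 1/p) / A * g x powr p + (1/p) / B * h x powr p)" for x
  proof (cases "g x = 0 \<or> h x = 0")
    case True
    then show ?thesis using p A B0 by auto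
  next
    case False
    then have pos: "g x > 0" "h x > 0" using nn[of x] by auto
    \<comment> \<open>After division by \<open>A\<close> and \<open>B\<close> the two terms on the
      right integrate to at most \<open>1 - 1/p\<close> and \<open>1/p\<close>, which add up to
      1.\<close>
    have *: "(g x powr p / A) powr (1 - 1/p) * (h x powr p / B) powr (1/p)
       \<le> (1 - 1/p) * (g x powr p / A) + (1/p) * (h x powr p / B)"
      using p pos A B0 by (intro Youngs_inequality_0) auto
    have **: "?K * ((g x powr p / A) powr (1 - 1/p) * (h x powr p / B) powr (1/p)) = g x powr (p - 1) * h x"
    proof -
      have "p * (1 - 1/p) = p - 1" "p * (1 / p) = 1" using p by (auto simp: field_simps)
      then have "(g x powr p / A) powr (1 - 1/p) = g x powr (p - 1) / A powr (1 - 1/p)"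
        "(h x powr p / B) powr (1/p) = h x / B powr (1/p)"
        using pos A B0 by (auto simp: powr_divide powr_powr)
      then show ?thesis using A B0 by simp
    qed
    show ?thesis
      using mult_left_mono[OF *, of ?K] unfolding ** by simp
  qed
  have "(\<integral>\<^sup>+x. ennreal (g x powr (p - 1) * h x) \<partial>M)
    \<le> (\<integral>\<^sup>+x. ennreal ?K * (ennreal ((1 - 1/p) / A) * ennreal (g x powr p) + ennreal ((1/p) / B) * ennreal (h x powr p)) \<partial>M)"
    using pw p A B0 by (intro nn_integral_mono)
      (simp add: ennreal_mult[symmetric] ennreal_plus[symmetric] del: ennreal_plus)
  also have "\<dots> = ennreal ?K * (ennreal ((1 - 1/p) / A) * (\<integral>\<^sup>+x. ennreal (g x powr p) \<partial>M) + ennreal ((1/p) / B) * (\<integral>\<^sup>+x. ennreal (h x powr p) \<partial>M))"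
    by (simp add: nn_integral_cmult nn_integral_add)
  also have "\<dots> \<le> ennreal ?K * (ennreal ((1 - 1/p) / A) * ennreal A + ennreal ((1/p) / B) * ennreal B)"
    using A B by (intro mult_left_mono add_mono) auto
  also have "\<dots> = ennreal ?K"
    using A B0 p by (simp add: ennreal_mult[symmetric] ennreal_plus[symmetric] del: ennreal_plus)
  finally show ?thesis .
qed

text \<open>Summing the recursion puts half of the sum on the right, where it is absorbed, at the
  price of the boundary term \<open>b n\<close>. The bound \<open>B\<close> serves only to make the
  partial sums bounded; once the series converges, \<open>b n\<close> tends to 0 and
  \<open>B\<close> disappears from the estimate.\<close>

lemma halving_recursion_sum_le:
  fixes b m :: "nat \<Rightarrow> real"
  assumes nn: "\<And>j. 0 \<le> b j" and rec: "\<And>j. b j \<le> b (Suc j) / 2 + C * m j" and "0 \<le> C"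
    and bdd: "\<And>j. b j \<le> B" and S: "\<And>n. (\<Sum>j<n. m j) \<le> S"
  shows "summable b" "suminf b \<le> 2 * C * S"
proof -
  have part: "(\<Sum>j<n. b j) \<le> b n + 2 * C * S" for n
  proof -
    have "(\<Sum>j<n. b j) \<le> (\<Sum>j<n. b (Suc j) / 2 + C * m j)" by (intro sum_mono rec)
    also have "\<dots> = ((\<Sum>j<n. b j) + b n - b 0) / 2 + C * (\<Sum>j<n. m j)"
      using sum.lessThan_Suc_shift[of b n] by (simp add: sum.distrib sum_divide_distrib[symmetric] sum_distrib_left)
    also have "\<dots> \<le> ((\<Sum>j<n. b j) + b n) / 2 + C * S"
      using nn[of 0] mult_left_mono[OF S \<open>0 \<le> C\<close>, of n] by (simp add: field_simps)
    finally show ?thesis by (simp add: field_simps)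
  qed
  show sm: "summable b"
    by (rule summableI_nonneg_bounded[OF nn, where x="B + 2 * C * S"]) (use part bdd in \<open>meson add_right_mono order_trans\<close>)
  have "(\<lambda>n. b n + 2 * C * S) \<longlonglongrightarrow> 0 + 2 * C * S"
    by (intro tendsto_intros summable_LIMSEQ_zero sm)
  with summable_LIMSEQ[OF sm] show "suminf b \<le> 2 * C * S"
    using part by (auto intro: LIMSEQ_le)
qed

text \<open>Think of \<open>y\<close> and \<open>x\<close> as the volumes above the levels
  \<open>l\<close> and \<open>2 * l\<close>. If \<open>x\<close> is much smaller than
  \<open>y\<close>, the scaled volume is halved outright. Otherwise \<open>y\<close> is at most a
  multiple of \<open>x\<close>, so the power of \<open>y\<close> in the weak Sobolev inequality can
  be traded for one of \<open>x\<close> and cancelled.\<close>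

lemma isoperimetric_dichotomy:
  fixes d l x y c m :: real
  assumes "d > 1" "l > 0" "x \<ge> 0" "y > 0" "c \<ge> 0" "m \<ge> 0"
    and le: "l * x \<le> c * y powr (1/d) * m"
  defines "\<kappa> \<equiv> 1 - 1/d"
  shows "2 * l * x powr \<kappa> \<le> (l * y powr \<kappa>) / 2 + 2 * c * (4 powr (1/\<kappa>)) powr (1/d) * m"
proof -
  have k: "\<kappa> > 0" using assms by (simp add: \<kappa>_def)
  \<comment> \<open>The 4 consists of a factor 2 for the doubled level and a factor 2 for the
    halving; the exponent \<open>1/\<kappa>\<close> undoes the power \<open>\<kappa>\<close> of the
    volume.\<close>
  define \<delta> where "\<delta> = 4 powr (1/\<kappa>)"
  have \<delta>: "\<delta> > 0" by (simp add: \<delta>_def)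
  show ?thesis
  proof (cases "x * \<delta> \<le> y")
    case True
    have "x powr \<kappa> * 4 = (x * \<delta>) powr \<kappa>"
      using assms k by (simp add: powr_mult \<delta>_def powr_powr)
    also have "\<dots> \<le> y powr \<kappa>"
      using True assms k \<delta> by (intro powr_mono2) auto
    finally have "2 * l * x powr \<kappa> \<le> (l * y powr \<kappa>) / 2"
      using \<open>l > 0\<close> by (simp add: field_simps)
    then show ?thesis using assms by (simp add: add_increasing2)
  next
    case False
    then have x: "x > 0" using assms \<delta> by (metis less_eq_real_def mult_zero_left not_le)
    have "l * x \<le> c * (x * \<delta>) powr (1/d) * m"
      using le False assms by (elim order_trans) (intro mult_right_mono mult_left_mono powr_mono2, auto)
    also have "\<dots> = x powr (1/d) * (c * \<delta> powr (1/d) * m)"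
      using x \<delta> by (simp add: powr_mult)
    finally have "l * x powr \<kappa> * x powr (1/d) \<le> (c * \<delta> powr (1/d) * m) * x powr (1/d)"
    proof -
      have "x powr \<kappa> * x powr (1/d) = x"
        using x by (simp add: \<kappa>_def powr_add[symmetric])
      moreover assume "l * x \<le> x powr (1 / d) * (c * \<delta> powr (1 / d) * m)"
      ultimately show ?thesis by (simp add: mult.assoc mult.commute[of "x powr (1/d)"])
    qed
    then have "l * x powr \<kappa> \<le> c * \<delta> powr (1/d) * m"
      using x by (simp only: mult_le_cancel_right) auto
    moreover have "0 \<le> (l * y powr \<kappa>) / 2" using assms by simp
    ultimately show ?thesis by (simp add: \<delta>_def)
  qed
qed

text \<open>The bound is 2 rather than 1 because neighbouring closed intervals share an endpoint.
  For the induction it is sharpened by two indicators, which advance by one level in each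
  step.\<close>

lemma sum_indicator_dyadic_le:
  fixes M r :: real
  assumes "M > 0"
  shows "(\<Sum>j<n. indicator {M / 2 ^ Suc j..M / 2 ^ j} r) \<le> (2::real)"
proof -
  have "(\<Sum>j<n. indicator {M / 2 ^ Suc j..M / 2 ^ j} r)
    \<le> (2::real) - indicator {..M / 2 ^ n} r - indicator {..M / 2 ^ Suc n} r"
  proof (induction n)
    case 0
    then show ?case by (auto split: split_indicator)
  next
    case (Suc n)
    have "M / 2 ^ Suc (Suc n) < M / 2 ^ Suc n" "M / 2 ^ Suc n < M / 2 ^ n"
      using assms by (auto simp: field_simps)
    then have "indicator {M / 2 ^ Suc n..M / 2 ^ n} r
      \<le> indicator {..M / 2 ^ n} r - (indicator {..M / 2 ^ Suc (Suc n)} r :: real)"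
      by (auto simp del: power_Suc split: split_indicator)
    with Suc show ?case by (simp del: power_Suc)
  qed
  then show ?thesis by (rule order_trans) (auto split: split_indicator)
qed

text \<open>Clamping is monotone, so for a given pair the increments in all layers have the same
  sign and their absolute values add up without loss.\<close>

lemma dyadic_trunc_sums:
  fixes M r r' :: real
  assumes "M > 0" "r \<le> M" "r' \<le> M"
  shows "(\<lambda>j. \<bar>trunc (M / 2 ^ Suc j) (M / 2 ^ j) r - trunc (M / 2 ^ Suc j) (M / 2 ^ j) r'\<bar>)
    sums \<bar>max 0 r - max 0 r'\<bar>"
proof -
  have l: "M / 2 ^ Suc j < M / 2 ^ j" for j using assms by (simp add: field_simps)
  have S: "(\<lambda>j. trunc (M / 2 ^ Suc j) (M / 2 ^ j) r - M / 2 ^ Suc j) sums max 0 r" if "r \<le> M" for r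
  proof -
    \<comment> \<open>\<open>H j\<close> is the excess of \<open>r\<close> over the level
      \<open>M / 2 ^ j\<close>. The clamped height in layer \<open>j\<close> is a difference of
      consecutive excesses, and the series telescopes from \<open>H 0 = 0\<close> to the limit
      \<open>max 0 r\<close>.\<close>
    define H where "H = (\<lambda>j. max (M / 2 ^ j) r - M / 2 ^ j)"
    have "(\<lambda>j. M / 2 ^ j) \<longlonglongrightarrow> 0"
      by (rule LIMSEQ_divide_realpow_zero) simp
    then have "H \<longlonglongrightarrow> max 0 r - 0"
      unfolding H_def by (intro tendsto_intros)
    then have "(\<lambda>j. H (Suc j) - H j) sums (max 0 r - 0 - H 0)"
      by (rule telescope_sums)
    moreover have "H (Suc j) - H j = trunc (M / 2 ^ Suc j) (M / 2 ^ j) r - M / 2 ^ Suc j" for j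
      using l[of j] by (auto simp: H_def trunc_def max_def min_def simp del: power_Suc)
    moreover have "H 0 = 0" using that by (simp add: H_def)
    ultimately show ?thesis by simp
  qed
  have *: "(\<lambda>j. \<bar>trunc (M / 2 ^ Suc j) (M / 2 ^ j) r - trunc (M / 2 ^ Suc j) (M / 2 ^ j) r'\<bar>)
    sums \<bar>max 0 r - max 0 r'\<bar>" if "r' \<le> r" "r \<le> M" "r' \<le> M" for r r'
  proof -
    have "trunc (M / 2 ^ Suc j) (M / 2 ^ j) r' \<le> trunc (M / 2 ^ Suc j) (M / 2 ^ j) r" for j
      using that by (auto simp: trunc_def)
    then show ?thesis
      using sums_diff[OF S[OF that(2)] S[OF that(3)]] that(1) by (simp add: max_def)
  qed
  show ?thesis
    using *[of r' r] *[of r r'] assms by (cases "r' \<le> r") (auto simp: abs_minus_commute)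
qed

text \<open>The clamped increment is interpolated between its L1 norm and its bound
  \<open>b - a\<close>, then paired by Hoelder's inequality. Of the two L1 bounds, the one by the
  gradient is good for small \<open>z\<close> and the one by the volume for large \<open>z\<close>;
  the minimum is kept so that the later integral over \<open>z\<close> converges at both
  ends.\<close>

lemma layer_pairing_le:
  fixes f w :: "'a::euclidean_space \<Rightarrow> real" and Df :: "'a \<Rightarrow> 'a"
  assumes deriv: "\<And>x. (f has_derivative (\<lambda>h. Df x \<bullet> h)) (at x)"
    and cont: "continuous_on UNIV Df" and ab: "a \<le> b"
    and p: "p > 1" and w: "w \<in> borel_measurable borel" "\<And>x. 0 \<le> w x"
    and A: "(\<integral>\<^sup>+x. ennreal (w x powr p) \<partial>lborel) \<le> ennreal A" "A > 0"
    and m: "(\<integral>\<^sup>+x. ennreal (norm (Df x) * indicator {a..b} (f x)) \<partial>lborel) \<le> ennreal m" "m \<ge> 0"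
    and e: "emeasure lborel {x. a < f x} \<le> ennreal e" "e \<ge> 0"
  shows "(\<integral>\<^sup>+x. ennreal (w x powr (p - 1) * \<bar>trunc a b (f x) - trunc a b (f (x - z))\<bar>) \<partial>lborel)
    \<le> ennreal (A powr (1 - 1/p) * (b - a) powr (1 - 1/p) * min (norm z * m) (2 * (b - a) * e) powr (1/p))"
proof -
  have fc: "continuous_on UNIV f" using deriv by (meson continuous_at_imp_continuous_on has_derivative_continuous)
  have [measurable]: "f \<in> borel_measurable borel" "w \<in> borel_measurable borel"
    using fc w by (auto intro: borel_measurable_continuous_onI)
  define F where "F = (\<lambda>x. \<bar>trunc a b (f x) - trunc a b (f (x - z))\<bar>)"
  have [measurable]: "F \<in> borel_measurable borel" unfolding F_def by measurable
  define D where "D = min (norm z * m) (2 * (b - a) * e)"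
  have D0: "D \<ge> 0" using ab m e by (auto simp: D_def)
  have F: "0 \<le> F x" "F x \<le> b - a" for x
    using ab by (auto simp: F_def trunc_def)
  have "(\<integral>\<^sup>+x. ennreal (F x) \<partial>lborel) \<le> ennreal (norm z) * ennreal m"
    unfolding F_def using trunc_translation_L1[OF deriv cont ab, of z] mult_left_mono[OF m(1), of "ennreal (norm z)"]
    by (elim order_trans) auto
  moreover have "(\<integral>\<^sup>+x. ennreal (F x) \<partial>lborel) \<le> ennreal (2 * (b - a) * e)"
  proof -
    have "(\<integral>\<^sup>+x. ennreal (F x) \<partial>lborel)
      \<le> (\<integral>\<^sup>+x. ennreal (trunc a b (f x) - a) + ennreal (trunc a b (f (x - z)) - a) \<partial>lborel)"
    proof (rule nn_integral_mono)
      fix x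
      have "a \<le> trunc a b r" for r by (simp add: trunc_def)
      from this[of "f x"] this[of "f (x - z)"]
      show "ennreal (F x) \<le> ennreal (trunc a b (f x) - a) + ennreal (trunc a b (f (x - z)) - a)"
        by (simp add: F_def ennreal_plus[symmetric] abs_if del: ennreal_plus)
    qed
    also have "\<dots> = (\<integral>\<^sup>+x. ennreal (trunc a b (f x) - a) \<partial>lborel) + (\<integral>\<^sup>+x. ennreal (trunc a b (f (x - z)) - a) \<partial>lborel)"
      by (rule nn_integral_add) auto
    also have "(\<integral>\<^sup>+x. ennreal (trunc a b (f (x - z)) - a) \<partial>lborel) = (\<integral>\<^sup>+x. ennreal (trunc a b (f x) - a) \<partial>lborel)"
      by (rule nn_integral_lborel_shift[of "\<lambda>x. ennreal (trunc a b (f x) - a)"]) measurable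
    finally have "(\<integral>\<^sup>+x. ennreal (F x) \<partial>lborel)
      \<le> (\<integral>\<^sup>+x. ennreal (trunc a b (f x) - a) \<partial>lborel) + (\<integral>\<^sup>+x. ennreal (trunc a b (f x) - a) \<partial>lborel)" .
    also have "(\<integral>\<^sup>+x. ennreal (trunc a b (f x) - a) \<partial>lborel) \<le> ennreal (b - a) * ennreal e"
      using trunc_L1_le[of f a b] ab mult_left_mono[OF e(1), of "ennreal (b - a)"] by (auto elim: order_trans)
    then have "(\<integral>\<^sup>+x. ennreal (trunc a b (f x) - a) \<partial>lborel) + (\<integral>\<^sup>+x. ennreal (trunc a b (f x) - a) \<partial>lborel)
      \<le> ennreal (b - a) * ennreal e + ennreal (b - a) * ennreal e"
      by (intro add_mono)
    also have "\<dots> = ennreal (2 * (b - a) * e)"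
      using ab e by (simp add: ennreal_mult[symmetric] ennreal_plus[symmetric] del: ennreal_plus)
    finally show ?thesis .
  qed
  ultimately have FD: "(\<integral>\<^sup>+x. ennreal (F x) \<partial>lborel) \<le> ennreal D"
    using m ab e by (simp add: D_def ennreal_mult[symmetric] min_def)
  have "(\<integral>\<^sup>+x. ennreal (F x powr p) \<partial>lborel) \<le> (\<integral>\<^sup>+x. ennreal ((b - a) powr (p - 1)) * ennreal (F x) \<partial>lborel)"
  proof (rule nn_integral_mono)
    fix x
    have "F x powr p = F x powr (p - 1) * F x"
      using F(1)[of x] by (cases "F x = 0") (auto simp: powr_diff)
    also have "\<dots> \<le> (b - a) powr (p - 1) * F x"
      using F[of x] p by (intro mult_right_mono powr_mono2) auto
    finally show "ennreal (F x powr p) \<le> ennreal ((b - a) powr (p - 1)) * ennreal (F x)"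
      using F[of x] by (simp add: ennreal_mult[symmetric])
  qed
  also have "\<dots> \<le> ennreal ((b - a) powr (p - 1) * D)"
    using mult_left_mono[OF FD, of "ennreal ((b - a) powr (p - 1))"] D0 by (simp add: nn_integral_cmult ennreal_mult)
  finally have "(\<integral>\<^sup>+x. ennreal (w x powr (p - 1) * F x) \<partial>lborel)
    \<le> ennreal (A powr (1 - 1/p) * ((b - a) powr (p - 1) * D) powr (1/p))"
    using p w F(1) A D0 by (intro Holder_nn) auto
  also have "((b - a) powr (p - 1) * D) powr (1/p) = (b - a) powr (1 - 1/p) * D powr (1/p)"
  proof -
    have "(p - 1) * (1/p) = 1 - 1/p" using p by (simp add: field_simps)
    then show ?thesis using ab D0 by (simp add: powr_mult powr_powr)
  qed
  finally show ?thesis by (simp add: F_def D_def mult.assoc)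
qed

text \<open>For \<open>a = b = 1\<close> the integrand is a power of the norm near 0, with exponent
  \<open>- (d + s - \<theta>)\<close>, integrable because \<open>s < \<theta>\<close>, and another
  at infinity, with exponent \<open>- (d + s)\<close>, integrable because \<open>0 < s\<close>. The
  dependence on \<open>a\<close> and \<open>b\<close> follows by scaling.\<close>

lemma nn_integral_min_powr_le:
  fixes s \<theta> :: real
  assumes "0 < s" "s < \<theta>" "\<theta> < 1"
  shows "\<exists>J\<ge>0. \<forall>a\<ge>0. \<forall>b\<ge>0.
    (\<integral>\<^sup>+z. ennreal (norm (z::'a::euclidean_space) powr (- (real DIM('a) + s)) * min (norm z * a) b powr \<theta>) \<partial>lborel)
      \<le> ennreal (J * a powr s * b powr (\<theta> - s))"
proof -
  let ?d = "real DIM('a)"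
  have d1: "?d \<ge> 1" using DIM_positive[where 'a='a] by linarith
  define I where "I = (\<integral>\<^sup>+z. ennreal (norm (z::'a) powr (- (?d + s)) * min (norm z) 1 powr \<theta>) \<partial>lborel)"
  have [measurable]: "ball (0::'a) 1 \<in> sets borel" by simp
  define g1 g2 :: "'a \<Rightarrow> ennreal"
    where "g1 = (\<lambda>z. ennreal (norm z powr (- (?d + s - \<theta>))) * indicator (ball 0 1) z)"
      and "g2 = (\<lambda>z. ennreal (norm z powr (- (?d + s))) * indicator (- ball 0 1) z)"
  have [measurable]: "g1 \<in> borel_measurable borel" "g2 \<in> borel_measurable borel"
    unfolding g1_def g2_def by measurable
  have "I \<le> (\<integral>\<^sup>+z. g1 z + g2 z \<partial>lborel)"
    unfolding I_def
  proof (rule nn_integral_mono)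
    fix z :: 'a
    have "norm z powr (- (?d + s)) * norm z powr \<theta> = norm z powr (- (?d + s - \<theta>))"
      unfolding powr_add[symmetric] by (rule arg_cong[where f="(powr) (norm z)"]) simp
    then show "ennreal (norm z powr (- (?d + s)) * min (norm z) 1 powr \<theta>) \<le> g1 z + g2 z"
      unfolding g1_def g2_def by (cases "norm z < 1") (simp_all only: min_def, simp_all)
  qed
  also have "\<dots> = (\<integral>\<^sup>+z. g1 z \<partial>lborel) + (\<integral>\<^sup>+z. g2 z \<partial>lborel)"
    by (rule nn_integral_add) simp_all
  also have "\<dots> < \<infinity>"
    using nn_integral_powr_inside[where 'a='a, of "?d + s - \<theta>" 1] nn_integral_powr_outside[where 'a='a, of "?d + s" 1] assms d1
    by (simp add: g1_def g2_def)
  finally have If: "I < \<infinity>" .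
  define J where "J = enn2real I"
  have J: "I = ennreal J" "J \<ge> 0" using If by (auto simp: J_def)
  show ?thesis
  proof (intro exI conjI allI impI)
    fix a b :: real assume ab: "0 \<le> a" "0 \<le> b"
    let ?L = "\<integral>\<^sup>+z. ennreal (norm (z::'a) powr (- (?d + s)) * min (norm z * a) b powr \<theta>) \<partial>lborel"
    show "?L \<le> ennreal (J * a powr s * b powr (\<theta> - s))"
    proof (cases "a = 0 \<or> b = 0")
      case True
      then have "min (norm z * a) b = 0" for z :: 'a using ab by auto
      then show ?thesis by simp
    next
      case False
      then have pos: "a > 0" "b > 0" using ab by auto
      \<comment> \<open>The radius at which the two entries of the minimum agree.\<close>
      define c where "c = b / a"
      have c: "c > 0" using pos by (simp add: c_def)
      have "?L = ennreal (\<bar>c\<bar> ^ DIM('a)) * (\<integral>\<^sup>+z. ennreal (norm (0 + c *\<^sub>R z :: 'a) powr (- (?d + s)) * min (norm (0 + c *\<^sub>R z) * a) b powr \<theta>) \<partial>lborel)"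
        using c by (intro nn_integral_lborel_affine) auto
      also have "\<dots> = ennreal (c powr ?d) * (\<integral>\<^sup>+z. ennreal (c powr (- (?d + s)) * b powr \<theta>) * ennreal (norm (z::'a) powr (- (?d + s)) * min (norm z) 1 powr \<theta>) \<partial>lborel)"
      proof (intro arg_cong2[where f="(*)"] nn_integral_cong)
        fix z :: 'a
        have "norm (c *\<^sub>R z) * a = b * norm z" using pos by (simp add: c_def)
        then have "min (norm (c *\<^sub>R z) * a) b = min (b * norm z) (b * 1)" by (simp only: mult_1_right)
        also have "\<dots> = b * min (norm z) 1" using pos by (simp only: min_mult_distrib_left) simp
        finally have "min (norm (c *\<^sub>R z) * a) b = b * min (norm z) 1" .
        then show "ennreal (norm (0 + c *\<^sub>R z) powr (- (?d + s)) * min (norm (0 + c *\<^sub>R z) * a) b powr \<theta>)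
           = ennreal (c powr (- (?d + s)) * b powr \<theta>) * ennreal (norm z powr (- (?d + s)) * min (norm z) 1 powr \<theta>)"
          using c pos by (simp add: powr_mult ennreal_mult[symmetric] ac_simps)
      qed (use c in \<open>simp add: powr_realpow\<close>)
      also have "\<dots> = ennreal (c powr ?d) * (ennreal (c powr (- (?d + s)) * b powr \<theta>) * ennreal J)"
        unfolding J(1)[symmetric] I_def by (subst nn_integral_cmult) auto
      also have "\<dots> = ennreal (c powr (?d + (- (?d + s))) * b powr \<theta> * J)"
        using J pos by (simp only: powr_add) (simp add: ennreal_mult[symmetric] ac_simps)
      also have "c powr (?d + (- (?d + s))) * b powr \<theta> * J = J * a powr s * b powr (\<theta> - s)"
        using pos by (simp add: c_def powr_divide powr_minus powr_diff field_simps)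
      finally show ?thesis by simp
    qed
  qed (use J in auto)
qed

section \<open>Summation over the layers\<close>

lemma powr_interp_le_add:
  fixes x y s :: real
  assumes "0 \<le> x" "0 \<le> y" "0 < s" "s < 1"
  shows "x powr s * y powr (1 - s) \<le> x + y"
proof (cases "x = 0 \<or> y = 0")
  case True
  then show ?thesis using assms by auto
next
  case False
  then have "x powr s * y powr (1 - s) \<le> s * x + (1 - s) * y"
    using assms by (intro Youngs_inequality_0) auto
  also have "\<dots> \<le> 1 * x + 1 * y" using assms by (intro add_mono mult_right_mono) auto
  finally show ?thesis by simp
qed

text \<open>The constant is chosen before all functions and bounds, and the a priori bound
  \<open>B\<close> does not enter the conclusion: it only permits the absorption in
  \<open>halving_recursion_sum_le\<close>. Positive parts appear because the levels
  \<open>M / 2 ^ j\<close> exhaust the values in \<open>(0, M]\<close>; the negative part of a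
  function is reached through its negation.\<close>

lemma positive_part_pairing:
  fixes s :: real
  assumes s: "0 < s" "s < 1" and dim: "DIM('a::euclidean_space) \<ge> 2"
  defines "d \<equiv> real DIM('a)"
  defines "p \<equiv> d / (d - 1 + s)"
  shows "\<exists>C>0. \<forall>(f :: 'a \<Rightarrow> real) Df w M B A m.
    (\<forall>x. (f has_derivative (\<lambda>h. Df x \<bullet> h)) (at x)) \<longrightarrow> continuous_on UNIV Df \<longrightarrow>
    w \<in> borel_measurable borel \<longrightarrow> (\<forall>x. 0 \<le> w x) \<longrightarrow> 0 < M \<longrightarrow> (\<forall>x. f x \<le> M) \<longrightarrow>
    (\<forall>l. 0 < l \<longrightarrow> l \<le> M \<longrightarrow> emeasure lborel {x. l < f x} < \<infinity> \<and> l * measure lborel {x. l < f x} powr (1 - 1/d) \<le> B) \<longrightarrow>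
    (\<integral>\<^sup>+x. ennreal (norm (Df x)) \<partial>lborel) \<le> ennreal m \<longrightarrow> 0 \<le> m \<longrightarrow>
    (\<integral>\<^sup>+x. ennreal (w x powr p) \<partial>lborel) \<le> ennreal A \<longrightarrow> 0 < A \<longrightarrow>
    (\<integral>\<^sup>+z. \<integral>\<^sup>+x. ennreal (norm z powr (- (d + s)) * (w x powr (p - 1) * \<bar>max 0 (f x) - max 0 (f (x - z))\<bar>)) \<partial>lborel \<partial>lborel)
      \<le> ennreal (C * A powr (1 - 1/p) * m)"
proof -
  let ?\<omega> = "unit_ball_vol (real DIM('a))"
  define \<kappa> where "\<kappa> = 1 - 1/d"
  define \<theta> where "\<theta> = 1/p"
  have d: "d \<ge> 2" using dim by (simp add: d_def)
  have \<kappa>: "\<kappa> > 0" using d by (simp add: \<kappa>_def)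
  have p1: "p > 1" using d s by (simp add: p_def field_simps)
  have \<theta>eq: "\<theta> = (d - 1 + s) / d" using d s by (simp add: \<theta>_def p_def)
  \<comment> \<open>This relation is what fixes the exponent \<open>p\<close>: the powers of level
    and volume left over by the interpolation then combine to a single power \<open>1 - s\<close> of
    \<open>b j\<close>.\<close>
  have \<theta>s: "\<theta> - s = \<kappa> * (1 - s)" using d by (simp add: \<theta>eq \<kappa>_def field_simps)
  have \<theta>: "s < \<theta>" "\<theta> < 1"
    using \<theta>s mult_pos_pos[OF \<kappa>, of "1 - s"] s d by (auto simp: \<theta>eq)
  \<comment> \<open>The constant of \<open>layer_weak_sobolev\<close> with the volume split off, so
    that \<open>e powr (1/d)\<close> stands alone; \<open>C0\<close> is what
    \<open>isoperimetric_dichotomy\<close> makes of it.\<close>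
  define c where "c = 2 * (2 / ?\<omega>) powr (1/d)"
  define C0 where "C0 = 2 * c * (4 powr (1/\<kappa>)) powr (1/d)"
  have c0: "c \<ge> 0" "C0 \<ge> 0" by (auto simp: c_def C0_def)
  obtain J where J: "J \<ge> 0" "\<And>a b. 0 \<le> a \<Longrightarrow> 0 \<le> b \<Longrightarrow>
    (\<integral>\<^sup>+z. ennreal (norm (z::'a) powr (- (d + s)) * min (norm z * a) b powr \<theta>) \<partial>lborel)
      \<le> ennreal (J * a powr s * b powr (\<theta> - s))"
    using nn_integral_min_powr_le[where 'a='a, of s \<theta>] s \<theta> unfolding d_def by blast
  show ?thesis
  \<comment> \<open>Each layer carries the factor \<open>2 * J\<close>. The sum of the
    \<open>mm j\<close> is at most \<open>2 * m\<close> and that of the \<open>b j\<close> at most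
    \<open>4 * C0 * m\<close>; the final 1 keeps the constant positive.\<close>
  proof (rule exI[of _ "J * (4 + 8 * C0) + 1"], intro conjI allI impI)
    show "J * (4 + 8 * C0) + 1 > 0" using J c0 by (simp add: add_nonneg_pos)
    fix f w :: "'a \<Rightarrow> real" and Df and M B A m :: real
    assume deriv: "\<forall>x. (f has_derivative (\<lambda>h. Df x \<bullet> h)) (at x)" and cont: "continuous_on UNIV Df"
      and w: "w \<in> borel_measurable borel" "\<forall>x. 0 \<le> w x" and M: "0 < M" and fM: "\<forall>x. f x \<le> M"
      and lev: "\<forall>l. 0 < l \<longrightarrow> l \<le> M \<longrightarrow> emeasure lborel {x. l < f x} < \<infinity> \<and> l * measure lborel {x. l < f x} powr (1 - 1/d) \<le> B"
      and m: "(\<integral>\<^sup>+x. ennreal (norm (Df x)) \<partial>lborel) \<le> ennreal m" "0 \<le> m"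
      and A: "(\<integral>\<^sup>+x. ennreal (w x powr p) \<partial>lborel) \<le> ennreal A" "0 < A"
    have fc: "continuous_on UNIV f" using deriv by (meson continuous_at_imp_continuous_on has_derivative_continuous)
    have [measurable]: "f \<in> borel_measurable borel" "Df \<in> borel_measurable borel" "w \<in> borel_measurable borel"
      using fc cont w by (auto intro: borel_measurable_continuous_onI)
    define l where "l = (\<lambda>j::nat. M / 2 ^ j)"
    have l: "0 < l j" "l j \<le> M" "l (Suc j) < l j" "l j - l (Suc j) = l (Suc j)" "l j = 2 * l (Suc j)" for j
      using M by (auto simp: l_def field_simps)
    define e where "e = (\<lambda>j. measure lborel {x. l (Suc j) < f x})"
    have e: "emeasure lborel {x. l (Suc j) < f x} = ennreal (e j)" "e j \<ge> 0" for j
      using lev l(1,2)[of "Suc j"] by (auto simp: e_def emeasure_eq_ennreal_measure)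
    define mm where "mm = (\<lambda>j. enn2real (\<integral>\<^sup>+x. ennreal (norm (Df x) * indicator {l (Suc j)..l j} (f x)) \<partial>lborel))"
    have mm: "(\<integral>\<^sup>+x. ennreal (norm (Df x) * indicator {l (Suc j)..l j} (f x)) \<partial>lborel) = ennreal (mm j)" "mm j \<ge> 0" for j
    proof -
      have "(\<integral>\<^sup>+x. ennreal (norm (Df x) * indicator {l (Suc j)..l j} (f x)) \<partial>lborel) \<le> (\<integral>\<^sup>+x. ennreal (norm (Df x)) \<partial>lborel)"
        by (intro nn_integral_mono) (auto split: split_indicator)
      also have "\<dots> < \<infinity>" using m(1) by (simp add: le_less_trans)
      finally show "(\<integral>\<^sup>+x. ennreal (norm (Df x) * indicator {l (Suc j)..l j} (f x)) \<partial>lborel) = ennreal (mm j)"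
        by (simp add: mm_def)
    qed (simp add: mm_def)
    have mmS: "(\<Sum>j<n. mm j) \<le> 2 * m" for n
    proof -
      have "ennreal (\<Sum>j<n. mm j) = (\<Sum>j<n. \<integral>\<^sup>+x. ennreal (norm (Df x) * indicator {l (Suc j)..l j} (f x)) \<partial>lborel)"
        by (simp add: mm)
      also have "\<dots> = (\<integral>\<^sup>+x. (\<Sum>j<n. ennreal (norm (Df x) * indicator {l (Suc j)..l j} (f x))) \<partial>lborel)"
        by (rule nn_integral_sum[symmetric]) measurable
      also have "\<dots> \<le> (\<integral>\<^sup>+x. ennreal 2 * ennreal (norm (Df x)) \<partial>lborel)"
      proof (rule nn_integral_mono)
        fix x
        have "(\<Sum>j<n. norm (Df x) * indicator {l (Suc j)..l j} (f x)) \<le> norm (Df x) * 2"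
          unfolding sum_distrib_left[symmetric] l_def by (intro mult_left_mono sum_indicator_dyadic_le M) simp
        then have "ennreal (\<Sum>j<n. norm (Df x) * indicator {l (Suc j)..l j} (f x)) \<le> ennreal (norm (Df x) * 2)"
          by (rule ennreal_leI)
        also have "\<dots> = ennreal 2 * ennreal (norm (Df x))"
          by (simp only: mult.commute[of "norm (Df x)"]) (rule ennreal_mult, simp_all)
        finally show "(\<Sum>j<n. ennreal (norm (Df x) * indicator {l (Suc j)..l j} (f x))) \<le> ennreal 2 * ennreal (norm (Df x))"
          by (subst sum_ennreal) auto
      qed
      also have "\<dots> \<le> ennreal 2 * ennreal m"
        using m by (simp add: nn_integral_cmult mult_left_mono)
      also have "\<dots> = ennreal (2 * m)" using m by (intro ennreal_mult[symmetric]) auto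
      finally show ?thesis using m by (simp only: ennreal_le_iff)
    qed
    define b where "b = (\<lambda>j. l (Suc j) * e j powr \<kappa>)"
    have b0: "b j \<ge> 0" for j using l(1)[of "Suc j"] by (simp add: b_def)
    have bB: "b j \<le> B" for j
      using lev l(1,2)[of "Suc j"] by (auto simp: b_def e_def \<kappa>_def)
    \<comment> \<open>The weak Sobolev inequality is applied one layer further down: the gradient in
      layer \<open>Suc j\<close> controls the volume above the top of that layer, which is
      \<open>e j\<close>. It needs a positive volume above the lower level; if that volume is 0, so
      is \<open>e j\<close>, since the sets are nested.\<close>
    have rec: "b j \<le> b (Suc j) / 2 + C0 * mm (Suc j)" for j
    proof (cases "e (Suc j) = 0")
      case True
      have "emeasure lborel {x. l (Suc j) < f x} \<le> emeasure lborel {x. l (Suc (Suc j)) < f x}"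
        using l(3)[of "Suc j"] by (intro emeasure_mono) auto
      then have "e j = 0" using True e(2)[of j] unfolding e(1) by simp
      then have "b j = 0" by (simp add: b_def)
      then show ?thesis using b0[of "Suc j"] c0 mm(2)[of "Suc j"] by simp
    next
      case False
      then have pos: "e (Suc j) > 0" using e(2)[of "Suc j"] by simp
      have "ennreal (l (Suc (Suc j)) * e j) = ennreal (l (Suc j) - l (Suc (Suc j))) * emeasure lborel {x. l (Suc j) < f x}"
        using l(1)[of "Suc (Suc j)"] e(2)[of j] unfolding e(1) l(4) by (simp add: ennreal_mult)
      also have "\<dots> \<le> ennreal (l (Suc j) - l (Suc (Suc j))) * emeasure lborel {x. l (Suc j) \<le> f x}"
        by (intro mult_left_mono emeasure_mono) auto
      also have "\<dots> \<le> ennreal (2 * (2 * e (Suc j) / ?\<omega>) powr (1 / d)) * ennreal (mm (Suc j))"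
        unfolding mm(1)[symmetric] d_def
        by (rule layer_weak_sobolev) (use deriv cont l(3)[of "Suc j"] e pos in auto)
      also have "(2 * e (Suc j) / ?\<omega>) powr (1 / d) = (2 / ?\<omega>) powr (1/d) * e (Suc j) powr (1/d)"
        using pos by (simp add: powr_mult[symmetric])
      finally have "l (Suc (Suc j)) * e j \<le> c * e (Suc j) powr (1/d) * mm (Suc j)"
        using mm(2)[of "Suc j"] by (simp add: ennreal_mult[symmetric] c_def mult.assoc)
      from isoperimetric_dichotomy[OF _ l(1) e(2) pos c0(1) mm(2) this] d
      show ?thesis by (simp add: b_def C0_def l(5)[of "Suc j"] \<kappa>_def)
    qed
    have "(\<Sum>j<n. mm (Suc j)) \<le> 2 * m" for n
      using mmS[of "Suc n", unfolded sum.lessThan_Suc_shift] mm(2)[of 0] by simp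
    from halving_recursion_sum_le[OF b0 rec c0(2) bB this]
    have b: "summable b" "suminf b \<le> 2 * C0 * (2 * m)" .
    have sm: "summable mm"
      by (rule summableI_nonneg_bounded[OF mm(2), where x="2 * m"]) (rule mmS)
    have smm: "suminf mm \<le> 2 * m" by (rule suminf_le_const[OF sm mmS])
    define T where "T = (\<lambda>j r. trunc (l (Suc j)) (l j) r)"
    have [measurable]: "(\<lambda>x. T j (g x)) \<in> borel_measurable N" if "g \<in> borel_measurable N" for j g and N :: "'b measure"
      unfolding T_def using that by measurable
    define k where "k = (\<lambda>(z::'a) (x::'a). norm z powr (- (d + s)) * w x powr (p - 1))"
    have k0: "k z x \<ge> 0" for z x by (simp add: k_def)
    have [measurable]: "(\<lambda>x. k z x) \<in> borel_measurable borel" for z :: 'a unfolding k_def by measurable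
    have "(\<integral>\<^sup>+z. \<integral>\<^sup>+x. ennreal (norm z powr (- (d + s)) * (w x powr (p - 1) * \<bar>max 0 (f x) - max 0 (f (x - z))\<bar>)) \<partial>lborel \<partial>lborel)
      = (\<integral>\<^sup>+z. \<integral>\<^sup>+x. (\<Sum>j. ennreal (k z x * \<bar>T j (f x) - T j (f (x - z))\<bar>)) \<partial>lborel \<partial>lborel)"
    proof (intro nn_integral_cong)
      fix z x :: 'a
      have "(\<lambda>j. k z x * \<bar>T j (f x) - T j (f (x - z))\<bar>) sums (k z x * \<bar>max 0 (f x) - max 0 (f (x - z))\<bar>)"
        unfolding T_def l_def using dyadic_trunc_sums[OF M] fM by (intro sums_mult) auto
      then show "ennreal (norm z powr (- (d + s)) * (w x powr (p - 1) * \<bar>max 0 (f x) - max 0 (f (x - z))\<bar>))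
        = (\<Sum>j. ennreal (k z x * \<bar>T j (f x) - T j (f (x - z))\<bar>))"
        using k0 by (subst suminf_ennreal_eq) (auto simp: k_def mult.assoc)
    qed
    also have "\<dots> = (\<integral>\<^sup>+z. (\<Sum>j. \<integral>\<^sup>+x. ennreal (k z x * \<bar>T j (f x) - T j (f (x - z))\<bar>) \<partial>lborel) \<partial>lborel)"
      by (intro nn_integral_cong nn_integral_suminf) measurable
    also have "\<dots> \<le> (\<integral>\<^sup>+z. (\<Sum>j. ennreal (norm (z::'a) powr (- (d + s))) * ennreal (A powr (1 - \<theta>) * l (Suc j) powr (1 - \<theta>) *
       min (norm z * mm j) (2 * l (Suc j) * e j) powr \<theta>)) \<partial>lborel)"
    proof (intro nn_integral_mono suminf_le allI)
      fix z :: 'a and j :: nat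
      have "(\<integral>\<^sup>+x. ennreal (k z x * \<bar>T j (f x) - T j (f (x - z))\<bar>) \<partial>lborel)
        = (\<integral>\<^sup>+x. ennreal (norm z powr (- (d + s))) * ennreal (w x powr (p - 1) * \<bar>T j (f x) - T j (f (x - z))\<bar>) \<partial>lborel)"
        by (intro nn_integral_cong) (simp add: k_def ennreal_mult[symmetric] mult.assoc)
      also have "\<dots> = ennreal (norm z powr (- (d + s))) * (\<integral>\<^sup>+x. ennreal (w x powr (p - 1) * \<bar>T j (f x) - T j (f (x - z))\<bar>) \<partial>lborel)"
        by (rule nn_integral_cmult) measurable
      also have "\<dots> \<le> ennreal (norm z powr (- (d + s))) * ennreal (A powr (1 - \<theta>) * l (Suc j) powr (1 - \<theta>) *
       min (norm z * mm j) (2 * l (Suc j) * e j) powr \<theta>)"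
      proof (rule mult_left_mono)
        have "(\<integral>\<^sup>+x. ennreal (w x powr (p - 1) * \<bar>T j (f x) - T j (f (x - z))\<bar>) \<partial>lborel)
          \<le> ennreal (A powr (1 - 1/p) * (l j - l (Suc j)) powr (1 - 1/p) * min (norm z * mm j) (2 * (l j - l (Suc j)) * e j) powr (1/p))"
          unfolding T_def
          by (rule layer_pairing_le[where Df=Df]) (use deriv cont l(3)[of j] p1 w A mm e in auto)
        then show "(\<integral>\<^sup>+x. ennreal (w x powr (p - 1) * \<bar>T j (f x) - T j (f (x - z))\<bar>) \<partial>lborel) \<le> ennreal (A powr (1 - \<theta>) * l (Suc j) powr (1 - \<theta>) *
       min (norm z * mm j) (2 * l (Suc j) * e j) powr \<theta>)"
          by (simp only: l(4) \<theta>_def)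
      qed simp
      finally show "(\<integral>\<^sup>+x. ennreal (k z x * \<bar>T j (f x) - T j (f (x - z))\<bar>) \<partial>lborel)
        \<le> ennreal (norm z powr (- (d + s))) * ennreal (A powr (1 - \<theta>) * l (Suc j) powr (1 - \<theta>) *
       min (norm z * mm j) (2 * l (Suc j) * e j) powr \<theta>)" .
    qed auto
    also have "\<dots> = (\<Sum>j. \<integral>\<^sup>+z. ennreal (norm (z::'a) powr (- (d + s))) * ennreal (A powr (1 - \<theta>) * l (Suc j) powr (1 - \<theta>) *
       min (norm z * mm j) (2 * l (Suc j) * e j) powr \<theta>) \<partial>lborel)"
      by (rule nn_integral_suminf) measurable
    also have "\<dots> \<le> (\<Sum>j. ennreal (A powr (1 - \<theta>) * J * 2 * (mm j + b j)))"
    proof (intro suminf_le allI)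
      fix j
      let ?K = "A powr (1 - \<theta>) * l (Suc j) powr (1 - \<theta>)"
      have "(\<integral>\<^sup>+z. ennreal (norm (z::'a) powr (- (d + s))) * ennreal (?K * min (norm z * mm j) (2 * l (Suc j) * e j) powr \<theta>) \<partial>lborel)
        = (\<integral>\<^sup>+z. ennreal ?K * ennreal (norm (z::'a) powr (- (d + s)) * min (norm z * mm j) (2 * l (Suc j) * e j) powr \<theta>) \<partial>lborel)"
        by (intro nn_integral_cong) (simp add: ennreal_mult[symmetric] ac_simps)
      also have "\<dots> = ennreal ?K * (\<integral>\<^sup>+z. ennreal (norm (z::'a) powr (- (d + s)) * min (norm z * mm j) (2 * l (Suc j) * e j) powr \<theta>) \<partial>lborel)"
        by (rule nn_integral_cmult) measurable
      also have "\<dots> \<le> ennreal ?K * ennreal (J * mm j powr s * (2 * l (Suc j) * e j) powr (\<theta> - s))"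
        using mm(2) e(2)[of j] l(1)[of "Suc j"] by (intro mult_left_mono J(2)) auto
      also have "\<dots> = ennreal (?K * (J * mm j powr s * (2 * l (Suc j) * e j) powr (\<theta> - s)))"
        using J by (intro ennreal_mult[symmetric]) auto
      \<comment> \<open>The sup bound contributes the power \<open>1 - \<theta>\<close> of the level
        and the volume bound the power \<open>\<theta> - s\<close>. Together they give
        \<open>b j powr (1 - s)\<close>, and the product with \<open>mm j powr s\<close> is at most
        \<open>mm j + b j\<close>, which is summable.\<close>
      also have "?K * (J * mm j powr s * (2 * l (Suc j) * e j) powr (\<theta> - s)) \<le> A powr (1 - \<theta>) * J * 2 * (mm j + b j)"
      proof -
        have "?K * (J * mm j powr s * (2 * l (Suc j) * e j) powr (\<theta> - s))
          = A powr (1 - \<theta>) * J * 2 powr (\<theta> - s) * (mm j powr s * ((l (Suc j) powr (1 - \<theta>) * l (Suc j) powr (\<theta> - s)) * e j powr (\<theta> - s)))"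
          using l(1)[of "Suc j"] e(2)[of j] by (simp add: powr_mult ac_simps)
        also have "l (Suc j) powr (1 - \<theta>) * l (Suc j) powr (\<theta> - s) = l (Suc j) powr (1 - s)"
          by (simp add: powr_add[symmetric])
        also have "l (Suc j) powr (1 - s) * e j powr (\<theta> - s) = b j powr (1 - s)"
          using l(1)[of "Suc j"] e(2)[of j] by (simp add: b_def \<theta>s powr_mult powr_powr)
        also have "A powr (1 - \<theta>) * J * 2 powr (\<theta> - s) * (mm j powr s * b j powr (1 - s))
          \<le> A powr (1 - \<theta>) * J * 2 * (mm j + b j)"
        proof (intro mult_mono)
          show "2 powr (\<theta> - s) \<le> (2::real)" using powr_mono[of "\<theta> - s" 1 "2::real"] \<theta> s by simp
        qed (use J powr_interp_le_add[OF mm(2) b0 s] mm(2)[of j] b0[of j] in auto)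
        finally show ?thesis .
      qed
      finally show "(\<integral>\<^sup>+z. ennreal (norm (z::'a) powr (- (d + s))) * ennreal (?K * min (norm z * mm j) (2 * l (Suc j) * e j) powr \<theta>) \<partial>lborel)
        \<le> ennreal (A powr (1 - \<theta>) * J * 2 * (mm j + b j))"
        by (simp add: ennreal_leI)
    qed auto
    also have "\<dots> = ennreal (A powr (1 - \<theta>) * J * 2 * (suminf mm + suminf b))"
      using J mm(2) b0 by (intro suminf_ennreal_eq sums_mult sums_add summable_sums sm b) auto
    also have "\<dots> \<le> ennreal ((J * (4 + 8 * C0) + 1) * A powr (1 - 1/p) * m)"
    proof (rule ennreal_leI)
      have "A powr (1 - \<theta>) * J * 2 * (suminf mm + suminf b) \<le> A powr (1 - \<theta>) * J * 2 * (2 * m + 2 * C0 * (2 * m))"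
        using J smm b by (intro mult_left_mono add_mono) auto
      also have "\<dots> = (J * (4 + 8 * C0)) * A powr (1 - \<theta>) * m" by (simp add: algebra_simps)
      also have "\<dots> \<le> (J * (4 + 8 * C0) + 1) * A powr (1 - \<theta>) * m"
        using m by (intro mult_right_mono) auto
      finally show "A powr (1 - \<theta>) * J * 2 * (suminf mm + suminf b) \<le> (J * (4 + 8 * C0) + 1) * A powr (1 - 1/p) * m"
        by (simp only: \<theta>_def)
    qed
    finally show "(\<integral>\<^sup>+z. \<integral>\<^sup>+x. ennreal (norm z powr (- (d + s)) * (w x powr (p - 1) * \<bar>max 0 (f x) - max 0 (f (x - z))\<bar>)) \<partial>lborel \<partial>lborel)
      \<le> ennreal ((J * (4 + 8 * C0) + 1) * A powr (1 - 1/p) * m)" .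
  qed
qed

section \<open>Riesz potentials of compactly supported functions\<close>

lemma uniformly_continuous_compact_support:
  fixes g :: "'a::euclidean_space \<Rightarrow> 'b::real_normed_vector"
  assumes g: "continuous_on UNIV g" and supp: "\<And>x. R \<le> norm x \<Longrightarrow> g x = 0" and "0 < \<epsilon>"
  obtains \<delta> where "0 < \<delta>" "\<And>x y. norm (x - y) < \<delta> \<Longrightarrow> norm (g x - g y) < \<epsilon>"
proof -
  have "uniformly_continuous_on (cball 0 (R + 1)) g"
    using g by (intro compact_uniformly_continuous) (auto intro: continuous_on_subset)
  then obtain \<delta> where \<delta>: "0 < \<delta>"
    "\<And>x y. x \<in> cball 0 (R + 1) \<Longrightarrow> y \<in> cball 0 (R + 1) \<Longrightarrow> dist y x < \<delta> \<Longrightarrow> dist (g y) (g x) < \<epsilon>"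
    unfolding uniformly_continuous_on_def using \<open>0 < \<epsilon>\<close> by metis
  show thesis
  proof (rule that[of "min \<delta> 1"])
    fix x y :: 'a assume xy: "norm (x - y) < min \<delta> 1"
    show "norm (g x - g y) < \<epsilon>"
    proof (cases "R \<le> norm x \<and> R \<le> norm y")
      case True
      then show ?thesis using supp \<open>0 < \<epsilon>\<close> by simp
    next
      case False
      then have "norm x \<le> R + 1 \<and> norm y \<le> R + 1"
        using xy norm_triangle_ineq2[of x y] norm_triangle_ineq2[of y x] by (auto simp: norm_minus_commute)
      then show ?thesis using \<delta>(2)[of y x] xy by (simp add: dist_norm norm_minus_commute)
    qed
  qed (use \<delta> in auto)
qed

text \<open>The Riesz potential of order \<open>N - a\<close> without its normalising constant. The
  translation sits in \<open>g\<close>, so that increments and derivatives fall on the regular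
  factor, and the values may be vectors, so that the same operator applies to a gradient.\<close>

definition riesz_conv :: "real \<Rightarrow> ('a::euclidean_space \<Rightarrow> 'b::{banach, second_countable_topology}) \<Rightarrow> 'a \<Rightarrow> 'b" where
  "riesz_conv a g x = (\<integral>z. norm z powr (-a) *\<^sub>R g (x - z) \<partial>lborel)"

lemma integrable_powr_ball:
  fixes a R :: real
  assumes "0 < a" "a < DIM('a::euclidean_space)"
  shows "integrable lborel (\<lambda>z::'a. norm z powr (-a) * indicator (ball 0 R) z)"
proof (cases "0 < R")
  case True
  have [measurable]: "ball (0::'a) R \<in> sets borel" by simp
  have "(\<integral>\<^sup>+z. ennreal (norm (norm z powr (-a) * indicator (ball (0::'a) R) z)) \<partial>lborel)
    = (\<integral>\<^sup>+z. ennreal (norm (z::'a) powr (-a)) * indicator (ball 0 R) z \<partial>lborel)"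
    by (intro nn_integral_cong) (auto split: split_indicator)
  also have "\<dots> < \<infinity>" by (rule nn_integral_powr_inside[OF assms True])
  finally show ?thesis by (subst integrable_iff_bounded) auto
next
  case False
  then have "indicator (ball 0 R) z = (0::real)" for z :: 'a by (simp add: ball_empty)
  then show ?thesis by (simp only: mult_zero_right integrable_zero)
qed

text \<open>For \<open>x\<close> in the ball of radius \<open>r\<close> only \<open>z\<close> in the
  ball of radius \<open>R + r\<close> contribute, and there the kernel is integrable. The bound is
  linear in the supremum \<open>c\<close>, so it can be applied to increments and to Taylor
  remainders of a function, where \<open>c\<close> is small.\<close>

lemma riesz_conv_bound:
  fixes a :: real and g :: "'a::euclidean_space \<Rightarrow> 'b::{banach, second_countable_topology}"
  assumes a: "0 < a" "a < DIM('a)" and [measurable]: "g \<in> borel_measurable borel"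
    and supp: "\<And>y. R \<le> norm y \<Longrightarrow> g y = 0" and c: "\<And>y. norm (g y) \<le> c"
  shows "integrable lborel (\<lambda>z. norm z powr (-a) *\<^sub>R g (x - z))"
    and "norm x \<le> r \<Longrightarrow> norm (riesz_conv a g x) \<le> c * (\<integral>z. norm (z::'a) powr (-a) * indicator (ball 0 (R + r)) z \<partial>lborel)"
proof -
  have le: "norm (norm z powr (-a) *\<^sub>R g (x - z)) \<le> c * (norm z powr (-a) * indicator (ball 0 (R + r)) z)"
    if "norm x \<le> r" for z r
  proof (cases "R \<le> norm (x - z)")
    case True
    then show ?thesis using supp order_trans[OF norm_ge_zero c[of 0]] by simp
  next
    case False
    then have "norm z < R + r" using norm_triangle_ineq4[of x "x - z"] that by simp
    then show ?thesis using c[of "x - z"] by (simp add: mult.commute mult_right_mono)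
  qed
  have i: "integrable lborel (\<lambda>z::'a. c * (norm z powr (-a) * indicator (ball 0 (R + r)) z))" for r
    using integrable_powr_ball[OF a] by simp
  show int: "integrable lborel (\<lambda>z. norm z powr (-a) *\<^sub>R g (x - z))"
    by (rule Bochner_Integration.integrable_bound[OF i[of "norm x"]])
       (use le[of "norm x"] in \<open>auto intro!: AE_I2 order_trans[OF _ abs_ge_self]\<close>)
  show "norm (riesz_conv a g x) \<le> c * (\<integral>z. norm (z::'a) powr (-a) * indicator (ball 0 (R + r)) z \<partial>lborel)" if "norm x \<le> r"
  proof -
    have "norm (riesz_conv a g x) \<le> (\<integral>z. norm (norm z powr (-a) *\<^sub>R g (x - z)) \<partial>lborel)"
      unfolding riesz_conv_def by (rule integral_norm_bound)
    also have "\<dots> \<le> (\<integral>z. c * (norm (z::'a) powr (-a) * indicator (ball 0 (R + r)) z) \<partial>lborel)"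
      using le[OF that] by (intro integral_mono integrable_norm int i) auto
    finally show ?thesis by simp
  qed
qed

lemma bounded_compact_support:
  fixes g :: "'a::euclidean_space \<Rightarrow> 'b::real_normed_vector"
  assumes g: "continuous_on UNIV g" and supp: "\<And>x. R \<le> norm x \<Longrightarrow> g x = 0"
  obtains c where "0 < c" "\<And>x. norm (g x) \<le> c"
proof -
  have "compact (g ` cball 0 R)"
    using g by (intro compact_continuous_image) (auto intro: continuous_on_subset)
  then obtain c where c: "0 < c" "\<And>x. norm x \<le> R \<Longrightarrow> norm (g x) \<le> c"
    using compact_imp_bounded bounded_pos by (metis (no_types, lifting) image_eqI mem_cball_0)
  show thesis
  proof (rule that[of c])
    show "norm (g x) \<le> c" for x
      using c supp[of x] by (cases "R \<le> norm x") auto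
  qed (rule c)
qed

text \<open>The increment of the convolution is the convolution of the increment of
  \<open>g\<close>, which is uniformly small because \<open>g\<close> is uniformly
  continuous.\<close>

lemma continuous_riesz_conv:
  fixes a :: real and g :: "'a::euclidean_space \<Rightarrow> 'b::{banach, second_countable_topology}"
  assumes a: "0 < a" "a < DIM('a)" and g: "continuous_on UNIV g"
    and supp: "\<And>y. R \<le> norm y \<Longrightarrow> g y = 0"
  shows "continuous_on UNIV (riesz_conv a g)"
proof (rule continuous_at_imp_continuous_on, intro ballI)
  fix x :: 'a
  have gm[measurable]: "g \<in> borel_measurable borel" using g by (rule borel_measurable_continuous_onI)
  obtain c where c: "\<And>x. norm (g x) \<le> c" using bounded_compact_support[OF g supp] by blast
  \<comment> \<open>A shift shorter than 1 enlarges the support by at most 1, hence the radius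
    \<open>R + 1\<close> for the increment \<open>h\<close>.\<close>
  define K where "K = (\<integral>z. norm (z::'a) powr (-a) * indicator (ball 0 (R + 1 + norm x)) z \<partial>lborel)"
  have K: "K \<ge> 0" unfolding K_def by (intro integral_nonneg_AE AE_I2) auto
  show "isCont (riesz_conv a g) x"
    unfolding continuous_at_eps_delta
  proof (intro allI impI)
    fix \<epsilon> :: real assume "0 < \<epsilon>"
    then have "0 < \<epsilon> / (K + 1)" using K by simp
    from uniformly_continuous_compact_support[OF g supp this] obtain \<delta> where
      \<delta>: "0 < \<delta>" "\<And>x y. norm (x - y) < \<delta> \<Longrightarrow> norm (g x - g y) < \<epsilon> / (K + 1)" by blast
    show "\<exists>\<delta>>0. \<forall>x'. dist x' x < \<delta> \<longrightarrow> dist (riesz_conv a g x') (riesz_conv a g x) < \<epsilon>"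
    proof (intro exI[of _ "min \<delta> 1"] conjI allI impI)
      fix x' assume x': "dist x' x < min \<delta> 1"
      define h where "h = (\<lambda>y. g (y + (x' - x)) - g y)"
      have hm: "h \<in> borel_measurable borel" unfolding h_def by measurable
      have hs: "h y = 0" if "R + 1 \<le> norm y" for y
      proof -
        have "R \<le> norm (y + (x' - x))"
          using that x' norm_diff_ineq[of y "x' - x"] by (simp add: dist_norm)
        then show ?thesis using supp that by (simp add: h_def)
      qed
      have hb: "norm (h y) \<le> \<epsilon> / (K + 1)" for y
        using \<delta>(2)[of "y + (x' - x)" y] x' by (simp add: h_def dist_norm less_imp_le)
      have "riesz_conv a g x' - riesz_conv a g x = riesz_conv a h x"
        unfolding riesz_conv_def h_def
        using riesz_conv_bound(1)[OF a gm supp c]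
        by (subst Bochner_Integration.integral_diff[symmetric]) (auto simp: algebra_simps)
      also have "norm \<dots> \<le> \<epsilon> / (K + 1) * K"
        unfolding K_def[symmetric]
        using riesz_conv_bound(2)[OF a hm hs hb, where x=x and r="norm x"] by (simp add: K_def)
      also have "\<dots> < \<epsilon>" using \<open>0 < \<epsilon>\<close> K by (simp add: field_simps)
      finally show "dist (riesz_conv a g x') (riesz_conv a g x) < \<epsilon>" by (simp add: dist_norm)
    qed (use \<delta> in auto)
  qed
qed

text \<open>The singular kernel is never differentiated. The first-order remainder of the
  convolution is the convolution of the first-order remainder \<open>h\<close> of \<open>u\<close>,
  which is at most \<open>norm k * \<eta>\<close> everywhere by uniform continuity of
  \<open>Du\<close>.\<close>

lemma has_derivative_riesz_conv:
  fixes a :: real and u :: "'a::euclidean_space \<Rightarrow> real" and Du :: "'a \<Rightarrow> 'a"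
  assumes a: "0 < a" "a < DIM('a)"
    and deriv: "\<And>x. (u has_derivative (\<lambda>h. Du x \<bullet> h)) (at x)" and cont: "continuous_on UNIV Du"
    and supp: "\<And>y. R \<le> norm y \<Longrightarrow> u y = 0" "\<And>y. R \<le> norm y \<Longrightarrow> Du y = 0"
  shows "(riesz_conv a u has_derivative (\<lambda>h. riesz_conv a Du x \<bullet> h)) (at x)"
proof -
  have uc: "continuous_on UNIV u" using deriv by (meson continuous_at_imp_continuous_on has_derivative_continuous)
  have um[measurable]: "u \<in> borel_measurable borel" and Dm[measurable]: "Du \<in> borel_measurable borel"
    using uc cont by (auto intro: borel_measurable_continuous_onI)
  obtain c where c: "\<And>x. norm (u x) \<le> c" using bounded_compact_support[OF uc supp(1)] by blast
  obtain c' where c': "\<And>x. norm (Du x) \<le> c'" using bounded_compact_support[OF cont supp(2)] by blast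
  note iu = riesz_conv_bound(1)[OF a um supp(1) c] and iD = riesz_conv_bound(1)[OF a Dm supp(2) c']
  define K where "K = (\<integral>z. norm (z::'a) powr (-a) * indicator (ball 0 (R + 1 + norm x)) z \<partial>lborel)"
  have K: "K \<ge> 0" unfolding K_def by (intro integral_nonneg_AE AE_I2) auto
  show ?thesis
    unfolding has_derivative_at_alt
  proof (intro conjI allI impI bounded_linear_inner_right)
    fix \<epsilon> :: real assume "0 < \<epsilon>"
    define \<eta> where "\<eta> = \<epsilon> / (K + 1)"
    have \<eta>: "\<eta> > 0" using \<open>0 < \<epsilon>\<close> K by (simp add: \<eta>_def)
    from uniformly_continuous_compact_support[OF cont supp(2) \<eta>] obtain \<delta> where
      \<delta>: "0 < \<delta>" "\<And>x y. norm (x - y) < \<delta> \<Longrightarrow> norm (Du x - Du y) < \<eta>" by blast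
    show "\<exists>\<delta>>0. \<forall>x'. norm (x' - x) < \<delta> \<longrightarrow>
      norm (riesz_conv a u x' - riesz_conv a u x - riesz_conv a Du x \<bullet> (x' - x)) \<le> \<epsilon> * norm (x' - x)"
    proof (intro exI[of _ "min \<delta> 1"] conjI allI impI)
      fix x' assume x': "norm (x' - x) < min \<delta> 1"
      define k where "k = x' - x"
      define h where "h = (\<lambda>y. u (y + k) - u y - Du y \<bullet> k)"
      have hm: "h \<in> borel_measurable borel" unfolding h_def by measurable
      have hs: "h y = 0" if "R + 1 \<le> norm y" for y
      proof -
        have "R \<le> norm (y + k)"
          using that x' norm_diff_ineq[of y k] by (simp add: k_def)
        then show ?thesis using supp that by (simp add: h_def)
      qed
      have hb: "norm (h y) \<le> norm k * \<eta>" for y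
      proof -
        have "norm (u (y + k) - u y - Du y \<bullet> ((y + k) - y)) \<le> norm ((y + k) - y) * \<eta>"
        proof (rule differentiable_bound_linearization[where S="cball y (norm k)" and f'="\<lambda>x h. Du x \<bullet> h"])
          show "y + t *\<^sub>R (y + k - y) \<in> cball y (norm k)" if "t \<in> {0..1}" for t
            using that by (simp add: dist_norm mult_left_le_one_le)
          show "(u has_derivative (\<bullet>) (Du z)) (at z within cball y (norm k))" for z
            using deriv by (rule has_derivative_at_withinI)
          fix z assume z: "z \<in> cball y (norm k)"
          then have "norm (Du z - Du y) \<le> \<eta>"
            using x' by (intro less_imp_le \<delta>(2)) (simp add: dist_norm k_def norm_minus_commute)
          moreover have "norm (Du z \<bullet> h - Du y \<bullet> h) \<le> norm (Du z - Du y) * norm h" for h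
            using Cauchy_Schwarz_ineq2[of "Du z - Du y" h] by (simp add: inner_diff_left)
          ultimately show "onorm ((\<bullet>) (Du z) - (\<bullet>) (Du y)) \<le> \<eta>"
            using \<eta> by (intro onorm_le) (simp, meson mult_right_mono norm_ge_zero order_trans)
        qed simp
        then show ?thesis by (simp add: h_def)
      qed
      have i1: "integrable lborel (\<lambda>z. norm z powr (-a) *\<^sub>R u (y - z))" for y by (rule iu)
      have i2: "integrable lborel (\<lambda>z. (norm z powr (-a) *\<^sub>R Du (x - z)) \<bullet> k)"
        by (intro integrable_inner_left iD)
      have "riesz_conv a u x' - riesz_conv a u x - riesz_conv a Du x \<bullet> (x' - x)
        = (\<integral>z. norm z powr (-a) *\<^sub>R u (x' - z) \<partial>lborel) - (\<integral>z. norm z powr (-a) *\<^sub>R u (x - z) \<partial>lborel)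
          - (\<integral>z. (norm z powr (-a) *\<^sub>R Du (x - z)) \<bullet> k \<partial>lborel)"
        using integral_inner_left[of k lborel "\<lambda>z. norm z powr (-a) *\<^sub>R Du (x - z)"] iD by (simp add: riesz_conv_def k_def)
      also have "\<dots> = (\<integral>z. norm z powr (-a) *\<^sub>R u (x' - z) - norm z powr (-a) *\<^sub>R u (x - z) - (norm z powr (-a) *\<^sub>R Du (x - z)) \<bullet> k \<partial>lborel)"
        using i1 i2 by (simp add: Bochner_Integration.integral_diff Bochner_Integration.integrable_diff)
      also have "\<dots> = riesz_conv a h x"
        unfolding riesz_conv_def h_def k_def by (rule Bochner_Integration.integral_cong) (auto simp: algebra_simps)
      also have "norm \<dots> \<le> norm k * \<eta> * K"
        using riesz_conv_bound(2)[OF a hm hs hb, where x=x and r="norm x"] by (simp add: K_def)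
      also have "\<dots> \<le> \<epsilon> * norm k"
      proof -
        have "\<eta> * K \<le> \<epsilon>" using K \<open>0 < \<epsilon>\<close> by (simp add: \<eta>_def field_simps)
        then show ?thesis using mult_left_mono[of "\<eta> * K" \<epsilon> "norm k"] by (simp add: ac_simps)
      qed
      finally show "norm (riesz_conv a u x' - riesz_conv a u x - riesz_conv a Du x \<bullet> (x' - x)) \<le> \<epsilon> * norm (x' - x)"
        by (simp add: k_def)
    qed (use \<delta> in auto)
  qed
qed

text \<open>If \<open>x\<close> is at least twice as far out as the support of \<open>u\<close>,
  every contributing \<open>z\<close> has norm at least \<open>norm x / 2\<close>, so the kernel can
  be replaced by its value there.\<close>

lemma riesz_conv_decay:
  fixes u :: "'a::euclidean_space \<Rightarrow> real"
  assumes a: "0 < a" and u: "continuous_on UNIV u" and R: "0 < R" "\<And>y. R \<le> norm y \<Longrightarrow> u y = 0"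
    and x: "2 * R \<le> norm x"
  shows "\<bar>riesz_conv a u x\<bar> \<le> (2 powr a * (\<integral>y. \<bar>u y\<bar> \<partial>lborel)) * norm x powr (-a)"
proof -
  have [measurable]: "u \<in> borel_measurable borel" using u by (rule borel_measurable_continuous_onI)
  have "integrable lborel (\<lambda>y. indicator (cball 0 R) y *\<^sub>R u y)"
    using u by (intro borel_integrable_compact) (auto intro: continuous_on_subset)
  moreover have "(\<lambda>y. indicator (cball 0 R) y *\<^sub>R u y) = u"
    using R(2) by (intro ext) (auto split: split_indicator)
  ultimately have iu: "integrable lborel u" by (simp only:)
  then have iu': "integrable lborel (\<lambda>z. \<bar>u (x - z)\<bar>)"
    using integrable_lborel_reflect[of u x] by simp
  have "\<bar>riesz_conv a u x\<bar> \<le> (\<integral>z. (norm x / 2) powr (-a) * \<bar>u (x - z)\<bar> \<partial>lborel)"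
    unfolding riesz_conv_def real_norm_def[symmetric]
  proof (rule order_trans[OF integral_norm_bound], rule integral_mono')
    show "integrable lborel (\<lambda>z. (norm x / 2) powr (-a) * norm (u (x - z)))" using iu' by simp
    fix z
    show "norm (norm z powr (-a) *\<^sub>R u (x - z)) \<le> (norm x / 2) powr (-a) * norm (u (x - z))"
    proof (cases "R \<le> norm (x - z)")
      case False
      then have "norm x / 2 \<le> norm z" using norm_triangle_ineq2[of x z] x by simp
      then have "norm z powr (-a) \<le> (norm x / 2) powr (-a)"
        using a x R by (intro powr_mono2') auto
      then show ?thesis by (simp add: abs_mult mult_right_mono)
    qed (use R in simp)
  qed simp
  also have "\<dots> = (norm x / 2) powr (-a) * (\<integral>y. \<bar>u y\<bar> \<partial>lborel)"
    using integral_lborel_reflect[of "\<lambda>y. \<bar>u y\<bar>" x] by simp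
  also have "(norm x / 2) powr (-a) = 2 powr a * norm x powr (-a)"
    by (simp add: powr_divide powr_minus field_simps)
  finally show ?thesis by (simp add: ac_simps)
qed

section \<open>Inversion of the Riesz potential\<close>

lemma Fubini_abs:
  fixes F :: "'a::euclidean_space \<Rightarrow> 'b::euclidean_space \<Rightarrow> real"
  assumes F: "case_prod F \<in> borel_measurable (lborel \<Otimes>\<^sub>M lborel)"
    and fin: "(\<integral>\<^sup>+x. \<integral>\<^sup>+y. ennreal \<bar>F x y\<bar> \<partial>lborel \<partial>lborel) < \<infinity>"
  shows "(\<integral>x. \<integral>y. F x y \<partial>lborel \<partial>lborel) = (\<integral>y. \<integral>x. F x y \<partial>lborel \<partial>lborel)"
    and "integrable lborel (\<lambda>x. \<integral>y. F x y \<partial>lborel)"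
    and "AE x in lborel. integrable lborel (F x)"
proof -
  have "(\<integral>\<^sup>+x. \<integral>\<^sup>+y. ennreal \<bar>F x y\<bar> \<partial>lborel \<partial>lborel) = (\<integral>\<^sup>+p. ennreal (norm (case_prod F p)) \<partial>(lborel \<Otimes>\<^sub>M lborel))"
    using F by (subst lborel.nn_integral_fst[symmetric]) auto
  then have int: "integrable (lborel \<Otimes>\<^sub>M lborel) (case_prod F)"
    using F fin by (simp add: integrable_iff_bounded)
  show "(\<integral>x. \<integral>y. F x y \<partial>lborel \<partial>lborel) = (\<integral>y. \<integral>x. F x y \<partial>lborel \<partial>lborel)"
    by (rule lborel_pair.Fubini_integral[OF int, symmetric])
  show "integrable lborel (\<lambda>x. \<integral>y. F x y \<partial>lborel)"
    using lborel_pair.integrable_fst'[OF int] by simp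
  show "AE x in lborel. integrable lborel (F x)"
    using lborel_pair.AE_integrable_fst'[OF int] by simp
qed

lemma mult_norm_powr:
  fixes w :: "'a::real_normed_vector"
  shows "norm w * norm w powr (- b) = norm w powr (- (b - 1))"
  by (cases "w = 0") (simp_all add: powr_diff powr_minus field_simps)

text \<open>Both exponents are below the dimension \<open>d\<close>, so each singularity is
  integrable, and their sum \<open>2 * d - 1\<close> exceeds \<open>d\<close>, so the integral
  converges at infinity. Scaling reduces to unit vectors, for which a bound uniform in the direction
  is enough.\<close>

lemma riesz_kernel_convolution_le:
  fixes s :: real
  assumes s: "0 < s" "s < 1" and dim: "DIM('a::euclidean_space) \<ge> 2"
  defines "d \<equiv> real DIM('a)"
  shows "\<exists>C\<ge>0. \<forall>y::'a. y \<noteq> 0 \<longrightarrow>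
    (\<integral>\<^sup>+w. ennreal (norm w powr (- (d + s - 1)) * norm (y - w) powr (- (d - s))) \<partial>lborel) \<le> ennreal (C * norm y powr (- (d - 1)))"
proof -
  let ?p = "d + s - 1" and ?q = "d - s"
  have d: "d \<ge> 2" using dim by (simp add: d_def)
  \<comment> \<open>\<open>G1\<close> is centred at the singularity 0 and \<open>G2\<close>, after
    reflection, at the other one. Within distance 1/2 of one singularity the other factor is at most
    a power of 2; elsewhere the product is at most the power \<open>- (2 * d - 1)\<close> of the
    smaller distance.\<close>
  define G1 G2 :: "'a \<Rightarrow> ennreal" where
    "G1 = (\<lambda>w. ennreal (2 powr ?q) * (ennreal (norm w powr (- ?p)) * indicator (ball 0 (1/2)) w)
       + ennreal (norm w powr (- (2 * d - 1))) * indicator (- ball 0 (1/2)) w)" and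
    "G2 = (\<lambda>w. ennreal (2 powr ?p) * (ennreal (norm w powr (- ?q)) * indicator (ball 0 (1/2)) w)
       + ennreal (norm w powr (- (2 * d - 1))) * indicator (- ball 0 (1/2)) w)"
  have [measurable]: "ball (0::'a) (1/2) \<in> sets borel" by simp
  have [measurable]: "G1 \<in> borel_measurable borel" "G2 \<in> borel_measurable borel"
    unfolding G1_def G2_def by measurable
  have m1: "(\<lambda>w::'a. ennreal (norm w powr (- b)) * indicator (ball 0 (1/2)) w) \<in> borel_measurable lborel"
    and m2: "(\<lambda>w::'a. ennreal (norm w powr (- b)) * indicator (- ball 0 (1/2)) w) \<in> borel_measurable lborel" for b
    by measurable
  have "(\<integral>\<^sup>+w. G1 w \<partial>lborel) < \<infinity>"
    unfolding G1_def
    using nn_integral_powr_inside[where 'a='a, of ?p "1/2"] nn_integral_powr_outside[where 'a='a, of "2 * d - 1" "1/2"] d s m1 m2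
    by (subst nn_integral_add) (auto simp: nn_integral_cmult d_def ennreal_mult_less_top)
  moreover have "(\<integral>\<^sup>+w. G2 w \<partial>lborel) < \<infinity>"
    unfolding G2_def
    using nn_integral_powr_inside[where 'a='a, of ?q "1/2"] nn_integral_powr_outside[where 'a='a, of "2 * d - 1" "1/2"] d s m1 m2
    by (subst nn_integral_add) (auto simp: nn_integral_cmult d_def ennreal_mult_less_top)
  ultimately have fin: "(\<integral>\<^sup>+w. G1 w \<partial>lborel) + (\<integral>\<^sup>+w. G2 w \<partial>lborel) < \<infinity>" by simp
  define C where "C = enn2real ((\<integral>\<^sup>+w. G1 w \<partial>lborel) + (\<integral>\<^sup>+w. G2 w \<partial>lborel))"
  have C: "(\<integral>\<^sup>+w. G1 w \<partial>lborel) + (\<integral>\<^sup>+w. G2 w \<partial>lborel) = ennreal C" "C \<ge> 0"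
    using fin by (auto simp: C_def)
  have half: "r powr (- b) \<le> 2 powr b" if "1/2 \<le> r" "0 \<le> b" for r b :: real
  proof -
    have "r powr (- b) \<le> (1/2) powr (- b)" using that by (intro powr_mono2') auto
    also have "\<dots> = 2 powr b" by (simp add: powr_divide powr_minus_divide)
    finally show ?thesis .
  qed
  have unit: "(\<integral>\<^sup>+w. ennreal (norm w powr (- ?p) * norm (e - w) powr (- ?q)) \<partial>lborel) \<le> ennreal C"
    if e: "norm e = 1" for e :: 'a
  proof -
    have pw: "ennreal (norm w powr (- ?p) * norm (e - w) powr (- ?q)) \<le> G1 w + G2 (e - w)" for w
    proof -
      consider "norm w < 1/2" | "1/2 \<le> norm w" "norm (e - w) < 1/2" | "1/2 \<le> norm w" "1/2 \<le> norm (e - w)"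
        by linarith
      then show ?thesis
      proof cases
        case 1
        then have "1/2 \<le> norm (e - w)" using norm_triangle_ineq2[of e w] e by simp
        then have "norm w powr (- ?p) * norm (e - w) powr (- ?q) \<le> 2 powr ?q * norm w powr (- ?p)"
          using mult_right_mono[OF half[of "norm (e - w)" ?q], of "norm w powr (- ?p)"] d s
          by (simp add: mult.commute)
        then have "ennreal (norm w powr (- ?p) * norm (e - w) powr (- ?q)) \<le> ennreal (2 powr ?q) * ennreal (norm w powr (- ?p))"
          by (simp add: ennreal_mult[symmetric] del: minus_diff_eq)
        also have "\<dots> = G1 w" using 1 by (simp add: G1_def)
        finally show ?thesis by (simp add: add_increasing2)
      next
        case 2
        then have "norm w powr (- ?p) * norm (e - w) powr (- ?q) \<le> 2 powr ?p * norm (e - w) powr (- ?q)"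
          using half[of "norm w" ?p] d s by (simp add: mult_right_mono)
        then have "ennreal (norm w powr (- ?p) * norm (e - w) powr (- ?q)) \<le> ennreal (2 powr ?p) * ennreal (norm (e - w) powr (- ?q))"
          by (simp add: ennreal_mult[symmetric] del: minus_diff_eq)
        also have "\<dots> = G2 (e - w)" using 2 by (simp add: G2_def)
        finally show ?thesis by (simp add: add_increasing)
      next
        case 3
        have pq: "r powr (- ?p) * r powr (- ?q) = r powr (- (2 * d - 1))" for r
          unfolding powr_add[symmetric] by (rule arg_cong[where f="(powr) r"]) simp
        have "norm w powr (- ?p) * norm (e - w) powr (- ?q) \<le> norm w powr (- (2 * d - 1)) + norm (e - w) powr (- (2 * d - 1))"
        proof (cases "norm w \<le> norm (e - w)")
          case True
          then have "norm w powr (- ?p) * norm (e - w) powr (- ?q) \<le> norm w powr (- ?p) * norm w powr (- ?q)"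
            using 3 d s by (intro mult_left_mono powr_mono2') auto
          then show ?thesis unfolding pq by (simp add: add_increasing2)
        next
          case False
          then have "norm w powr (- ?p) * norm (e - w) powr (- ?q) \<le> norm (e - w) powr (- ?p) * norm (e - w) powr (- ?q)"
            using 3 d s by (intro mult_right_mono powr_mono2') auto
          then show ?thesis unfolding pq by (simp add: add_increasing)
        qed
        then have "ennreal (norm w powr (- ?p) * norm (e - w) powr (- ?q)) \<le> ennreal (norm w powr (- (2 * d - 1))) + ennreal (norm (e - w) powr (- (2 * d - 1)))"
          by (simp add: ennreal_plus[symmetric] ennreal_leI del: ennreal_plus minus_diff_eq)
        also have "\<dots> = G1 w + G2 (e - w)" using 3 by (simp add: G1_def G2_def)
        finally show ?thesis .
      qed
    qed
    have "(\<integral>\<^sup>+w. ennreal (norm w powr (- ?p) * norm (e - w) powr (- ?q)) \<partial>lborel) \<le> (\<integral>\<^sup>+w. G1 w + G2 (e - w) \<partial>lborel)"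
      by (rule nn_integral_mono) (rule pw)
    also have "\<dots> = (\<integral>\<^sup>+w. G1 w \<partial>lborel) + (\<integral>\<^sup>+w. G2 (e - w) \<partial>lborel)"
      by (rule nn_integral_add) auto
    also have "(\<integral>\<^sup>+w. G2 (e - w) \<partial>lborel) = (\<integral>\<^sup>+w. G2 w \<partial>lborel)"
      by (rule nn_integral_lborel_reflect) simp
    finally show ?thesis by (simp add: C)
  qed
  show ?thesis
  proof (intro exI[of _ C] conjI allI impI)
    fix y :: 'a assume "y \<noteq> 0"
    define r where "r = norm y"
    define e where "e = (1/r) *\<^sub>R y"
    have r: "r > 0" and e: "norm e = 1" and y: "y = r *\<^sub>R e" using \<open>y \<noteq> 0\<close> by (auto simp: r_def e_def)
    have "(\<integral>\<^sup>+w. ennreal (norm w powr (- ?p) * norm (y - w) powr (- ?q)) \<partial>lborel)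
      = ennreal (\<bar>r\<bar> ^ DIM('a)) * (\<integral>\<^sup>+w. ennreal (norm (0 + r *\<^sub>R w) powr (- ?p) * norm (y - (0 + r *\<^sub>R w)) powr (- ?q)) \<partial>lborel)"
      using r by (intro nn_integral_lborel_affine) auto
    also have "\<dots> = ennreal (r powr d) * (\<integral>\<^sup>+w. ennreal (r powr (- ?p) * r powr (- ?q)) * ennreal (norm w powr (- ?p) * norm (e - w) powr (- ?q)) \<partial>lborel)"
    proof (intro arg_cong2[where f="(*)"] nn_integral_cong)
      fix w :: 'a
      have "norm (y - (0 + r *\<^sub>R w)) = r * norm (e - w)"
        using r by (simp add: y scaleR_diff_right[symmetric])
      then show "ennreal (norm (0 + r *\<^sub>R w) powr (- ?p) * norm (y - (0 + r *\<^sub>R w)) powr (- ?q))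
        = ennreal (r powr (- ?p) * r powr (- ?q)) * ennreal (norm w powr (- ?p) * norm (e - w) powr (- ?q))"
        using r by (simp add: powr_mult ennreal_mult[symmetric] ac_simps del: minus_diff_eq)
    qed (use r in \<open>simp add: powr_realpow d_def\<close>)
    also have "\<dots> = ennreal (r powr d * (r powr (- ?p) * r powr (- ?q))) * (\<integral>\<^sup>+w. ennreal (norm w powr (- ?p) * norm (e - w) powr (- ?q)) \<partial>lborel)"
      by (subst nn_integral_cmult) (auto simp: ennreal_mult mult.assoc)
    also have "\<dots> \<le> ennreal (r powr d * (r powr (- ?p) * r powr (- ?q))) * ennreal C"
      by (intro mult_left_mono unit e) simp
    also have "\<dots> = ennreal (C * (r powr d * (r powr (- ?p) * r powr (- ?q))))"
      using C by (simp add: ennreal_mult[symmetric] mult.commute)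
    also have "r powr d * (r powr (- ?p) * r powr (- ?q)) = r powr (- (d - 1))"
      unfolding powr_add[symmetric] by (rule arg_cong[where f="(powr) r"]) simp
    finally show "(\<integral>\<^sup>+w. ennreal (norm w powr (- ?p) * norm (y - w) powr (- ?q)) \<partial>lborel) \<le> ennreal (C * norm y powr (- (d - 1)))"
      by (simp only: r_def)
  qed (rule C)
qed

text \<open>The first factor comes from the weight of the increments in the inversion formula, the
  second from the Riesz kernel inside the potential. Alone, the first is not integrable at
  \<open>w = 0\<close>; it always occurs with a factor linear in \<open>w\<close>.\<close>

definition inv_kernel :: "real \<Rightarrow> 'a::euclidean_space \<Rightarrow> 'a \<Rightarrow> real" where
  "inv_kernel s y w = norm w powr (- (real DIM('a) + s)) * norm (y - w) powr (- (real DIM('a) - s))"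

text \<open>By symmetry the integral of \<open>w\<close> against the kernel is a multiple of
  \<open>y\<close>; this is the multiple, read off by taking the inner product with
  \<open>y\<close>. At \<open>y = 0\<close> the division makes it 0.\<close>

definition inv_weight :: "real \<Rightarrow> 'a::euclidean_space \<Rightarrow> real" where
  "inv_weight s y = (\<integral>w. (y \<bullet> w) * inv_kernel s y w \<partial>lborel) / (norm y)\<^sup>2"

lemma measurable_inv_kernel [measurable (raw)]:
  assumes [measurable]: "f \<in> borel_measurable M" "g \<in> borel_measurable M"
  shows "(\<lambda>x. inv_kernel s (f x) (g x)) \<in> borel_measurable M"
  unfolding inv_kernel_def by measurable

lemma measurable_inv_weight [measurable]: "inv_weight s \<in> borel_measurable borel"
  unfolding inv_weight_def by measurable

lemma inv_kernel_nonneg: "0 \<le> inv_kernel s y w"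
  by (simp add: inv_kernel_def)

text \<open>The linear factor gains one power of \<open>norm w\<close>, which lowers the exponent of
  the singularity from \<open>d + s\<close> to \<open>d + s - 1\<close>, within reach of
  \<open>riesz_kernel_convolution_le\<close>.\<close>

lemma nn_integral_inv_kernel_le:
  fixes s :: real
  assumes "0 < s" "s < 1" and dim: "DIM('a::euclidean_space) \<ge> 2"
  shows "\<exists>C\<ge>0. \<forall>(y::'a) a. y \<noteq> 0 \<longrightarrow>
    (\<integral>\<^sup>+w. ennreal \<bar>(a \<bullet> w) * inv_kernel s y w\<bar> \<partial>lborel) \<le> ennreal (C * norm a * norm y powr (- (real DIM('a) - 1)))"
proof -
  let ?d = "real DIM('a)"
  obtain C where C: "C \<ge> 0" "\<And>y::'a. y \<noteq> 0 \<Longrightarrow>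
    (\<integral>\<^sup>+w. ennreal (norm w powr (- (?d + s - 1)) * norm (y - w) powr (- (?d - s))) \<partial>lborel) \<le> ennreal (C * norm y powr (- (?d - 1)))"
    using riesz_kernel_convolution_le[OF assms] by blast
  show ?thesis
  proof (intro exI[of _ C] conjI allI impI)
    fix y a :: 'a assume y: "y \<noteq> 0"
    have "(\<integral>\<^sup>+w. ennreal \<bar>(a \<bullet> w) * inv_kernel s y w\<bar> \<partial>lborel)
      \<le> (\<integral>\<^sup>+w. ennreal (norm a) * ennreal (norm w powr (- (?d + s - 1)) * norm (y - w) powr (- (?d - s))) \<partial>lborel)"
    proof (rule nn_integral_mono)
      fix w
      have "\<bar>(a \<bullet> w) * inv_kernel s y w\<bar> \<le> (norm a * norm w) * inv_kernel s y w"
        unfolding abs_mult abs_of_nonneg[OF inv_kernel_nonneg]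
        by (intro mult_right_mono Cauchy_Schwarz_ineq2 inv_kernel_nonneg)
      also have "\<dots> = norm a * ((norm w * norm w powr (- (?d + s))) * norm (y - w) powr (- (?d - s)))"
        by (simp add: inv_kernel_def ac_simps)
      also have "norm w * norm w powr (- (?d + s)) = norm w powr (- (?d + s - 1))"
        by (rule mult_norm_powr)
      finally show "ennreal \<bar>(a \<bullet> w) * inv_kernel s y w\<bar>
         \<le> ennreal (norm a) * ennreal (norm w powr (- (?d + s - 1)) * norm (y - w) powr (- (?d - s)))"
        by (subst ennreal_mult[symmetric]) (auto intro: ennreal_leI)
    qed
    also have "\<dots> = ennreal (norm a) * (\<integral>\<^sup>+w. ennreal (norm w powr (- (?d + s - 1)) * norm (y - w) powr (- (?d - s))) \<partial>lborel)"
      by (rule nn_integral_cmult) measurable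
    also have "\<dots> \<le> ennreal (norm a) * ennreal (C * norm y powr (- (?d - 1)))"
      by (intro mult_left_mono C y) simp
    also have "\<dots> = ennreal (C * norm a * norm y powr (- (?d - 1)))"
      using C(1) by (simp add: ennreal_mult[symmetric] ac_simps del: minus_diff_eq)
    finally show "(\<integral>\<^sup>+w. ennreal \<bar>(a \<bullet> w) * inv_kernel s y w\<bar> \<partial>lborel) \<le> ennreal (C * norm a * norm y powr (- (?d - 1)))" .
  qed (rule C)
qed

lemma integrable_inv_kernel:
  fixes s :: real and y a :: "'a::euclidean_space"
  assumes "0 < s" "s < 1" "DIM('a) \<ge> 2" "y \<noteq> 0"
  shows "integrable lborel (\<lambda>w. (a \<bullet> w) * inv_kernel s y w)"
proof -
  obtain C where "\<And>a. (\<integral>\<^sup>+w. ennreal \<bar>(a \<bullet> w) * inv_kernel s y w\<bar> \<partial>lborel) \<le> ennreal (C * norm a * norm y powr (- (real DIM('a) - 1)))"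
    using nn_integral_inv_kernel_le[OF assms(1-3)] assms(4) by blast
  from this[of a] have "(\<integral>\<^sup>+w. ennreal \<bar>(a \<bullet> w) * inv_kernel s y w\<bar> \<partial>lborel) < \<infinity>"
    by (rule le_less_trans) simp
  then show ?thesis by (subst integrable_iff_bounded) simp
qed

text \<open>The kernel is symmetric under the reflection fixing the axis through \<open>y\<close>, which
  averages \<open>w\<close> to its component along \<open>y\<close>.\<close>
lemma integral_inv_kernel:
  fixes s :: real and y a :: "'a::euclidean_space"
  assumes "0 < s" "s < 1" "DIM('a) \<ge> 2" "y \<noteq> 0"
  shows "(\<integral>w. (a \<bullet> w) * inv_kernel s y w \<partial>lborel) = (a \<bullet> y) * inv_weight s y"
proof -
  define R where "R = (\<lambda>w. (2 * (w \<bullet> y) / (y \<bullet> y)) *\<^sub>R y - w)"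
  have yy: "y \<bullet> y \<noteq> 0" using assms by simp
  have lin: "linear R"
    by (rule linearI) (auto simp: R_def algebra_simps inner_add_left add_divide_distrib)
  have Ry: "R w \<bullet> y = w \<bullet> y" for w using yy by (simp add: R_def inner_diff_left)
  have inv: "R (R w) = w" for w
    using Ry[of w] by (simp add: R_def)
  have "R w \<bullet> R w = w \<bullet> w" for w
  proof -
    have "R w \<bullet> R w = (2 * (w \<bullet> y) / (y \<bullet> y)) * (R w \<bullet> y) - R w \<bullet> w"
      by (subst (2) R_def) (simp add: inner_diff_right)
    also have "R w \<bullet> w = (2 * (w \<bullet> y) / (y \<bullet> y)) * (w \<bullet> y) - w \<bullet> w"
      by (simp add: R_def inner_diff_left inner_commute[of y w])
    finally show ?thesis by (simp add: Ry)
  qed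
  then have iso: "norm (R w) = norm w" for w by (simp add: norm_eq_sqrt_inner)
  have "R y = y" using yy by (simp add: R_def scaleR_2)
  then have "norm (y - R w) = norm (y - w)" for w
    using iso[of "y - w"] by (simp add: linear_diff[OF lin])
  then have kR: "inv_kernel s y (R w) = inv_kernel s y w" for w by (simp add: inv_kernel_def iso)
  note int = integrable_inv_kernel[OF assms]
  have "(\<integral>w. (a \<bullet> w) * inv_kernel s y w \<partial>lborel) = (\<integral>w. (a \<bullet> R w) * inv_kernel s y (R w) \<partial>lborel)"
    by (rule integral_lborel_involution[OF lin iso inv, symmetric]) measurable
  also have "\<dots> = (\<integral>w. 2 * (a \<bullet> y) / (y \<bullet> y) * ((y \<bullet> w) * inv_kernel s y w) - (a \<bullet> w) * inv_kernel s y w \<partial>lborel)"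
    by (rule Bochner_Integration.integral_cong) (simp_all only: kR, auto simp: R_def inner_diff_right inner_commute field_simps)
  also have "\<dots> = 2 * (a \<bullet> y) / (y \<bullet> y) * (\<integral>w. (y \<bullet> w) * inv_kernel s y w \<partial>lborel) - (\<integral>w. (a \<bullet> w) * inv_kernel s y w \<partial>lborel)"
    using int by (subst Bochner_Integration.integral_diff) auto
  finally show ?thesis
    using yy by (simp add: inv_weight_def power2_norm_eq_inner field_simps)
qed

text \<open>Adding the integrand at \<open>- w\<close> gives \<open>q\<close>, a product in which
  \<open>y \<bullet> w\<close> and the difference of the two Riesz kernels have the same sign:
  \<open>w\<close> is closer to \<open>y\<close> than to \<open>- y\<close> exactly when
  \<open>y \<bullet> w\<close> is positive.\<close>

lemma inv_weight_pos:
  fixes s :: real and y :: "'a::euclidean_space"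
  assumes "0 < s" "s < 1" "DIM('a) \<ge> 2" "y \<noteq> 0"
  shows "inv_weight s y > 0"
proof -
  let ?d = "real DIM('a)"
  have d: "?d \<ge> 2" using assms by simp
  define P where "P = (\<integral>w. (y \<bullet> w) * inv_kernel s y w \<partial>lborel)"
  define q where "q = (\<lambda>w. (y \<bullet> w) * inv_kernel s y w + (y \<bullet> (0 - w)) * inv_kernel s y (0 - w))"
  have i1: "integrable lborel (\<lambda>w. (y \<bullet> w) * inv_kernel s y w)" by (rule integrable_inv_kernel[OF assms])
  have i2: "integrable lborel (\<lambda>w. (y \<bullet> (0 - w)) * inv_kernel s y (0 - w))"
    by (subst integrable_lborel_reflect[of "\<lambda>w. (y \<bullet> w) * inv_kernel s y w" 0]) (rule i1)
  have iq: "integrable lborel q" unfolding q_def using i1 i2 by (rule Bochner_Integration.integrable_add)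
  have "(\<integral>w. q w \<partial>lborel) = P + P"
    unfolding q_def P_def using i1 i2
    by (simp only: Bochner_Integration.integral_add integral_lborel_reflect[of "\<lambda>w. (y \<bullet> w) * inv_kernel s y w" 0])
  have qeq: "q w = (y \<bullet> w) * norm w powr (- (?d + s)) * (norm (y - w) powr (- (?d - s)) - norm (y + w) powr (- (?d - s)))" for w
    by (simp add: q_def inv_kernel_def algebra_simps)
  have sq: "(norm (y + w))\<^sup>2 - (norm (y - w))\<^sup>2 = 4 * (y \<bullet> w)" for w
    by (simp add: power2_norm_eq_inner inner_add_left inner_add_right inner_diff_left inner_diff_right inner_commute)
  have lt: "r powr (- (?d - s)) < r' powr (- (?d - s))" if "0 < r'" "r' < r" for r r' :: real
    using that d assms by (intro powr_less_mono2_neg) auto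
  \<comment> \<open>The points \<open>y\<close> and \<open>- y\<close> are excluded because a power
    of 0 is 0, so the comparison of the kernels fails at the singularities.\<close>
  have qpos: "q w > 0" if w: "y \<bullet> w \<noteq> 0" "w \<noteq> y" "w \<noteq> - y" for w
  proof -
    have n: "norm w > 0" "norm (y - w) > 0" "norm (y + w) > 0"
      using w by (auto simp: add_eq_0_iff)
    show ?thesis
    proof (cases "y \<bullet> w > 0")
      case True
      then have "(norm (y - w))\<^sup>2 < (norm (y + w))\<^sup>2" using sq[of w] by linarith
      then have "norm (y - w) < norm (y + w)" by (rule power2_less_imp_less) simp
      from lt[OF n(2) this] show ?thesis unfolding qeq using True n by (intro mult_pos_pos) auto
    next
      case False
      then have "y \<bullet> w < 0" using w by simp
      then have "(norm (y + w))\<^sup>2 < (norm (y - w))\<^sup>2" using sq[of w] by linarith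
      then have "norm (y + w) < norm (y - w)" by (rule power2_less_imp_less) simp
      from lt[OF n(3) this] show ?thesis unfolding qeq using False n w by (intro mult_neg_neg mult_neg_pos) auto
    qed
  qed
  have qnn: "AE w in lborel. 0 \<le> q w"
    using AE_lborel_singleton[of y] AE_lborel_singleton[of "- y"]
  proof eventually_elim
    case (elim w)
    then show ?case using qpos[of w] by (cases "y \<bullet> w = 0") (auto simp: qeq)
  qed
  have "(\<integral>w. q w \<partial>lborel) \<noteq> 0"
  proof
    assume "(\<integral>w. q w \<partial>lborel) = 0"
    then have "AE w in lborel. q w = 0"
      using integral_nonneg_eq_0_iff_AE[OF iq qnn] by simp
    \<comment> \<open>If \<open>q\<close> vanished almost everywhere, the open half space
      \<open>y \<bullet> w > 0\<close> without \<open>y\<close> would be negligible, although it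
      contains twice \<open>y\<close>.\<close>
    then have "AE w in lborel. \<not> (y \<bullet> w > 0 \<and> w \<noteq> y)"
    proof eventually_elim
      case (elim w)
      have ne: "w \<noteq> - y" if pos: "y \<bullet> w > 0"
      proof
        assume "w = - y"
        then have "y \<bullet> w \<le> 0" by simp
        with pos show False by simp
      qed
      show ?case using elim qpos[of w] ne by fastforce
    qed
    moreover have o: "open {w. y \<bullet> w > 0 \<and> w \<noteq> y}"
      by (intro open_Collect_conj open_Collect_less open_Collect_neq continuous_intros)
    ultimately have "{w. y \<bullet> w > 0 \<and> w \<noteq> y} \<in> null_sets lborel"
      using AE_iff_null_sets[of "{w. y \<bullet> w > 0 \<and> w \<noteq> y}" lborel] borel_open[OF o] by simp
    then have "negligible {w. y \<bullet> w > 0 \<and> w \<noteq> y}"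
      by (simp add: negligible_iff_null_sets null_sets_completionI)
    moreover note o
    moreover have "2 *\<^sub>R y \<in> {w. y \<bullet> w > 0 \<and> w \<noteq> y}" using assms by (auto simp: scaleR_2 inner_add_right add_pos_pos)
    ultimately show False using open_not_negligible by blast
  qed
  moreover have "(\<integral>w. q w \<partial>lborel) \<ge> 0" by (rule integral_nonneg_AE[OF qnn])
  ultimately have "P > 0" using \<open>(\<integral>w. q w \<partial>lborel) = P + P\<close> by simp
  then show ?thesis using assms by (simp add: inv_weight_def P_def)
qed

text \<open>Counting powers of \<open>t\<close>, with \<open>d\<close> the dimension:
  \<open>d\<close> from the change of variables, 2 from the inner product and \<open>- 2 * d\<close>
  from the kernel; the division by the squared norm removes the 2.\<close>

lemma inv_weight_scaleR:
  fixes y :: "'a::euclidean_space"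
  assumes "t > 0"
  shows "inv_weight s (t *\<^sub>R y) = t powr (- real DIM('a)) * inv_weight s y"
proof -
  let ?d = "real DIM('a)"
  have "(\<integral>w. ((t *\<^sub>R y) \<bullet> w) * inv_kernel s (t *\<^sub>R y) w \<partial>lborel)
    = t ^ DIM('a) * (\<integral>w. ((t *\<^sub>R y) \<bullet> (0 + t *\<^sub>R w)) * inv_kernel s (t *\<^sub>R y) (0 + t *\<^sub>R w) \<partial>lborel)"
    using integral_lborel_affine[of t "\<lambda>w. ((t *\<^sub>R y) \<bullet> w) * inv_kernel s (t *\<^sub>R y) w" 0] assms by simp
  also have "\<dots> = t ^ DIM('a) * (\<integral>w. (t\<^sup>2 * (t powr (- (?d + s)) * t powr (- (?d - s)))) * ((y \<bullet> w) * inv_kernel s y w) \<partial>lborel)"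
    using assms by (simp add: inv_kernel_def scaleR_diff_right[symmetric] powr_mult power2_eq_square ac_simps del: minus_diff_eq)
  also have "\<dots> = t powr ?d * (t powr 2 * (t powr (- (?d + s)) * t powr (- (?d - s)))) * (\<integral>w. (y \<bullet> w) * inv_kernel s y w \<partial>lborel)"
    using assms by (simp add: powr_realpow)
  also have "t powr ?d * (t powr 2 * (t powr (- (?d + s)) * t powr (- (?d - s)))) = t powr 2 * t powr (- ?d)"
    unfolding powr_add[symmetric] by (rule arg_cong[where f="(powr) t"]) simp
  finally show ?thesis using assms by (simp add: inv_weight_def power_mult_distrib)
qed

lemma inv_weight_bound:
  fixes s :: real
  assumes "0 < s" "s < 1" "DIM('a::euclidean_space) \<ge> 2"
  shows "\<exists>C\<ge>0. \<forall>y::'a. \<bar>inv_weight s y\<bar> \<le> C * norm y powr (- real DIM('a))"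
proof -
  let ?d = "real DIM('a)"
  obtain C where C: "C \<ge> 0" "\<And>(y::'a) a. y \<noteq> 0 \<Longrightarrow>
    (\<integral>\<^sup>+w. ennreal \<bar>(a \<bullet> w) * inv_kernel s y w\<bar> \<partial>lborel) \<le> ennreal (C * norm a * norm y powr (- (?d - 1)))"
    using nn_integral_inv_kernel_le[OF assms] by blast
  show ?thesis
  proof (intro exI[of _ C] conjI allI)
    fix y :: 'a
    show "\<bar>inv_weight s y\<bar> \<le> C * norm y powr (- ?d)"
    proof (cases "y = 0")
      case False
      have "ennreal \<bar>\<integral>w. (y \<bullet> w) * inv_kernel s y w \<partial>lborel\<bar> \<le> (\<integral>\<^sup>+w. ennreal \<bar>(y \<bullet> w) * inv_kernel s y w\<bar> \<partial>lborel)"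
        using integral_norm_bound_ennreal[OF integrable_inv_kernel[OF assms False, of y]] by simp
      also have "\<dots> \<le> ennreal (C * norm y * norm y powr (- (?d - 1)))" by (rule C(2)[OF False])
      finally have "\<bar>\<integral>w. (y \<bullet> w) * inv_kernel s y w \<partial>lborel\<bar> \<le> C * norm y * norm y powr (- (?d - 1))"
        using C(1) by (subst (asm) ennreal_le_iff) auto
      also have "\<dots> = C * norm y powr (- ?d) * (norm y)\<^sup>2"
        using False by (simp add: powr_diff powr_minus power2_eq_square field_simps)
      finally show ?thesis using False by (simp add: inv_weight_def divide_le_eq)
    qed (simp add: inv_weight_def)
  qed (rule C)
qed

text \<open>Integration in polar coordinates, with Fubini's theorem and scaling in place of the
  coarea formula: \<open>norm y powr (-d)\<close> is \<open>d\<close> times the integral of \<open>t powr (-d-1)\<close> over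
  \<open>t > norm y\<close>, and the substitution \<open>y = t \<eta>\<close> leads to integrals along rays.\<close>
lemma integral_gradient_radial:
  fixes u :: "'a::euclidean_space \<Rightarrow> real" and Du :: "'a \<Rightarrow> 'a" and \<Theta> :: "'a \<Rightarrow> real"
  assumes dim: "DIM('a) \<ge> 2"
    and deriv: "\<And>x. (u has_derivative (\<lambda>h. Du x \<bullet> h)) (at x)" and cont: "continuous_on UNIV Du"
    and supp: "\<And>y. R \<le> norm y \<Longrightarrow> u y = 0" "\<And>y. R \<le> norm y \<Longrightarrow> Du y = 0"
    and [measurable]: "\<Theta> \<in> borel_measurable borel" and \<Theta>: "\<And>y. \<bar>\<Theta> y\<bar> \<le> C" "\<And>t y. 0 < t \<Longrightarrow> \<Theta> (t *\<^sub>R y) = \<Theta> y"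
  shows "(\<integral>y. (Du (x - y) \<bullet> y) * (norm y powr (- real DIM('a)) * \<Theta> y) \<partial>lborel)
    = u x * (real DIM('a) * (\<integral>\<eta>. \<Theta> \<eta> * indicator (ball 0 1) \<eta> \<partial>lborel))"
proof -
  let ?d = "real DIM('a)"
  have d: "?d \<ge> 2" using dim by simp
  have Dm[measurable]: "Du \<in> borel_measurable borel" using cont by (rule borel_measurable_continuous_onI)
  obtain c where c: "\<And>x. norm (Du x) \<le> c" using bounded_compact_support[OF cont supp(2)] by blast
  have c0: "c \<ge> 0" using c[of 0] norm_ge_zero order_trans by blast
  have C0: "C \<ge> 0" using \<Theta>(1)[of 0] abs_ge_zero order_trans by blast
  have [measurable]: "(\<lambda>y. indicator (ball (0::'a) 1) y :: real) \<in> borel_measurable borel"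
    by (intro borel_measurable_indicator) simp
  \<comment> \<open>Integration over \<open>t\<close> turns \<open>F\<close> into the integrand of
    the claim, by the layer cake for \<open>norm y powr (-d)\<close>.\<close>
  define F where "F = (\<lambda>(y::'a) t. ?d * (t powr (- ?d - 1) * (if norm y < t then 1 else 0)) * ((Du (x - y) \<bullet> y) * \<Theta> y))"
  \<comment> \<open>\<open>F\<close> after the substitution of \<open>t\<close> times
    \<open>\<eta>\<close> for \<open>y\<close>: the Jacobian, the power of \<open>t\<close> and the
    linear factor cancel exactly, and the condition \<open>norm y < t\<close> becomes membership of
    \<open>\<eta>\<close> in the unit ball.\<close>
  define G where "G = (\<lambda>(\<eta>::'a) t. ?d * (if 0 < t then 1 else 0) * indicator (ball 0 1) \<eta> * ((Du (x - t *\<^sub>R \<eta>) \<bullet> \<eta>) * \<Theta> \<eta>) :: real)"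
  have Fm: "case_prod F \<in> borel_measurable (lborel \<Otimes>\<^sub>M lborel)"
    unfolding F_def by measurable
  have Gm: "case_prod G \<in> borel_measurable (lborel \<Otimes>\<^sub>M lborel)"
    unfolding G_def by measurable
  have Fm1[measurable]: "(\<lambda>y. F y t) \<in> borel_measurable lborel" for t unfolding F_def by measurable
  have FG: "t ^ DIM('a) * F (t *\<^sub>R \<eta>) t = G \<eta> t" if "t > 0" for t \<eta>
  proof -
    have "t ^ DIM('a) * (t powr (- ?d - 1) * t) = t powr ?d * (t powr (- ?d - 1) * t powr 1)"
      using that by (simp add: powr_realpow)
    also have "\<dots> = t powr 0" unfolding powr_add[symmetric] by (rule arg_cong[where f="(powr) t"]) simp
    finally have e: "t ^ DIM('a) * (t powr (- ?d - 1) * t) = 1" using that by simp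
    have n: "norm (t *\<^sub>R \<eta>) < t \<longleftrightarrow> \<eta> \<in> ball 0 1" using that by simp
    have "t ^ DIM('a) * F (t *\<^sub>R \<eta>) t
      = ?d * (t ^ DIM('a) * (t powr (- ?d - 1) * t)) * (if norm (t *\<^sub>R \<eta>) < t then 1 else 0) * ((Du (x - t *\<^sub>R \<eta>) \<bullet> \<eta>) * \<Theta> \<eta>)"
      using that by (simp add: F_def \<Theta>(2) ac_simps del: norm_scaleR)
    then show ?thesis unfolding e n using that by (simp add: G_def indicator_def)
  qed
  have F0: "F y t = 0" if "t \<le> 0" for y t
  proof -
    have "\<not> norm y < t" using that norm_ge_zero[of y] by linarith
    then show ?thesis by (simp add: F_def)
  qed
  have int_t: "(\<integral>\<^sup>+t. ennreal (?d * (t powr (- ?d - 1) * (if r < t then 1 else 0))) \<partial>lborel) = ennreal (r powr (- ?d))"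
    if "r > 0" for r :: real
  proof -
    have "(\<integral>\<^sup>+t. ennreal (?d * (t powr (- ?d - 1) * (if r < t then 1 else 0))) \<partial>lborel)
      = (\<integral>\<^sup>+t. ennreal ?d * (ennreal (t powr (- ?d - 1)) * indicator {r<..} t) \<partial>lborel)"
      by (intro nn_integral_cong) (auto simp: ennreal_mult split: split_indicator)
    also have "\<dots> = ennreal ?d * (\<integral>\<^sup>+t. ennreal (t powr (- ?d - 1)) * indicator {r<..} t \<partial>lborel)"
      by (rule nn_integral_cmult) measurable
    also have "\<dots> = ennreal (?d * (r powr (- ?d) / ?d))"
      using d that by (subst nn_integral_powr_greaterThan) (auto simp: ennreal_mult[symmetric])
    finally show ?thesis using d by simp
  qed
  have "(\<integral>\<^sup>+y. \<integral>\<^sup>+t. ennreal \<bar>F y t\<bar> \<partial>lborel \<partial>lborel)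
    \<le> (\<integral>\<^sup>+y. ennreal (c * C) * (ennreal (norm (y::'a) powr (- (?d - 1))) * indicator (ball 0 (\<bar>R\<bar> + norm x + 1)) y) \<partial>lborel)"
  proof (rule nn_integral_mono_AE, use AE_lborel_singleton[of "0::'a"] in eventually_elim)
    case (elim y)
    have "(\<integral>\<^sup>+t. ennreal \<bar>F y t\<bar> \<partial>lborel)
      = (\<integral>\<^sup>+t. ennreal (?d * (t powr (- ?d - 1) * (if norm y < t then 1 else 0))) * ennreal \<bar>(Du (x - y) \<bullet> y) * \<Theta> y\<bar> \<partial>lborel)"
      by (intro nn_integral_cong) (auto simp: F_def ennreal_mult[symmetric] abs_mult)
    also have "\<dots> = ennreal (norm y powr (- ?d)) * ennreal \<bar>(Du (x - y) \<bullet> y) * \<Theta> y\<bar>"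
      using elim int_t[of "norm y"] by (subst nn_integral_multc) auto
    also have "\<dots> \<le> ennreal (c * C) * (ennreal (norm y powr (- (?d - 1))) * indicator (ball 0 (\<bar>R\<bar> + norm x + 1)) y)"
    proof (cases "R \<le> norm (x - y)")
      case True
      then show ?thesis using supp by simp
    next
      case False
      have "norm y < \<bar>R\<bar> + norm x + 1" using norm_triangle_ineq4[of x "x - y"] False by simp
      moreover have "norm y powr (- ?d) * \<bar>(Du (x - y) \<bullet> y) * \<Theta> y\<bar> \<le> c * C * norm y powr (- (?d - 1))"
      proof -
        have "\<bar>Du (x - y) \<bullet> y\<bar> \<le> c * norm y"
          using Cauchy_Schwarz_ineq2[of "Du (x - y)" y] mult_right_mono[OF c[of "x - y"], of "norm y"] by simp
        then have "\<bar>(Du (x - y) \<bullet> y) * \<Theta> y\<bar> \<le> (c * norm y) * C"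
          unfolding abs_mult using c0 by (intro mult_mono \<Theta>(1)) auto
        then have "norm y powr (- ?d) * \<bar>(Du (x - y) \<bullet> y) * \<Theta> y\<bar> \<le> norm y powr (- ?d) * ((c * norm y) * C)"
          by (intro mult_left_mono) auto
        also have "\<dots> = c * C * (norm y * norm y powr (- ?d))" by (simp add: ac_simps)
        finally show ?thesis unfolding mult_norm_powr .
      qed
      ultimately show ?thesis using c0 C0
        by (simp add: ennreal_mult[symmetric] ennreal_leI del: minus_diff_eq)
    qed
    finally show ?case .
  qed
  also have "\<dots> < \<infinity>"
  proof -
    have "(\<integral>\<^sup>+y. ennreal (norm (y::'a) powr (- (?d - 1))) * indicator (ball 0 (\<bar>R\<bar> + norm x + 1)) y \<partial>lborel) < \<infinity>"
      using d by (intro nn_integral_powr_inside) (auto intro: add_nonneg_pos)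
    moreover have [measurable]: "ball (0::'a) (\<bar>R\<bar> + norm x + 1) \<in> sets borel" by simp
    ultimately show ?thesis by (subst nn_integral_cmult) (auto simp: ennreal_mult_less_top)
  qed
  finally have fin: "(\<integral>\<^sup>+y. \<integral>\<^sup>+t. ennreal \<bar>F y t\<bar> \<partial>lborel \<partial>lborel) < \<infinity>" .
  have "(\<integral>\<^sup>+t. \<integral>\<^sup>+y. ennreal \<bar>F y t\<bar> \<partial>lborel \<partial>lborel) = (\<integral>\<^sup>+y. \<integral>\<^sup>+t. ennreal \<bar>F y t\<bar> \<partial>lborel \<partial>lborel)"
    using Fm by (intro lborel_pair.Fubini') (simp add: split_beta')
  moreover have "(\<integral>\<^sup>+y. ennreal \<bar>F y t\<bar> \<partial>lborel) = (\<integral>\<^sup>+\<eta>. ennreal \<bar>G \<eta> t\<bar> \<partial>lborel)" for t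
  proof (cases "t > 0")
    case True
    have "(\<integral>\<^sup>+y. ennreal \<bar>F y t\<bar> \<partial>lborel) = ennreal (\<bar>t\<bar> ^ DIM('a)) * (\<integral>\<^sup>+\<eta>. ennreal \<bar>F (0 + t *\<^sub>R \<eta>) t\<bar> \<partial>lborel)"
      using True by (intro nn_integral_lborel_affine) auto
    also have "\<dots> = (\<integral>\<^sup>+\<eta>. ennreal (\<bar>t\<bar> ^ DIM('a)) * ennreal \<bar>F (0 + t *\<^sub>R \<eta>) t\<bar> \<partial>lborel)"
      using Fm1[of t] by (intro nn_integral_cmult[symmetric]) measurable
    also have "\<dots> = (\<integral>\<^sup>+\<eta>. ennreal \<bar>G \<eta> t\<bar> \<partial>lborel)"
      using True by (intro nn_integral_cong) (simp add: FG[symmetric] ennreal_mult[symmetric] abs_mult)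
    finally show ?thesis .
  qed (simp add: F0 G_def)
  moreover have "(\<integral>\<^sup>+t. \<integral>\<^sup>+\<eta>. ennreal \<bar>G \<eta> t\<bar> \<partial>lborel \<partial>lborel) = (\<integral>\<^sup>+\<eta>. \<integral>\<^sup>+t. ennreal \<bar>G \<eta> t\<bar> \<partial>lborel \<partial>lborel)"
    using Gm by (intro lborel_pair.Fubini') (simp add: split_beta')
  ultimately have finG: "(\<integral>\<^sup>+\<eta>. \<integral>\<^sup>+t. ennreal \<bar>G \<eta> t\<bar> \<partial>lborel \<partial>lborel) < \<infinity>"
    using fin by simp
  \<comment> \<open>Along the ray from \<open>x\<close> in direction \<open>- \<eta>\<close> the
    integrand is the derivative of \<open>- u\<close>. From the parameter \<open>T\<close> on, the
    ray is outside the support, so only the value at the start remains.\<close>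
  have G_t: "(\<integral>t. G \<eta> t \<partial>lborel) = ?d * (\<Theta> \<eta> * indicator (ball 0 1) \<eta>) * u x" if "\<eta> \<noteq> 0" for \<eta>
  proof -
    define T where "T = (\<bar>R\<bar> + norm x) / norm \<eta>"
    have T: "T \<ge> 0" by (simp add: T_def)
    have far: "R \<le> norm (x - t *\<^sub>R \<eta>)" if "T \<le> t" for t
    proof -
      have "\<bar>R\<bar> + norm x \<le> t * norm \<eta>"
        using that \<open>\<eta> \<noteq> 0\<close> by (simp add: T_def field_simps)
      also have "\<dots> \<le> norm (t *\<^sub>R \<eta>)" by (simp add: mult_right_mono)
      finally have "\<bar>R\<bar> + norm x \<le> norm (t *\<^sub>R \<eta>)" .
      then show ?thesis using norm_triangle_ineq2[of "t *\<^sub>R \<eta>" x] by (simp add: norm_minus_commute)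
    qed
    have "(\<integral>t. (Du (x - t *\<^sub>R \<eta>) \<bullet> \<eta>) * indicator {0..T} t \<partial>lborel) = - u (x - T *\<^sub>R \<eta>) - (- u (x - 0 *\<^sub>R \<eta>))"
    proof (rule integral_FTC_Icc_real[OF T])
      fix t :: real
      have "((\<lambda>t. - u (x - t *\<^sub>R \<eta>)) has_derivative (\<lambda>h. - (Du (x - t *\<^sub>R \<eta>) \<bullet> (- (h *\<^sub>R \<eta>))))) (at t)"
        by (intro has_derivative_minus has_derivative_compose[OF _ deriv]) (auto intro!: derivative_eq_intros)
      then show "((\<lambda>t. - u (x - t *\<^sub>R \<eta>)) has_real_derivative Du (x - t *\<^sub>R \<eta>) \<bullet> \<eta>) (at t)"
        by (simp add: has_field_derivative_def mult_commute_abs)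
      have "continuous_on UNIV (\<lambda>t. Du (x - t *\<^sub>R \<eta>) \<bullet> \<eta>)"
        by (intro continuous_intros continuous_on_compose2[OF cont]) auto
      then show "isCont (\<lambda>t. Du (x - t *\<^sub>R \<eta>) \<bullet> \<eta>) t" by (simp add: continuous_on_eq_continuous_at)
    qed
    also have "\<dots> = u x" using supp(1)[OF far[of T]] by simp
    finally have 1: "(\<integral>t. (Du (x - t *\<^sub>R \<eta>) \<bullet> \<eta>) * indicator {0..T} t \<partial>lborel) = u x" .
    have "(\<integral>t. G \<eta> t \<partial>lborel) = (\<integral>t. ?d * (\<Theta> \<eta> * indicator (ball 0 1) \<eta>) * ((Du (x - t *\<^sub>R \<eta>) \<bullet> \<eta>) * indicator {0..T} t) \<partial>lborel)"
    proof (rule integral_cong_AE)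
      show "AE t in lborel. G \<eta> t = ?d * (\<Theta> \<eta> * indicator (ball 0 1) \<eta>) * ((Du (x - t *\<^sub>R \<eta>) \<bullet> \<eta>) * indicator {0..T} t)"
        using AE_lborel_singleton[of "0::real"]
      proof eventually_elim
        case (elim t)
        show ?case using elim supp(2)[OF far[of t]]
          by (cases "T \<le> t") (auto simp: G_def split: split_indicator)
      qed
    qed (unfold G_def, measurable)
    then show ?thesis using 1 by simp
  qed
  have "(\<integral>y. (Du (x - y) \<bullet> y) * (norm y powr (- ?d) * \<Theta> y) \<partial>lborel) = (\<integral>y. \<integral>t. F y t \<partial>lborel \<partial>lborel)"
  proof (rule integral_cong_AE)
    show "AE y in lborel. (Du (x - y) \<bullet> y) * (norm y powr (- ?d) * \<Theta> y) = (\<integral>t. F y t \<partial>lborel)"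
      using AE_lborel_singleton[of "0::'a"]
    proof eventually_elim
      case (elim y)
      have "(\<integral>t. ?d * (t powr (- ?d - 1) * (if norm y < t then 1 else 0)) \<partial>lborel) = norm y powr (- ?d)"
        using int_t[of "norm y"] elim by (subst integral_eq_nn_integral) auto
      then show ?case by (simp add: F_def)
    qed
    show "(\<lambda>y. \<integral>t. F y t \<partial>lborel) \<in> borel_measurable lborel"
      using Fm by (rule lborel.borel_measurable_lebesgue_integral)
  qed measurable
  also have "\<dots> = (\<integral>t. \<integral>y. F y t \<partial>lborel \<partial>lborel)" by (rule Fubini_abs(1)[OF Fm fin])
  also have "\<dots> = (\<integral>t. \<integral>\<eta>. G \<eta> t \<partial>lborel \<partial>lborel)"
  proof (rule Bochner_Integration.integral_cong[OF refl])
    fix t :: real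
    show "(\<integral>y. F y t \<partial>lborel) = (\<integral>\<eta>. G \<eta> t \<partial>lborel)"
    proof (cases "t > 0")
      case True
      then show ?thesis using integral_lborel_affine[of t "\<lambda>y. F y t" 0] by (simp add: FG[symmetric])
    qed (simp add: F0 G_def)
  qed
  also have "\<dots> = (\<integral>\<eta>. \<integral>t. G \<eta> t \<partial>lborel \<partial>lborel)" by (rule Fubini_abs(1)[OF Gm finG, symmetric])
  also have "\<dots> = (\<integral>\<eta>. ?d * (\<Theta> \<eta> * indicator (ball 0 1) \<eta>) * u x \<partial>lborel)"
  proof (rule integral_cong_AE)
    show "AE \<eta> in lborel. (\<integral>t. G \<eta> t \<partial>lborel) = ?d * (\<Theta> \<eta> * indicator (ball 0 1) \<eta>) * u x"
      by (rule eventually_mono[OF AE_lborel_singleton[of "0::'a"]]) (rule G_t)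
    show "(\<lambda>\<eta>. \<integral>t. G \<eta> t \<partial>lborel) \<in> borel_measurable lborel"
      using Gm by (rule lborel.borel_measurable_lebesgue_integral)
  qed measurable
  also have "\<dots> = u x * (?d * (\<integral>\<eta>. \<Theta> \<eta> * indicator (ball 0 1) \<eta> \<partial>lborel))"
    by simp
  finally show ?thesis .
qed

text \<open>The increment of \<open>V\<close> is the integral of its gradient over the segment.
  Rescaling \<open>w = t z\<close> makes the integral over space the same for every \<open>t\<close>
  up to the factor \<open>t powr (s - 1)\<close>, whose integral over the unit interval is
  \<open>1 / s\<close>.\<close>

lemma integral_difference_kernel:
  fixes V :: "'a::euclidean_space \<Rightarrow> real" and DV :: "'a \<Rightarrow> 'a" and s :: real
  assumes s: "0 < s"
    and deriv: "\<And>x. (V has_derivative (\<lambda>h. DV x \<bullet> h)) (at x)" and cont: "continuous_on UNIV DV"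
    and fin: "(\<integral>\<^sup>+w. ennreal \<bar>(DV (x - w) \<bullet> w) * norm w powr (- (real DIM('a) + s))\<bar> \<partial>lborel) < \<infinity>"
  shows "integrable lborel (\<lambda>z. (V x - V (x - z)) * norm z powr (- (real DIM('a) + s)))"
    and "s * (\<integral>z. (V x - V (x - z)) * norm z powr (- (real DIM('a) + s)) \<partial>lborel)
      = (\<integral>w. (DV (x - w) \<bullet> w) * norm w powr (- (real DIM('a) + s)) \<partial>lborel)"
proof -
  let ?d = "real DIM('a)"
  define h where "h = (\<lambda>w. (DV (x - w) \<bullet> w) * norm w powr (- (?d + s)))"
  have [measurable]: "DV \<in> borel_measurable borel" using cont by (rule borel_measurable_continuous_onI)
  have hm[measurable]: "h \<in> borel_measurable borel" unfolding h_def by measurable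
  define F where "F = (\<lambda>(z::'a) t. indicator {0<..1} t * ((DV (x - t *\<^sub>R z) \<bullet> z) * norm z powr (- (?d + s))))"
  have Fm: "case_prod F \<in> borel_measurable (lborel \<Otimes>\<^sub>M lborel)"
    unfolding F_def by measurable
  \<comment> \<open>The linear factor and the kernel supply the exponent \<open>1 - d - s\<close> of
    \<open>t\<close>; compensating it and splitting off the Jacobian \<open>t ^ d\<close> leaves
    \<open>s - 1\<close>.\<close>
  have Fh: "F z t = indicator {0<..1} t * t powr (s - 1) * (t ^ DIM('a) * h (t *\<^sub>R z))" for z and t :: real
  proof (cases "0 < t")
    case True
    have "t powr (s - 1) * t ^ DIM('a) * (t * t powr (- (?d + s))) = t powr (s - 1) * t powr ?d * (t powr 1 * t powr (- (?d + s)))"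
      using True by (simp add: powr_realpow)
    also have "\<dots> = t powr 0" unfolding powr_add[symmetric] by (rule arg_cong[where f="(powr) t"]) simp
    finally have e: "t powr (s - 1) * t ^ DIM('a) * (t * t powr (- (?d + s))) = 1" using True by simp
    have "indicator {0<..1} t * t powr (s - 1) * (t ^ DIM('a) * h (t *\<^sub>R z))
      = (t powr (s - 1) * t ^ DIM('a) * (t * t powr (- (?d + s)))) * F z t"
      using True by (simp add: h_def F_def powr_mult ac_simps)
    then show ?thesis unfolding e by simp
  qed (simp add: F_def)
  have scale: "(\<integral>\<^sup>+z. ennreal (t ^ DIM('a)) * ennreal \<bar>h (t *\<^sub>R z)\<bar> \<partial>lborel) = (\<integral>\<^sup>+w. ennreal \<bar>h w\<bar> \<partial>lborel)" if "t > 0" for t :: real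
    using nn_integral_lborel_affine[of "\<lambda>w. ennreal \<bar>h w\<bar>" t 0] that by (simp add: nn_integral_cmult)
  have "(\<integral>\<^sup>+z. \<integral>\<^sup>+t. ennreal \<bar>F z t\<bar> \<partial>lborel \<partial>lborel) = (\<integral>\<^sup>+t. \<integral>\<^sup>+z. ennreal \<bar>F z t\<bar> \<partial>lborel \<partial>lborel)"
    using Fm by (intro lborel_pair.Fubini'[symmetric]) (simp add: split_beta')
  also have "\<dots> \<le> (\<integral>\<^sup>+t. (ennreal (t powr (s - 1)) * indicator {0..1} t) * (\<integral>\<^sup>+w. ennreal \<bar>h w\<bar> \<partial>lborel) \<partial>lborel)"
  proof (rule nn_integral_mono)
    fix t :: real
    show "(\<integral>\<^sup>+z. ennreal \<bar>F z t\<bar> \<partial>lborel) \<le> (ennreal (t powr (s - 1)) * indicator {0..1} t) * (\<integral>\<^sup>+w. ennreal \<bar>h w\<bar> \<partial>lborel)"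
    proof (cases "0 < t \<and> t \<le> 1")
      case True
      then have "(\<integral>\<^sup>+z. ennreal \<bar>F z t\<bar> \<partial>lborel) = (\<integral>\<^sup>+z. ennreal (t powr (s - 1)) * (ennreal (t ^ DIM('a)) * ennreal \<bar>h (t *\<^sub>R z)\<bar>) \<partial>lborel)"
        by (intro nn_integral_cong) (simp add: Fh abs_mult ennreal_mult[symmetric])
      also have "\<dots> = ennreal (t powr (s - 1)) * (\<integral>\<^sup>+z. ennreal (t ^ DIM('a)) * ennreal \<bar>h (t *\<^sub>R z)\<bar> \<partial>lborel)"
        by (rule nn_integral_cmult) measurable
      finally show ?thesis using True by (simp add: scale)
    qed (auto simp: F_def)
  qed
  also have "\<dots> = ennreal (1 / s) * (\<integral>\<^sup>+w. ennreal \<bar>h w\<bar> \<partial>lborel)"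
    using nn_integral_powr_from_0[of "s - 1" 1] s by (simp add: nn_integral_multc)
  also have "\<dots> < \<infinity>" using fin by (simp add: h_def ennreal_mult_less_top)
  finally have finF: "(\<integral>\<^sup>+z. \<integral>\<^sup>+t. ennreal \<bar>F z t\<bar> \<partial>lborel \<partial>lborel) < \<infinity>" .
  have F_t: "(\<integral>t. F z t \<partial>lborel) = (V x - V (x - z)) * norm z powr (- (?d + s))" for z
  proof -
    have "(\<integral>t. (DV (x - t *\<^sub>R z) \<bullet> z) * indicator {0..1} t \<partial>lborel) = - V (x - 1 *\<^sub>R z) - (- V (x - 0 *\<^sub>R z))"
    proof (rule integral_FTC_Icc_real)
      fix t :: real
      have "((\<lambda>t. - V (x - t *\<^sub>R z)) has_derivative (\<lambda>h. - (DV (x - t *\<^sub>R z) \<bullet> (- (h *\<^sub>R z))))) (at t)"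
        by (intro has_derivative_minus has_derivative_compose[OF _ deriv]) (auto intro!: derivative_eq_intros)
      then show "((\<lambda>t. - V (x - t *\<^sub>R z)) has_real_derivative DV (x - t *\<^sub>R z) \<bullet> z) (at t)"
        by (simp add: has_field_derivative_def mult_commute_abs)
      have "continuous_on UNIV (\<lambda>t. DV (x - t *\<^sub>R z) \<bullet> z)"
        by (intro continuous_intros continuous_on_compose2[OF cont]) auto
      then show "isCont (\<lambda>t. DV (x - t *\<^sub>R z) \<bullet> z) t" by (simp add: continuous_on_eq_continuous_at)
    qed simp
    then have 1: "(\<integral>t. (DV (x - t *\<^sub>R z) \<bullet> z) * indicator {0..1} t \<partial>lborel) = V x - V (x - z)" by simp
    have "(\<integral>t. F z t \<partial>lborel) = (\<integral>t. norm z powr (- (?d + s)) * ((DV (x - t *\<^sub>R z) \<bullet> z) * indicator {0..1} t) \<partial>lborel)"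
    proof (rule integral_cong_AE)
      show "AE t in lborel. F z t = norm z powr (- (?d + s)) * ((DV (x - t *\<^sub>R z) \<bullet> z) * indicator {0..1} t)"
        using AE_lborel_singleton[of "0::real"] by eventually_elim (auto simp: F_def split: split_indicator)
    qed (unfold F_def, measurable)
    then show ?thesis using 1 by (simp add: mult.commute)
  qed
  show "integrable lborel (\<lambda>z. (V x - V (x - z)) * norm z powr (- (?d + s)))"
    using Fubini_abs(2)[OF Fm finF] unfolding F_t .
  have "(\<integral>z. (V x - V (x - z)) * norm z powr (- (?d + s)) \<partial>lborel) = (\<integral>t. \<integral>z. F z t \<partial>lborel \<partial>lborel)"
    using Fubini_abs(1)[OF Fm finF] unfolding F_t .
  also have "\<dots> = (\<integral>t. (t powr (s - 1) * indicator {0..1} t) * (\<integral>w. h w \<partial>lborel) \<partial>lborel)"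
  proof (rule integral_cong_AE)
    show "AE t in lborel. (\<integral>z. F z t \<partial>lborel) = (t powr (s - 1) * indicator {0..1} t) * (\<integral>w. h w \<partial>lborel)"
      using AE_lborel_singleton[of "0::real"]
    proof eventually_elim
      case (elim t)
      show ?case
      proof (cases "0 < t \<and> t \<le> 1")
        case True
        then show ?thesis using integral_lborel_affine[of t h 0] by (simp add: Fh)
      qed (use elim in \<open>auto simp: F_def\<close>)
    qed
    show "(\<lambda>t. \<integral>z. F z t \<partial>lborel) \<in> borel_measurable lborel"
      by (rule lborel.borel_measurable_lebesgue_integral) (unfold F_def split_beta', measurable)
  qed measurable
  also have "\<dots> = (\<integral>t. t powr (s - 1) * indicator {0..1} t \<partial>lborel) * (\<integral>w. h w \<partial>lborel)"
    by simp
  also have "(\<integral>t. t powr (s - 1) * indicator {0..1} t \<partial>lborel) = 1 / s"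
  proof (subst integral_eq_nn_integral)
    have "(\<integral>\<^sup>+t. ennreal (t powr (s - 1) * indicator {0..1} t) \<partial>lborel) = (\<integral>\<^sup>+t. ennreal (t powr (s - 1)) * indicator {0..1} t \<partial>lborel)"
      by (intro nn_integral_cong) (auto split: split_indicator)
    then show "enn2real (\<integral>\<^sup>+t. ennreal (t powr (s - 1) * indicator {0..1} t) \<partial>lborel) = 1 / s"
      using nn_integral_powr_from_0[of "s - 1" 1] s by simp
  qed auto
  finally show "s * (\<integral>z. (V x - V (x - z)) * norm z powr (- (?d + s)) \<partial>lborel)
      = (\<integral>w. (DV (x - w) \<bullet> w) * norm w powr (- (?d + s)) \<partial>lborel)"
    using s by (simp add: h_def)
qed

text \<open>With \<open>DV\<close> written out as an integral over \<open>y\<close>, the integrand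
  is linear in \<open>Du (x - y)\<close>, and integrating over \<open>w\<close> first leaves the
  weight of \<open>integral_inv_kernel\<close>. Absolute convergence is seen in the same order: the
  inner integral is at most a multiple of \<open>norm y powr (- (d - 1))\<close>, which is locally
  integrable, and the support of \<open>Du\<close> confines \<open>y\<close> to a ball.\<close>

lemma riesz_conv_gradient_pairing:
  fixes s :: real and Du :: "'a::euclidean_space \<Rightarrow> 'a"
  assumes s: "0 < s" "s < 1" and dim: "DIM('a) \<ge> 2"
    and cont: "continuous_on UNIV Du" and supp: "\<And>y. R \<le> norm y \<Longrightarrow> Du y = 0"
  defines "DV \<equiv> riesz_conv (real DIM('a) - s) Du"
  shows "(\<integral>\<^sup>+w. ennreal \<bar>(DV (x - w) \<bullet> w) * norm w powr (- (real DIM('a) + s))\<bar> \<partial>lborel) < \<infinity>"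
    and "(\<integral>w. (DV (x - w) \<bullet> w) * norm w powr (- (real DIM('a) + s)) \<partial>lborel)
      = (\<integral>y. (Du (x - y) \<bullet> y) * inv_weight s y \<partial>lborel)"
proof -
  let ?d = "real DIM('a)"
  have d: "?d \<ge> 2" using dim by simp
  have Dm[measurable]: "Du \<in> borel_measurable borel" using cont by (rule borel_measurable_continuous_onI)
  obtain c where c: "\<And>x. norm (Du x) \<le> c" using bounded_compact_support[OF cont supp] by blast
  have c0: "c \<ge> 0" using c[of 0] norm_ge_zero order_trans by blast
  define F where "F = (\<lambda>w y. (Du (x - y) \<bullet> w) * inv_kernel s y w)"
  have Fm: "case_prod F \<in> borel_measurable (lborel \<Otimes>\<^sub>M lborel)" unfolding F_def by measurable
  have F_y: "(\<integral>y. F w y \<partial>lborel) = (DV (x - w) \<bullet> w) * norm w powr (- (?d + s))" for w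
  proof -
    have int: "integrable lborel (\<lambda>z. norm z powr (- (?d - s)) *\<^sub>R Du (x - w - z))"
      using s d by (intro riesz_conv_bound(1)[OF _ _ Dm supp c]) auto
    have "(\<integral>y. F w y \<partial>lborel) = (\<integral>z. F w (w + 1 *\<^sub>R z) \<partial>lborel)"
      using integral_lborel_affine[of 1 "F w" w] by simp
    also have "\<dots> = (\<integral>z. norm w powr (- (?d + s)) * ((norm z powr (- (?d - s)) *\<^sub>R Du (x - w - z)) \<bullet> w) \<partial>lborel)"
      by (rule Bochner_Integration.integral_cong) (auto simp: F_def inv_kernel_def algebra_simps)
    also have "\<dots> = norm w powr (- (?d + s)) * (\<integral>z. (norm z powr (- (?d - s)) *\<^sub>R Du (x - w - z)) \<bullet> w \<partial>lborel)"
      by (rule integral_mult_right_zero)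
    also have "(\<integral>z. (norm z powr (- (?d - s)) *\<^sub>R Du (x - w - z)) \<bullet> w \<partial>lborel) = DV (x - w) \<bullet> w"
      unfolding DV_def riesz_conv_def by (rule integral_inner_left) (rule int)
    finally show ?thesis by (simp only: mult.commute)
  qed
  obtain C where C: "C \<ge> 0" "\<And>(y::'a) a. y \<noteq> 0 \<Longrightarrow>
    (\<integral>\<^sup>+w. ennreal \<bar>(a \<bullet> w) * inv_kernel s y w\<bar> \<partial>lborel) \<le> ennreal (C * norm a * norm y powr (- (?d - 1)))"
    using nn_integral_inv_kernel_le[OF s dim] by blast
  have "(\<integral>\<^sup>+w. \<integral>\<^sup>+y. ennreal \<bar>F w y\<bar> \<partial>lborel \<partial>lborel) = (\<integral>\<^sup>+y. \<integral>\<^sup>+w. ennreal \<bar>F w y\<bar> \<partial>lborel \<partial>lborel)"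
    using Fm by (intro lborel_pair.Fubini'[symmetric]) (simp add: split_beta')
  also have "\<dots> \<le> (\<integral>\<^sup>+y. ennreal (C * c) * (ennreal (norm (y::'a) powr (- (?d - 1))) * indicator (ball 0 (\<bar>R\<bar> + norm x + 1)) y) \<partial>lborel)"
  proof (rule nn_integral_mono_AE, use AE_lborel_singleton[of "0::'a"] in eventually_elim)
    case (elim y)
    show ?case
    proof (cases "R \<le> norm (x - y)")
      case True
      then show ?thesis using supp by (simp add: F_def)
    next
      case False
      have "norm y < \<bar>R\<bar> + norm x + 1" using norm_triangle_ineq4[of x "x - y"] False by simp
      moreover have "(\<integral>\<^sup>+w. ennreal \<bar>F w y\<bar> \<partial>lborel) \<le> ennreal (C * c) * ennreal (norm y powr (- (?d - 1)))"
      proof -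
        have "(\<integral>\<^sup>+w. ennreal \<bar>F w y\<bar> \<partial>lborel) \<le> ennreal (C * norm (Du (x - y)) * norm y powr (- (?d - 1)))"
          unfolding F_def by (rule C(2)[OF elim])
        also have "\<dots> \<le> ennreal (C * c * norm y powr (- (?d - 1)))"
          using C(1) c by (intro ennreal_leI mult_right_mono mult_left_mono) auto
        finally show ?thesis using C(1) c0 by (simp add: ennreal_mult)
      qed
      ultimately show ?thesis by simp
    qed
  qed
  also have "\<dots> < \<infinity>"
  proof -
    have "(\<integral>\<^sup>+y. ennreal (norm (y::'a) powr (- (?d - 1))) * indicator (ball 0 (\<bar>R\<bar> + norm x + 1)) y \<partial>lborel) < \<infinity>"
      using d by (intro nn_integral_powr_inside) (auto intro: add_nonneg_pos)
    moreover have [measurable]: "ball (0::'a) (\<bar>R\<bar> + norm x + 1) \<in> sets borel" by simp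
    ultimately show ?thesis by (subst nn_integral_cmult) (auto simp: ennreal_mult_less_top)
  qed
  finally have fin: "(\<integral>\<^sup>+w. \<integral>\<^sup>+y. ennreal \<bar>F w y\<bar> \<partial>lborel \<partial>lborel) < \<infinity>" .
  have "integrable lborel (\<lambda>w. (DV (x - w) \<bullet> w) * norm w powr (- (?d + s)))"
    using Fubini_abs(2)[OF Fm fin] unfolding F_y .
  then show "(\<integral>\<^sup>+w. ennreal \<bar>(DV (x - w) \<bullet> w) * norm w powr (- (?d + s))\<bar> \<partial>lborel) < \<infinity>"
    unfolding integrable_iff_bounded by simp
  have "(\<integral>w. (DV (x - w) \<bullet> w) * norm w powr (- (?d + s)) \<partial>lborel) = (\<integral>y. \<integral>w. F w y \<partial>lborel \<partial>lborel)"
    using Fubini_abs(1)[OF Fm fin] unfolding F_y .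
  also have "\<dots> = (\<integral>y. (Du (x - y) \<bullet> y) * inv_weight s y \<partial>lborel)"
  proof (rule integral_cong_AE)
    show "AE y in lborel. (\<integral>w. F w y \<partial>lborel) = (Du (x - y) \<bullet> y) * inv_weight s y"
      unfolding F_def
      by (rule eventually_mono[OF AE_lborel_singleton[of "0::'a"]]) (rule integral_inv_kernel[OF s dim])
    show "(\<lambda>y. \<integral>w. F w y \<partial>lborel) \<in> borel_measurable lborel"
      by (rule lborel.borel_measurable_lebesgue_integral) (unfold F_def split_beta', measurable)
  qed measurable
  finally show "(\<integral>w. (DV (x - w) \<bullet> w) * norm w powr (- (?d + s)) \<partial>lborel)
      = (\<integral>y. (Du (x - y) \<bullet> y) * inv_weight s y \<partial>lborel)" .
qed

text \<open>The proof gives an exact formula for \<open>u x\<close>. Only the resulting bound by a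
  nonnegative integral is kept, since it can be multiplied, integrated and exchanged without
  questions of integrability.\<close>

lemma riesz_inversion_bound:
  fixes s :: real
  assumes s: "0 < s" "s < 1" and dim: "DIM('a::euclidean_space) \<ge> 2"
  defines "d \<equiv> real DIM('a)"
  shows "\<exists>C>0. \<forall>(u :: 'a \<Rightarrow> real) Du R x.
    (\<forall>x. (u has_derivative (\<lambda>h. Du x \<bullet> h)) (at x)) \<longrightarrow> continuous_on UNIV Du \<longrightarrow>
    (\<forall>y. R \<le> norm y \<longrightarrow> u y = 0 \<and> Du y = 0) \<longrightarrow>
    ennreal \<bar>u x\<bar> \<le> ennreal C * (\<integral>\<^sup>+z. ennreal (norm z powr (- (d + s)) * \<bar>riesz_conv (d - s) u x - riesz_conv (d - s) u (x - z)\<bar>) \<partial>lborel)"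
proof -
  have d: "d \<ge> 2" using dim by (simp add: d_def)
  \<comment> \<open>The angular part of the weight, homogeneous of degree 0, as
    \<open>integral_gradient_radial\<close> requires.\<close>
  define \<Theta> :: "'a \<Rightarrow> real" where "\<Theta> = (\<lambda>y. norm y powr d * inv_weight s y)"
  have [measurable]: "\<Theta> \<in> borel_measurable borel" unfolding \<Theta>_def by measurable
  obtain C where C: "C \<ge> 0" "\<And>y::'a. \<bar>inv_weight s y\<bar> \<le> C * norm y powr (- d)"
    using inv_weight_bound[OF s dim] unfolding d_def by blast
  have \<Theta>1: "\<bar>\<Theta> y\<bar> \<le> C" for y
  proof (cases "y = 0")
    case False
    have "\<bar>\<Theta> y\<bar> \<le> norm y powr d * (C * norm y powr (- d))"
      unfolding \<Theta>_def abs_mult by (simp add: mult_left_mono C)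
    also have "\<dots> = C" using False by (simp add: powr_minus)
    finally show ?thesis .
  qed (simp add: \<Theta>_def C)
  have \<Theta>2: "\<Theta> (t *\<^sub>R y) = \<Theta> y" if "0 < t" for t y
    using that by (simp add: \<Theta>_def inv_weight_scaleR d_def powr_mult powr_minus)
  \<comment> \<open>Also true at \<open>y = 0\<close>, where the power of 0 and the division in
    \<open>inv_weight\<close> both give 0.\<close>
  have \<Theta>w: "norm y powr (- d) * \<Theta> y = inv_weight s y" for y
    using d by (cases "y = 0") (auto simp: \<Theta>_def powr_minus inv_weight_def)
  \<comment> \<open>The integral of \<open>inv_weight s\<close> over the unit sphere, expressed by
    the ball.\<close>
  define c0 where "c0 = d * (\<integral>\<eta>. \<Theta> \<eta> * indicator (ball 0 1) \<eta> \<partial>lborel)"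
  have nn: "0 \<le> \<Theta> \<eta> * indicator (ball 0 1) \<eta>" for \<eta>
    using inv_weight_pos[OF s dim, of \<eta>] by (cases "\<eta> = 0") (auto simp: \<Theta>_def)
  have [measurable]: "(\<lambda>y. indicator (ball (0::'a) 1) y :: real) \<in> borel_measurable borel"
    by (intro borel_measurable_indicator) simp
  have "integrable lborel (\<lambda>\<eta>::'a. C * indicator (ball 0 1) \<eta>)"
    using emeasure_lborel_ball_finite[of "0::'a" 1] by (intro integrable_mult_right integrable_real_indicator) auto
  then have int: "integrable lborel (\<lambda>\<eta>. \<Theta> \<eta> * indicator (ball 0 1) \<eta>)"
    by (rule Bochner_Integration.integrable_bound)
       (use \<Theta>1 C(1) in \<open>auto intro!: AE_I2 simp: abs_mult split: split_indicator\<close>)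
  have "(\<integral>\<eta>. \<Theta> \<eta> * indicator (ball 0 1) \<eta> \<partial>lborel) \<noteq> 0"
  proof
    assume "(\<integral>\<eta>. \<Theta> \<eta> * indicator (ball 0 1) \<eta> \<partial>lborel) = 0"
    then have "AE \<eta> in lborel. \<Theta> \<eta> * indicator (ball 0 1) \<eta> = 0"
      using integral_nonneg_eq_0_iff_AE[OF int] nn by simp
    then have "AE \<eta> in lborel. \<eta> \<notin> ball (0::'a) 1"
      using AE_lborel_singleton[of "0::'a"]
    proof eventually_elim
      case (elim \<eta>)
      then show ?case using inv_weight_pos[OF s dim, of \<eta>] by (auto simp: \<Theta>_def)
    qed
    then have "ball (0::'a) 1 \<in> null_sets lborel"
      using AE_iff_null_sets[of "ball (0::'a) 1" lborel] by simp
    then have "emeasure lborel (ball (0::'a) 1) = 0" by auto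
    moreover have "emeasure lborel (ball (0::'a) 1) = ennreal (unit_ball_vol (real DIM('a)))"
      using emeasure_ball[of 1 "0::'a"] by simp
    moreover have "unit_ball_vol (real DIM('a)) > 0" by (rule unit_ball_vol_pos) simp
    ultimately show False by (simp add: ennreal_eq_0_iff)
  qed
  moreover have "(\<integral>\<eta>. \<Theta> \<eta> * indicator (ball 0 1) \<eta> \<partial>lborel) \<ge> 0"
    by (rule integral_nonneg_AE, rule AE_I2, rule nn)
  ultimately have c0: "c0 > 0" using d by (simp add: c0_def)
  show ?thesis
  proof (rule exI[of _ "s / c0"], intro conjI allI impI)
    show "s / c0 > 0" using s c0 by simp
    fix u :: "'a \<Rightarrow> real" and Du R x
    assume deriv: "\<forall>x. (u has_derivative (\<lambda>h. Du x \<bullet> h)) (at x)" and cont: "continuous_on UNIV Du"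
      and supp: "\<forall>y. R \<le> norm y \<longrightarrow> u y = 0 \<and> Du y = 0"
    define V where "V = riesz_conv (d - s) u"
    define DV where "DV = riesz_conv (d - s) Du"
    have a: "0 < d - s" "d - s < real DIM('a)" using d s by (auto simp: d_def)
    have V: "(V has_derivative (\<lambda>h. DV x \<bullet> h)) (at x)" for x
      unfolding V_def DV_def using deriv supp by (intro has_derivative_riesz_conv[OF a _ cont, of u R]) auto
    have DVc: "continuous_on UNIV DV"
      unfolding DV_def using supp by (intro continuous_riesz_conv[OF a cont, of R]) auto
    have supp': "\<And>y. R \<le> norm y \<Longrightarrow> Du y = 0" using supp by blast
    note fin = riesz_conv_gradient_pairing(1)[OF s dim cont supp', of R x, folded d_def, folded DV_def]
    note id = integral_difference_kernel[OF s(1) V DVc, of x, folded d_def, OF fin]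
    have "s * (\<integral>z. (V x - V (x - z)) * norm z powr (- (d + s)) \<partial>lborel) = (\<integral>y. (Du (x - y) \<bullet> y) * inv_weight s y \<partial>lborel)"
      by (rule trans[OF id(2) riesz_conv_gradient_pairing(2)[OF s dim cont supp', of R x, folded d_def, folded DV_def]])
    also have "\<dots> = (\<integral>y. (Du (x - y) \<bullet> y) * (norm y powr (- real DIM('a)) * \<Theta> y) \<partial>lborel)"
      by (simp only: \<Theta>w[unfolded d_def])
    also have "\<dots> = u x * c0"
      unfolding c0_def d_def
      by (rule integral_gradient_radial[OF dim _ cont, where R=R and C=C]) (use deriv supp \<Theta>1 \<Theta>2 in auto)
    finally have ux: "u x = (s / c0) * (\<integral>z. (V x - V (x - z)) * norm z powr (- (d + s)) \<partial>lborel)"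
      using c0 by (simp add: field_simps)
    have "ennreal \<bar>u x\<bar> = ennreal (s / c0) * ennreal \<bar>\<integral>z. (V x - V (x - z)) * norm z powr (- (d + s)) \<partial>lborel\<bar>"
      unfolding ux using s c0 by (simp add: abs_mult ennreal_mult[symmetric])
    also have "\<dots> \<le> ennreal (s / c0) * (\<integral>\<^sup>+z. ennreal (norm ((V x - V (x - z)) * norm z powr (- (d + s)))) \<partial>lborel)"
      unfolding real_norm_def[symmetric] by (rule mult_left_mono[OF integral_norm_bound_ennreal[OF id(1)] zero_le])
    also have "(\<integral>\<^sup>+z. ennreal (norm ((V x - V (x - z)) * norm z powr (- (d + s)))) \<partial>lborel)
      = (\<integral>\<^sup>+z. ennreal (norm z powr (- (d + s)) * \<bar>V x - V (x - z)\<bar>) \<partial>lborel)"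
      by (intro nn_integral_cong) (simp add: abs_mult mult.commute)
    finally show "ennreal \<bar>u x\<bar> \<le> ennreal (s / c0) * (\<integral>\<^sup>+z. ennreal (norm z powr (- (d + s)) * \<bar>riesz_conv (d - s) u x - riesz_conv (d - s) u (x - z)\<bar>) \<partial>lborel)"
      by (simp only: V_def)
  qed
qed

section \<open>The estimate\<close>

lemma gradient_eqI:
  fixes f :: "'a::real_inner \<Rightarrow> real"
  assumes "(f has_derivative (\<lambda>h. D \<bullet> h)) (at x)"
  shows "gradient f x = D"
proof -
  have D: "GDERIV f x :> D" using assms by (simp add: gderiv_def inner_commute)
  have uniq: "E = D" if "GDERIV f x :> E" for E
  proof -
    have "(\<lambda>h. h \<bullet> E) = (\<lambda>h. h \<bullet> D)"
      using that D unfolding gderiv_def by (rule has_derivative_unique)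
    then have "(E - D) \<bullet> E = (E - D) \<bullet> D" by metis
    then show ?thesis by (metis eq_iff_diff_eq_0 inner_diff_right inner_eq_zero_iff)
  qed
  show ?thesis unfolding gradient_def using D uniq by (rule the_equality)
qed

lemma riesz_const_pos:
  assumes "0 < \<beta>" "\<beta> < real N"
  shows "0 < riesz_const N \<beta>"
  unfolding riesz_const_def using assms by (intro divide_pos_pos mult_pos_pos Gamma_real_pos) auto

lemma riesz_potential_eq_conv:
  fixes u :: "real ^ 'n::finite \<Rightarrow> real"
  shows "riesz_potential \<beta> u x = 1 / riesz_const CARD('n) \<beta> * riesz_conv (real CARD('n) - \<beta>) u x"
proof -
  have "(\<integral>y. u y / norm (x - y) powr (real CARD('n) - \<beta>) \<partial>lborel)
    = (\<integral>z. u (x - z) / norm (x - (x - z)) powr (real CARD('n) - \<beta>) \<partial>lborel)"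
    by (rule integral_lborel_reflect[symmetric])
  also have "\<dots> = riesz_conv (real CARD('n) - \<beta>) u x"
    unfolding riesz_conv_def
    by (rule Bochner_Integration.integral_cong[OF refl]) (simp add: powr_minus_divide del: minus_diff_eq)
  finally show ?thesis by (simp add: riesz_potential_def)
qed

lemma test_functions_gradient:
  fixes u :: "'a::euclidean_space \<Rightarrow> real"
  assumes u: "u \<in> test_functions"
  obtains Du R where "\<And>x. (u has_derivative (\<lambda>h. Du x \<bullet> h)) (at x)" "continuous_on UNIV Du"
    "0 < R" "\<And>y. R \<le> norm y \<Longrightarrow> u y = 0" "\<And>y. R \<le> norm y \<Longrightarrow> Du y = 0"
proof -
  let ?D = "\<lambda>x. frechet_derivative u (at x)"
  \<comment> \<open>The coordinates are directional derivatives, whose continuity is what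
    \<open>Ck (Suc 0)\<close> provides.\<close>
  define Du where "Du = (\<lambda>x. \<Sum>i\<in>Basis. ?D x i *\<^sub>R i)"
  have "Ck (Suc 0) u" using u unfolding test_functions_def by blast
  then have diff: "u differentiable (at x)" and cont: "continuous_on UNIV (\<lambda>x. ?D x v)" for x v by auto
  have D: "(u has_derivative ?D x) (at x)" for x using diff frechet_derivative_works by blast
  have DDu: "?D x = (\<lambda>h. Du x \<bullet> h)" for x
  proof
    fix h
    interpret bounded_linear "?D x" using D by (rule has_derivative_bounded_linear)
    have "?D x h = ?D x (\<Sum>i\<in>Basis. (h \<bullet> i) *\<^sub>R i)" by (simp add: euclidean_representation)
    also have "\<dots> = Du x \<bullet> h"
      by (simp add: sum scaleR Du_def inner_sum_left) (simp add: inner_commute mult.commute)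
    finally show "?D x h = Du x \<bullet> h" .
  qed
  have "bounded (closure {x. u x \<noteq> 0})" using u by (auto simp: test_functions_def compact_imp_bounded)
  then obtain r where r: "\<And>x. u x \<noteq> 0 \<Longrightarrow> norm x \<le> r"
    unfolding bounded_iff using closure_subset[of "{x. u x \<noteq> 0}"] by blast
  have Du0: "Du y = 0" if "r < norm y" for y
  proof -
    have "open {x::'a. r < norm x}" by (intro open_Collect_less continuous_intros)
    then have "(u has_derivative (\<lambda>h. 0)) (at y)"
    proof (rule has_derivative_transform_within_open[OF has_derivative_const[of 0]])
      show "y \<in> {x. r < norm x}" using that by simp
      show "0 = u x" if "x \<in> {x. r < norm x}" for x using r[of x] that by force
    qed
    then have "?D y = (\<lambda>h. 0)" using D has_derivative_unique by blast
    then show ?thesis by (simp add: Du_def)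
  qed
  show thesis
  \<comment> \<open>The margin 1 puts \<open>y\<close> into the open set on which \<open>u\<close>
    vanishes, so that the derivative is 0 as well; the absolute value makes the radius
    positive.\<close>
  proof (rule that[of Du "\<bar>r\<bar> + 1"])
    show "(u has_derivative (\<lambda>h. Du x \<bullet> h)) (at x)" for x using D[of x] unfolding DDu .
    show "continuous_on UNIV Du" unfolding Du_def by (intro continuous_intros cont)
    show "u y = 0" if "\<bar>r\<bar> + 1 \<le> norm y" for y using r[of y] that by force
    show "Du y = 0" if "\<bar>r\<bar> + 1 \<le> norm y" for y using Du0[of y] that by simp
  qed simp
qed

text \<open>By the decay, the set above \<open>l\<close> lies in a ball of radius
  \<open>R + (K / l) powr (1/a)\<close>. For small \<open>l\<close> the scaled volume is thus of
  order at most \<open>l powr (1 - (d - 1) / a)\<close>, with \<open>d\<close> the dimension, and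
  \<open>d - 1 < a\<close> keeps it bounded. This supplies the a priori bound for the
  absorption.\<close>

lemma superlevel_weak_bound:
  fixes f :: "'a::euclidean_space \<Rightarrow> real"
  assumes dim: "DIM('a) \<ge> 2" and a: "real DIM('a) - 1 < a" and R: "0 < R" and K: "0 \<le> K"
    and decay: "\<And>x. R \<le> norm x \<Longrightarrow> f x \<le> K * norm x powr (- a)"
  shows "\<exists>B. \<forall>l. 0 < l \<longrightarrow> l \<le> M \<longrightarrow> emeasure lborel {x. l < f x} < \<infinity> \<and>
    l * measure lborel {x. l < f x} powr (1 - 1 / real DIM('a)) \<le> B"
proof -
  let ?d = "real DIM('a)" and ?\<omega> = "unit_ball_vol (real DIM('a))"
  have d: "?d \<ge> 2" using dim by simp
  \<comment> \<open>The estimate evaluated at \<open>l = M\<close>. Moving \<open>l\<close> inside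
    the power \<open>d - 1\<close> gives two terms with the exponents \<open>1 / (d - 1)\<close> and
    \<open>1 / (d - 1) - 1/a\<close> of \<open>l\<close>, both nonnegative, so the largest level is
    the worst.\<close>
  define B where "B = ?\<omega> powr (1 - 1/?d) * (R * M powr (1 / (?d - 1)) + K powr (1/a) * M powr (1 / (?d - 1) - 1/a)) powr (?d - 1)"
  show ?thesis
  proof (intro exI[of _ B] allI impI)
    fix l :: real assume l: "0 < l" "l \<le> M"
    define \<rho> where "\<rho> = R + (K / l) powr (1/a)"
    have \<rho>: "\<rho> > 0" using R by (simp add: \<rho>_def add_pos_nonneg)
    have "norm x < \<rho>" if "l < f x" for x
    proof (cases "R \<le> norm x")
      case True
      then have x: "norm x > 0" using R by linarith
      have "l < K * norm x powr (- a)" using decay[OF True] that by linarith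
      then have "norm x powr a < K / l" using x l by (simp add: powr_minus field_simps)
      then have "(norm x powr a) powr (1/a) < (K / l) powr (1/a)"
        using a d by (intro powr_less_mono2) auto
      then have "norm x < (K / l) powr (1/a)" using x a d by (simp add: powr_powr)
      then show ?thesis using R by (simp add: \<rho>_def)
    next
      case False
      moreover have "0 \<le> (K / l) powr (1/a)" by simp
      ultimately show ?thesis unfolding \<rho>_def by linarith
    qed
    then have sub: "{x. l < f x} \<subseteq> ball 0 \<rho>" by auto
    have le: "emeasure lborel {x. l < f x} \<le> ennreal (?\<omega> * \<rho> ^ DIM('a))"
      using emeasure_mono[OF sub, of lborel] emeasure_lborel_ball[of \<rho> "0::'a"] \<rho> by simp
    show "emeasure lborel {x. l < f x} < \<infinity> \<and> l * measure lborel {x. l < f x} powr (1 - 1 / ?d) \<le> B"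
    proof
      show "emeasure lborel {x. l < f x} < \<infinity>" using le by (rule le_less_trans) simp
      have "measure lborel {x. l < f x} \<le> ?\<omega> * \<rho> ^ DIM('a)"
        unfolding measure_def using le \<rho> by (intro enn2real_leI) auto
      then have "measure lborel {x. l < f x} powr (1 - 1 / ?d) \<le> (?\<omega> * \<rho> powr ?d) powr (1 - 1 / ?d)"
        using d \<rho> by (intro powr_mono2) (auto simp: powr_realpow)
      also have "\<dots> = ?\<omega> powr (1 - 1/?d) * \<rho> powr (?d - 1)"
      proof -
        have "?d * (1 - 1/?d) = ?d - 1" using d by (simp add: field_simps)
        then show ?thesis by (simp add: powr_mult powr_powr)
      qed
      finally have "l * measure lborel {x. l < f x} powr (1 - 1 / ?d) \<le> l * (?\<omega> powr (1 - 1/?d) * \<rho> powr (?d - 1))"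
        using l by (intro mult_left_mono) auto
      also have "\<dots> = ?\<omega> powr (1 - 1/?d) * (l * \<rho> powr (?d - 1))" by simp
      also have "l * \<rho> powr (?d - 1) = (l powr (1 / (?d - 1)) * \<rho>) powr (?d - 1)"
        using l d \<rho> by (simp add: powr_mult powr_powr)
      also have "l powr (1 / (?d - 1)) * \<rho> = R * l powr (1 / (?d - 1)) + K powr (1/a) * l powr (1 / (?d - 1) - 1/a)"
        using l K by (simp add: \<rho>_def powr_divide powr_diff field_simps)
      also have "?\<omega> powr (1 - 1/?d) * (R * l powr (1 / (?d - 1)) + K powr (1/a) * l powr (1 / (?d - 1) - 1/a)) powr (?d - 1) \<le> B"
      proof -
        have "1/a \<le> 1 / (?d - 1)" using a d by (intro divide_left_mono) auto
        then show ?thesis unfolding B_def using l R d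
          by (intro mult_left_mono powr_mono2 add_mono) auto
      qed
      finally show "l * measure lborel {x. l < f x} powr (1 - 1 / ?d) \<le> B" .
    qed
  qed
qed

lemma abs_diff_le_positive_parts:
  fixes a b :: real
  shows "\<bar>a - b\<bar> \<le> \<bar>max 0 a - max 0 b\<bar> + \<bar>max 0 (- a) - max 0 (- b)\<bar>"
  by (auto simp: max_def)

theorem mainTheorem2:
  fixes \<alpha> :: real
  assumes "CARD('n::finite) \<ge> 2" and "0 < \<alpha>" and "\<alpha> < 1"
  shows "\<exists>C>0. \<forall>u \<in> (test_functions :: (real ^ 'n \<Rightarrow> real) set).
           Lp_norm (real CARD('n) / (real CARD('n) - \<alpha>)) u
             \<le> ennreal C * Lp_norm 1 (riesz_gradient \<alpha> u)"
proof -
  define s where "s = 1 - \<alpha>"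
  have s: "0 < s" "s < 1" using assms by (auto simp: s_def)
  define d where "d = real CARD('n)"
  have dd: "d = real DIM(real ^ 'n)" by (simp add: d_def)
  have dim: "DIM(real ^ 'n) \<ge> 2" using assms by simp
  have d: "d \<ge> 2" using assms by (simp add: d_def)
  define p where "p = d / (d - 1 + s)"
  have p: "p = real CARD('n) / (real CARD('n) - \<alpha>)" by (simp add: p_def d_def s_def)
  have p1: "p > 1" using d s by (simp add: p_def field_simps)
  \<comment> \<open>The normalising factor by which the Riesz potential differs from
    \<open>riesz_conv\<close>.\<close>
  define \<kappa> where "\<kappa> = 1 / riesz_const CARD('n) s"
  have \<kappa>: "\<kappa> > 0" using riesz_const_pos[of s "CARD('n)"] s d by (simp add: \<kappa>_def d_def)
  obtain C1 where C1: "C1 > 0" "\<forall>(u :: real ^ 'n \<Rightarrow> real) Du R x.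
    (\<forall>x. (u has_derivative (\<lambda>h. Du x \<bullet> h)) (at x)) \<longrightarrow> continuous_on UNIV Du \<longrightarrow>
    (\<forall>y. R \<le> norm y \<longrightarrow> u y = 0 \<and> Du y = 0) \<longrightarrow>
    ennreal \<bar>u x\<bar> \<le> ennreal C1 * (\<integral>\<^sup>+z. ennreal (norm z powr (- (d + s)) * \<bar>riesz_conv (d - s) u x - riesz_conv (d - s) u (x - z)\<bar>) \<partial>lborel)"
    by (rule exE[OF riesz_inversion_bound[OF s dim, folded dd]], erule conjE, rule that)
  obtain C2 where C2: "C2 > 0" "\<forall>(f :: real ^ 'n \<Rightarrow> real) Df w M B A m.
    (\<forall>x. (f has_derivative (\<lambda>h. Df x \<bullet> h)) (at x)) \<longrightarrow> continuous_on UNIV Df \<longrightarrow>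
    w \<in> borel_measurable borel \<longrightarrow> (\<forall>x. 0 \<le> w x) \<longrightarrow> 0 < M \<longrightarrow> (\<forall>x. f x \<le> M) \<longrightarrow>
    (\<forall>l. 0 < l \<longrightarrow> l \<le> M \<longrightarrow> emeasure lborel {x. l < f x} < \<infinity> \<and> l * measure lborel {x. l < f x} powr (1 - 1/d) \<le> B) \<longrightarrow>
    (\<integral>\<^sup>+x. ennreal (norm (Df x)) \<partial>lborel) \<le> ennreal m \<longrightarrow> 0 \<le> m \<longrightarrow>
    (\<integral>\<^sup>+x. ennreal (w x powr p) \<partial>lborel) \<le> ennreal A \<longrightarrow> 0 < A \<longrightarrow>
    (\<integral>\<^sup>+z. \<integral>\<^sup>+x. ennreal (norm z powr (- (d + s)) * (w x powr (p - 1) * \<bar>max 0 (f x) - max 0 (f (x - z))\<bar>)) \<partial>lborel \<partial>lborel)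
      \<le> ennreal (C2 * A powr (1 - 1/p) * m)"
    by (rule exE[OF positive_part_pairing[OF s dim, folded dd, folded p_def]], erule conjE, rule that)
  \<comment> \<open>\<open>C1\<close> belongs to the potential without normalisation, hence the
    division by \<open>\<kappa>\<close>; the 2 counts the positive and the negative part.\<close>
  define C where "C = C1 / \<kappa> * (2 * C2)"
  have C: "C > 0" using C1(1) C2(1) \<kappa> by (simp add: C_def)
  show ?thesis
  proof (intro exI[of _ C] conjI ballI)
    fix u :: "real ^ 'n \<Rightarrow> real" assume u: "u \<in> test_functions"
    obtain Du R where deriv: "\<And>x. (u has_derivative (\<lambda>h. Du x \<bullet> h)) (at x)" and cont: "continuous_on UNIV Du"
      and R: "0 < R" and supp: "\<And>y. R \<le> norm y \<Longrightarrow> u y = 0" "\<And>y. R \<le> norm y \<Longrightarrow> Du y = 0"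
      using test_functions_gradient[OF u] by blast
    have uc: "continuous_on UNIV u" using deriv by (meson continuous_at_imp_continuous_on has_derivative_continuous)
    have um[measurable]: "u \<in> borel_measurable borel" using uc by (rule borel_measurable_continuous_onI)
    have a: "0 < d - s" "d - s < real DIM(real ^ 'n)" using d s by (auto simp: d_def)
    define V where "V = riesz_conv (d - s) u"
    define v where "v = (\<lambda>x. \<kappa> * V x)"
    define Dv where "Dv = (\<lambda>x. \<kappa> *\<^sub>R riesz_conv (d - s) Du x)"
    have v_eq: "riesz_potential s u = v"
      by (rule ext) (simp add: riesz_potential_eq_conv v_def V_def \<kappa>_def d_def)
    have v_deriv: "(v has_derivative (\<lambda>h. Dv x \<bullet> h)) (at x)" for x
      using has_derivative_mult_right[OF has_derivative_riesz_conv[OF a deriv cont supp, where x=x], where x="\<kappa>"]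
      by (simp add: v_def V_def Dv_def)
    have Dv_cont: "continuous_on UNIV Dv"
      unfolding Dv_def by (intro continuous_intros continuous_riesz_conv[OF a cont supp(2)])
    have grad: "riesz_gradient \<alpha> u = Dv"
      unfolding riesz_gradient_def s_def[symmetric] v_eq by (rule ext) (rule gradient_eqI[OF v_deriv])
    have vc: "continuous_on UNIV v" using v_deriv by (meson continuous_at_imp_continuous_on has_derivative_continuous)
    have [measurable]: "v \<in> borel_measurable borel" "Dv \<in> borel_measurable borel"
      using vc Dv_cont by (auto intro: borel_measurable_continuous_onI)
    let ?I = "\<integral>\<^sup>+x. ennreal (norm (Dv x)) \<partial>lborel" and ?J = "\<integral>\<^sup>+x. ennreal (\<bar>u x\<bar> powr p) \<partial>lborel"
    have norm1: "Lp_norm 1 Dv = ?I"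
      by (cases "?I = \<infinity>") (simp_all add: Lp_norm_def Let_def less_top)
    obtain c where c: "\<And>x. norm (u x) \<le> c" using bounded_compact_support[OF uc supp(1)] by blast
    have "?J \<le> (\<integral>\<^sup>+x. ennreal (c powr p) * indicator (cball 0 R) (x :: real ^ 'n) \<partial>lborel)"
    proof (rule nn_integral_mono)
      fix x :: "real ^ 'n"
      show "ennreal (\<bar>u x\<bar> powr p) \<le> ennreal (c powr p) * indicator (cball 0 R) x"
        using c[of x] supp(1)[of x] p1 by (cases "norm x \<le> R") (auto intro!: ennreal_leI powr_mono2)
    qed
    also have "\<dots> < \<infinity>"
      using emeasure_lborel_cball_finite[of "0 :: real ^ 'n" R] by (subst nn_integral_cmult_indicator) (auto simp: ennreal_mult_less_top)
    \<comment> \<open>Finiteness comes from the compact support of \<open>u\<close>; the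
      cancellation at the end depends on it.\<close>
    finally have Jfin: "?J < \<infinity>" .
    define A where "A = enn2real ?J"
    have A: "?J = ennreal A" "A \<ge> 0" using Jfin by (auto simp: A_def)
    have normp: "Lp_norm p u = ennreal (A powr (1/p))"
      using Jfin by (simp add: Lp_norm_def Let_def A_def)
    show "Lp_norm (real CARD('n) / (real CARD('n) - \<alpha>)) u \<le> ennreal C * Lp_norm 1 (riesz_gradient \<alpha> u)"
      unfolding p[symmetric] grad normp norm1
    \<comment> \<open>Both cases are trivial, and both must be set apart: \<open>m\<close> below is
      a real number, and a power of \<open>A\<close> is cancelled.\<close>
    proof (cases "?I = \<infinity> \<or> A = 0")
      case True
      then show "ennreal (A powr (1/p)) \<le> ennreal C * ?I"
        using C by (auto simp: ennreal_mult_top)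
    next
      case False
      define m where "m = enn2real ?I"
      have m: "?I = ennreal m" "m \<ge> 0" using False by (auto simp: m_def less_top)
      have A0: "A > 0" using False A by simp
      define K where "K = 2 powr (d - s) * (\<integral>y. \<bar>u y\<bar> \<partial>lborel) * \<kappa>"
      have K: "K \<ge> 0" using \<kappa> by (simp add: K_def integral_nonneg_AE)
      have decay: "\<bar>v x\<bar> \<le> K * norm x powr (- (d - s))" if "2 * R \<le> norm x" for x
        using mult_left_mono[OF riesz_conv_decay[OF a(1) uc R supp(1) that], of \<kappa>] \<kappa>
        by (simp add: v_def V_def K_def abs_mult ac_simps)
      \<comment> \<open>Compactness bounds \<open>v\<close> on the ball of radius
        \<open>2 * R\<close>, and the decay bounds it outside.\<close>
      obtain M where M: "M > 0" "\<And>x. \<bar>v x\<bar> \<le> M"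
      proof -
        have "compact (v ` cball 0 (2 * R))"
          using vc by (intro compact_continuous_image) (auto intro: continuous_on_subset)
        then have "bounded (v ` cball 0 (2 * R))" by (rule compact_imp_bounded)
        then obtain M where M0: "M > 0" "\<forall>y \<in> v ` cball 0 (2 * R). norm y \<le> M"
          unfolding bounded_pos by (elim exE conjE) (rule that)
        then have M: "M > 0" "\<And>x. norm x \<le> 2 * R \<Longrightarrow> \<bar>v x\<bar> \<le> M" by auto
        have "\<bar>v x\<bar> \<le> M + K * (2 * R) powr (- (d - s))" for x
        proof (cases "norm x \<le> 2 * R")
          case True
          then show ?thesis using M K by (simp add: add_increasing2)
        next
          case False
          then have "\<bar>v x\<bar> \<le> K * norm x powr (- (d - s))" by (intro decay) simp
          also have "\<dots> \<le> K * (2 * R) powr (- (d - s))"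
            using False R a K by (intro mult_left_mono powr_mono2') auto
          finally show ?thesis using M by simp
        qed
        then show thesis using M(1) K by (intro that[of "M + K * (2 * R) powr (- (d - s))"]) (auto simp: add_pos_nonneg)
      qed
      \<comment> \<open>The pairing of \<open>positive_part_pairing\<close> with weight
        \<open>\<bar>u\<bar>\<close>; it is applied to \<open>v\<close> and to
        \<open>- v\<close>.\<close>
      define Q where "Q = (\<lambda>f. \<integral>\<^sup>+z. \<integral>\<^sup>+x. ennreal (norm z powr (- (d + s)) * (\<bar>u x\<bar> powr (p - 1) * \<bar>max 0 (f x) - max 0 (f (x - z))\<bar>)) \<partial>lborel \<partial>lborel)"
      have level: "\<exists>B. \<forall>l. 0 < l \<longrightarrow> l \<le> M \<longrightarrow> emeasure lborel {x. l < f x} < \<infinity> \<and> l * measure lborel {x. l < f x} powr (1 - 1/d) \<le> B"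
        if "\<And>x. \<bar>f x\<bar> = \<bar>v x\<bar>" for f :: "real ^ 'n \<Rightarrow> real"
        unfolding dd
      proof (rule superlevel_weak_bound[OF dim, of "d - s" "2 * R" K])
        show "f x \<le> K * norm x powr (- (d - s))" if "2 * R \<le> norm x" for x
          using decay[OF that] \<open>\<And>x. \<bar>f x\<bar> = \<bar>v x\<bar>\<close>[of x] by linarith
      qed (use s R K in \<open>auto simp: d_def\<close>)
      have Qv: "Q v \<le> ennreal (C2 * A powr (1 - 1/p) * m)"
      proof -
        obtain B where "\<forall>l. 0 < l \<longrightarrow> l \<le> M \<longrightarrow> emeasure lborel {x. l < v x} < \<infinity> \<and> l * measure lborel {x. l < v x} powr (1 - 1/d) \<le> B"
          using level[of v] by blast
        then show ?thesis
          unfolding Q_def using M A m A0 v_deriv Dv_cont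
          by (intro C2(2)[THEN spec, of "v", THEN spec, of "Dv", THEN spec, of "\<lambda>x. \<bar>u x\<bar>", THEN spec, of M, THEN spec, of B, THEN spec, of A, THEN spec, of m, rule_format])
             (auto intro: order_trans[OF abs_ge_self])
      qed
      have Qmv: "Q (\<lambda>x. - v x) \<le> ennreal (C2 * A powr (1 - 1/p) * m)"
      proof -
        obtain B where B: "\<forall>l. 0 < l \<longrightarrow> l \<le> M \<longrightarrow> emeasure lborel {x. l < - v x} < \<infinity> \<and> l * measure lborel {x. l < - v x} powr (1 - 1/d) \<le> B"
          using level[of "\<lambda>x. - v x"] by auto
        have "((\<lambda>x. - v x) has_derivative (\<lambda>h. (- Dv x) \<bullet> h)) (at x)" for x
          using has_derivative_minus[OF v_deriv] by simp
        moreover have "continuous_on UNIV (\<lambda>x. - Dv x)" by (intro continuous_intros Dv_cont)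
        ultimately show ?thesis
          unfolding Q_def using M A m A0 B
          by (intro C2(2)[THEN spec, of "\<lambda>x. - v x", THEN spec, of "\<lambda>x. - Dv x", THEN spec, of "\<lambda>x. \<bar>u x\<bar>", THEN spec, of M, THEN spec, of B, THEN spec, of A, THEN spec, of m, rule_format])
             (auto intro: order_trans[OF abs_ge_minus_self] simp del: inner_minus_left)
      qed
      \<comment> \<open>Duality: one factor \<open>\<bar>u x\<bar>\<close> is split off and
        estimated by the inversion formula, while the remaining power acts as the weight.\<close>
      have "ennreal A = (\<integral>\<^sup>+x. ennreal (\<bar>u x\<bar> powr (p - 1)) * ennreal \<bar>u x\<bar> \<partial>lborel)"
        unfolding A(1)[symmetric]
      proof (rule nn_integral_cong)
        fix x
        have "\<bar>u x\<bar> powr p = \<bar>u x\<bar> powr (p - 1) * \<bar>u x\<bar>"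
          by (cases "u x = 0") (auto simp: powr_diff)
        then show "ennreal (\<bar>u x\<bar> powr p) = ennreal (\<bar>u x\<bar> powr (p - 1)) * ennreal \<bar>u x\<bar>"
          by (simp add: ennreal_mult)
      qed
      also have "\<dots> \<le> (\<integral>\<^sup>+x. \<integral>\<^sup>+z. ennreal (C1 / \<kappa>) *
          (ennreal (norm z powr (- (d + s)) * (\<bar>u x\<bar> powr (p - 1) * \<bar>max 0 (v x) - max 0 (v (x - z))\<bar>))
         + ennreal (norm z powr (- (d + s)) * (\<bar>u x\<bar> powr (p - 1) * \<bar>max 0 (- v x) - max 0 (- v (x - z))\<bar>))) \<partial>lborel \<partial>lborel)"
      proof (rule nn_integral_mono)
        fix x
        have [measurable]: "V \<in> borel_measurable borel"
          unfolding V_def by (intro borel_measurable_continuous_onI continuous_riesz_conv[OF a uc supp(1)])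
        have "ennreal (\<bar>u x\<bar> powr (p - 1)) * ennreal \<bar>u x\<bar>
          \<le> ennreal (\<bar>u x\<bar> powr (p - 1)) * (ennreal C1 * (\<integral>\<^sup>+z. ennreal (norm z powr (- (d + s)) * \<bar>V x - V (x - z)\<bar>) \<partial>lborel))"
          unfolding V_def by (intro mult_left_mono C1(2)[THEN spec, of u, THEN spec, of Du, THEN spec, of R, THEN spec, of x, rule_format]) (use deriv cont supp in auto)
        also have "\<dots> = (\<integral>\<^sup>+z. ennreal (\<bar>u x\<bar> powr (p - 1)) * (ennreal C1 * ennreal (norm z powr (- (d + s)) * \<bar>V x - V (x - z)\<bar>)) \<partial>lborel)"
          by (simp add: nn_integral_cmult)
        also have "\<dots> \<le> (\<integral>\<^sup>+z. ennreal (C1 / \<kappa>) *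
          (ennreal (norm z powr (- (d + s)) * (\<bar>u x\<bar> powr (p - 1) * \<bar>max 0 (v x) - max 0 (v (x - z))\<bar>))
         + ennreal (norm z powr (- (d + s)) * (\<bar>u x\<bar> powr (p - 1) * \<bar>max 0 (- v x) - max 0 (- v (x - z))\<bar>))) \<partial>lborel)"
        proof (rule nn_integral_mono)
          fix z :: "real ^ 'n"
          let ?k = "norm z powr (- (d + s)) * \<bar>u x\<bar> powr (p - 1)"
          have "\<bar>u x\<bar> powr (p - 1) * (C1 * (norm z powr (- (d + s)) * \<bar>V x - V (x - z)\<bar>))
            = C1 / \<kappa> * (?k * \<bar>v x - v (x - z)\<bar>)"
            using \<kappa> by (simp add: v_def right_diff_distrib[symmetric] abs_mult)
          also have "\<dots> \<le> C1 / \<kappa> * (?k * (\<bar>max 0 (v x) - max 0 (v (x - z))\<bar> + \<bar>max 0 (- v x) - max 0 (- v (x - z))\<bar>))"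
            using C1(1) \<kappa> by (intro mult_left_mono abs_diff_le_positive_parts) auto
          also have "\<dots> = C1 / \<kappa> * (norm z powr (- (d + s)) * (\<bar>u x\<bar> powr (p - 1) * \<bar>max 0 (v x) - max 0 (v (x - z))\<bar>)
            + norm z powr (- (d + s)) * (\<bar>u x\<bar> powr (p - 1) * \<bar>max 0 (- v x) - max 0 (- v (x - z))\<bar>))" (is "_ = C1 / \<kappa> * (?X + ?Y)")
            by (simp only: distrib_left mult.assoc)
          finally have "ennreal (\<bar>u x\<bar> powr (p - 1) * (C1 * (norm z powr (- (d + s)) * \<bar>V x - V (x - z)\<bar>))) \<le> ennreal (C1 / \<kappa> * (?X + ?Y))"
            by (rule ennreal_leI)
          moreover have "ennreal (\<bar>u x\<bar> powr (p - 1) * (C1 * (norm z powr (- (d + s)) * \<bar>V x - V (x - z)\<bar>)))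
            = ennreal (\<bar>u x\<bar> powr (p - 1)) * (ennreal C1 * ennreal (norm z powr (- (d + s)) * \<bar>V x - V (x - z)\<bar>))"
            using C1(1) by (subst ennreal_mult, simp, simp) (subst ennreal_mult, simp_all)
          moreover have "ennreal (C1 / \<kappa> * (?X + ?Y)) = ennreal (C1 / \<kappa>) * (ennreal ?X + ennreal ?Y)"
            using C1(1) \<kappa> by (subst ennreal_mult, simp, simp) (subst ennreal_plus, simp_all)
          ultimately show "ennreal (\<bar>u x\<bar> powr (p - 1)) * (ennreal C1 * ennreal (norm z powr (- (d + s)) * \<bar>V x - V (x - z)\<bar>))
            \<le> ennreal (C1 / \<kappa>) * (ennreal ?X + ennreal ?Y)"
            by (simp only:)
        qed
        finally show "ennreal (\<bar>u x\<bar> powr (p - 1)) * ennreal \<bar>u x\<bar> \<le> (\<integral>\<^sup>+z. ennreal (C1 / \<kappa>) *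
          (ennreal (norm z powr (- (d + s)) * (\<bar>u x\<bar> powr (p - 1) * \<bar>max 0 (v x) - max 0 (v (x - z))\<bar>))
         + ennreal (norm z powr (- (d + s)) * (\<bar>u x\<bar> powr (p - 1) * \<bar>max 0 (- v x) - max 0 (- v (x - z))\<bar>))) \<partial>lborel)" .
      qed
      also have "\<dots> = (\<integral>\<^sup>+z. \<integral>\<^sup>+x. ennreal (C1 / \<kappa>) *
          (ennreal (norm z powr (- (d + s)) * (\<bar>u x\<bar> powr (p - 1) * \<bar>max 0 (v x) - max 0 (v (x - z))\<bar>))
         + ennreal (norm z powr (- (d + s)) * (\<bar>u x\<bar> powr (p - 1) * \<bar>max 0 (- v x) - max 0 (- v (x - z))\<bar>))) \<partial>lborel \<partial>lborel)"
        by (rule lborel_pair.Fubini') measurable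
      also have "\<dots> = ennreal (C1 / \<kappa>) * (Q v + Q (\<lambda>x. - v x))"
        unfolding Q_def by (simp add: nn_integral_cmult nn_integral_add)
      also have "\<dots> \<le> ennreal (C1 / \<kappa>) * (ennreal (C2 * A powr (1 - 1/p) * m) + ennreal (C2 * A powr (1 - 1/p) * m))"
        by (intro mult_left_mono add_mono Qv Qmv) simp
      also have "\<dots> = ennreal (C * A powr (1 - 1/p) * m)"
        using C1(1) C2(1) \<kappa> m by (simp add: C_def ennreal_mult[symmetric] ennreal_plus[symmetric] mult.assoc del: ennreal_plus)
      finally have "A \<le> C * A powr (1 - 1/p) * m"
        using C m by (subst (asm) ennreal_le_iff) auto
      \<comment> \<open>Cancelling \<open>A powr (1 - 1/p)\<close> leaves the Lp norm of
        \<open>u\<close> on the left.\<close>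
      moreover have "A = A powr (1/p) * A powr (1 - 1/p)"
        using A0 by (simp add: powr_add[symmetric])
      ultimately have "A powr (1/p) * A powr (1 - 1/p) \<le> (C * m) * A powr (1 - 1/p)"
        by (simp add: ac_simps)
      then have "A powr (1/p) \<le> C * m"
        using A0 by (subst (asm) mult_le_cancel_right) auto
      then have "ennreal (A powr (1/p)) \<le> ennreal (C * m)" by (rule ennreal_leI)
      then show "ennreal (A powr (1/p)) \<le> ennreal C * ?I"
        using C m by (simp add: ennreal_mult)
    qed
  qed (rule C)
qed

end
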